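(* Let $G=(A\cup P,E)$ be a bipartite graph in which every applicant $a\in A$ ranks its neighbours in $P$ in a preference list (ties allowed), every vertex $u\in A\cup P$ has a positive integer quota $q(u)$, and every vertex $u\in A\cup P$ has a classification $\mathcal{C}_u$ over its neighbourhood $N(u)$ that is a laminar family, each class $C\in\mathcal{C}_u$ having a quota $q(C)$. Then there is an algorithm running in time $O(|E|^2)$ that computes a feasible matching of $G$ that is rank-maximal among all feasible matchings of $G$.
   Context: An edge $(a,p)\in E$ has rank $k$ if $p$ is a $k$-th choice of $a$; let $r$ be the largest rank. A matching is a subset $M\subseteq E$; $M(u)$ denotes the set of neighbours of $u$ in $M$ (vertices may have several partners). $M$ is feasible if for every vertex $u$, $|M(u)|\le q(u)$ and for every class $C\in\mathcal{C}_u$, $|M(u)\cap C|\le q(C)$. The signature of $M$ is $(x_1,\dots,x_r)$ where $x_k$ is the number of rank-$k$ edges in $M$; signatures are compared lexicographically ($M\succ M'$ if for some $k$, $x_i=x'_i$ for $i<k$ and $x_k>x'_k$). A feasible matching is rank-maximal among feasible matchings if no feasible matching has a lexicographically larger signature. A family $\mathcal{F}$ of sets is laminar if for all $X,Y\in\mathcal{F}$, $X\subseteq Y$, $Y\subseteq X$ or $X\cap Y=\emptyset$. *)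

theory Defs
  imports Complex_Main "HOL-Library.Landau_Symbols"
begin

section \<open>Rank-maximal matchings under classifications\<close>

text \<open>
  Vertices are named by arbitrary natural numbers.  \<open>pref I a\<close> is the preference list of \<open>a\<close>: a list
  of tie groups, most preferred first.  \<open>class_quota I u C\<close> also takes the owner \<open>u\<close> of the
  class, since the same set can be a class of several vertices, with different quotas.
\<close>

record cm_instance =
  applicants :: "nat set"
  posts :: "nat set"
  edges :: "(nat \<times> nat) set"
  pref :: "nat \<Rightarrow> nat set list"
  quota :: "nat \<Rightarrow> nat"
  classes :: "nat \<Rightarrow> nat set set"
  class_quota :: "nat \<Rightarrow> nat set \<Rightarrow> nat"

definition vertices :: "cm_instance \<Rightarrow> nat set" where
  "vertices I = applicants I \<union> posts I"

definition partners :: "(nat \<times> nat) set \<Rightarrow> nat \<Rightarrow> nat set" where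
  "partners M u = {v. (u, v) \<in> M \<or> (v, u) \<in> M}"

definition laminar :: "'a set set \<Rightarrow> bool" where
  "laminar F \<longleftrightarrow> (\<forall>X\<in>F. \<forall>Y\<in>F. X \<subseteq> Y \<or> Y \<subseteq> X \<or> X \<inter> Y = {})"

definition preference_list :: "nat set list \<Rightarrow> nat set \<Rightarrow> bool" where
  "preference_list gs X \<longleftrightarrow>
     \<Union> (set gs) = X \<and> {} \<notin> set gs \<and>
     (\<forall>i<length gs. \<forall>j<length gs. i \<noteq> j \<longrightarrow> gs ! i \<inter> gs ! j = {})"

definition valid_instance :: "cm_instance \<Rightarrow> bool" where
  "valid_instance I \<longleftrightarrow>
     finite (applicants I) \<and> finite (posts I) \<and> applicants I \<inter> posts I = {} \<and>
     edges I \<subseteq> applicants I \<times> posts I \<and>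
     (\<forall>a\<in>applicants I. preference_list (pref I a) (partners (edges I) a)) \<and>
     (\<forall>u\<in>vertices I. 0 < quota I u \<and>
        (\<forall>C\<in>classes I u. C \<subseteq> partners (edges I) u) \<and> laminar (classes I u))"

definition has_rank :: "cm_instance \<Rightarrow> nat \<times> nat \<Rightarrow> nat \<Rightarrow> bool" where
  "has_rank I e k \<longleftrightarrow>
     1 \<le> k \<and> k \<le> length (pref I (fst e)) \<and> snd e \<in> pref I (fst e) ! (k - 1)"

text \<open>The \<open>0\<close> only matters for an instance without edges.\<close>

definition max_rank :: "cm_instance \<Rightarrow> nat" where
  "max_rank I = Max (insert 0 {k. \<exists>e\<in>edges I. has_rank I e k})"

definition feasible :: "cm_instance \<Rightarrow> (nat \<times> nat) set \<Rightarrow> bool" where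
  "feasible I M \<longleftrightarrow>
     M \<subseteq> edges I \<and>
     (\<forall>u\<in>vertices I. card (partners M u) \<le> quota I u \<and>
        (\<forall>C\<in>classes I u. card (partners M u \<inter> C) \<le> class_quota I u C))"

definition signature :: "cm_instance \<Rightarrow> (nat \<times> nat) set \<Rightarrow> nat list" where
  "signature I M = map (\<lambda>k. card {e \<in> M. has_rank I e k}) [1..<Suc (max_rank I)]"

definition lex_larger :: "nat list \<Rightarrow> nat list \<Rightarrow> bool" where
  "lex_larger xs ys \<longleftrightarrow> (\<exists>k<length xs. (\<forall>i<k. xs ! i = ys ! i) \<and> xs ! k > ys ! k)"

definition rank_maximal :: "cm_instance \<Rightarrow> (nat \<times> nat) set \<Rightarrow> bool" where
  "rank_maximal I M \<longleftrightarrow>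
     feasible I M \<and> (\<nexists>M'. feasible I M' \<and> lex_larger (signature I M') (signature I M))"


section \<open>Machine model\<close>

text \<open>
  A random access machine with uniform cost, presented as a structured language: the memory consists
  of named arrays of natural numbers, a scalar being cell \<open>0\<close> of an array.  A program
  mentions finitely many arrays, so interleaving them in one address space costs a constant
  factor.  The operations are addition, truncated subtraction, comparison and indirect
  access; multiplication is left out, because together with unit cost it
  would make the model unrealistically strong.  Every expression node, every write and every test
  takes one time unit.
\<close>

type_synonym vname = string
type_synonym state = "vname \<Rightarrow> nat \<Rightarrow> nat"

datatype aexp = Num nat | Read vname aexp | Add aexp aexp | Sub aexp aexp

datatype bexp = Less aexp aexp | Equal aexp aexp | Neg bexp | And bexp bexp

datatype com =
    Skip
  | Write vname aexp aexp
  | Seq com com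
  | Cond bexp com com
  | While bexp com

fun aval :: "aexp \<Rightarrow> state \<Rightarrow> nat" where
  "aval (Num n) s = n"
| "aval (Read x a) s = s x (aval a s)"
| "aval (Add a b) s = aval a s + aval b s"
| "aval (Sub a b) s = aval a s - aval b s"

fun acost :: "aexp \<Rightarrow> nat" where
  "acost (Num n) = 1"
| "acost (Read x a) = 1 + acost a"
| "acost (Add a b) = 1 + acost a + acost b"
| "acost (Sub a b) = 1 + acost a + acost b"

fun bval :: "bexp \<Rightarrow> state \<Rightarrow> bool" where
  "bval (Less a b) s \<longleftrightarrow> aval a s < aval b s"
| "bval (Equal a b) s \<longleftrightarrow> aval a s = aval b s"
| "bval (Neg b) s \<longleftrightarrow> \<not> bval b s"
| "bval (And b c) s \<longleftrightarrow> bval b s \<and> bval c s"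

fun bcost :: "bexp \<Rightarrow> nat" where
  "bcost (Less a b) = 1 + acost a + acost b"
| "bcost (Equal a b) = 1 + acost a + acost b"
| "bcost (Neg b) = 1 + bcost b"
| "bcost (And b c) = 1 + bcost b + bcost c"

text \<open>\<open>exec c s t s'\<close>: program \<open>c\<close> started in \<open>s\<close> halts after \<open>t\<close> time units in \<open>s'\<close>.\<close>

inductive exec :: "com \<Rightarrow> state \<Rightarrow> nat \<Rightarrow> state \<Rightarrow> bool" where
  Skip: "exec Skip s 1 s"
| Write: "exec (Write x i a) s (1 + acost i + acost a) (s(x := (s x)(aval i s := aval a s)))"
| Seq: "exec c s t s' \<Longrightarrow> exec d s' t' s'' \<Longrightarrow> exec (Seq c d) s (t + t') s''"
| CondTrue: "bval b s \<Longrightarrow> exec c s t s' \<Longrightarrow> exec (Cond b c d) s (1 + bcost b + t) s'"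
| CondFalse: "\<not> bval b s \<Longrightarrow> exec d s t s' \<Longrightarrow> exec (Cond b c d) s (1 + bcost b + t) s'"
| WhileFalse: "\<not> bval b s \<Longrightarrow> exec (While b c) s (1 + bcost b) s"
| WhileTrue: "bval b s \<Longrightarrow> exec c s t s' \<Longrightarrow> exec (While b c) s' t' s'' \<Longrightarrow>
    exec (While b c) s (1 + bcost b + t + t') s''"

lemma exec_deterministic:
  "exec c s t s' \<Longrightarrow> exec c s u s'' \<Longrightarrow> t = u \<and> s' = s''"
proof (induction arbitrary: u s'' rule: exec.induct)
  case (Skip s)
  then show ?case by cases auto
next
  case (Write x i a s)
  then show ?case by cases auto
next
  case (Seq c s t s' d t' sa)
  from Seq.prems obtain t1 s1 t2 where "exec c s t1 s1" "exec d s1 t2 s''" "u = t1 + t2"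
    by cases auto
  with Seq.IH(1)[of t1 s1] Seq.IH(2)[of t2 s''] show ?case by simp
next
  case (CondTrue b s c t s' d)
  from CondTrue.prems CondTrue.hyps(1) obtain t1 where "exec c s t1 s''" "u = 1 + bcost b + t1"
    by cases auto
  with CondTrue.IH[of t1 s''] show ?case by simp
next
  case (CondFalse b s d t s' c)
  from CondFalse.prems CondFalse.hyps(1) obtain t1 where "exec d s t1 s''" "u = 1 + bcost b + t1"
    by cases auto
  with CondFalse.IH[of t1 s''] show ?case by simp
next
  case (WhileFalse b s c)
  from WhileFalse.prems WhileFalse.hyps show ?case by cases auto
next
  case (WhileTrue b s c t s' t' sa)
  from WhileTrue.prems WhileTrue.hyps(1) obtain t1 s1 t2
    where "exec c s t1 s1" "exec (While b c) s1 t2 s''" "u = 1 + bcost b + t1 + t2"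
    by cases auto
  with WhileTrue.IH(1)[of t1 s1] WhileTrue.IH(2)[of t2 s''] show ?case by simp
qed


section \<open>Input and output\<close>

definition stores :: "state \<Rightarrow> vname \<Rightarrow> nat \<Rightarrow> nat list \<Rightarrow> bool" where
  "stores s x k xs \<longleftrightarrow> (\<forall>i<length xs. s x (k + i) = xs ! i)"

definition input_arrays :: "vname set" where
  "input_arrays =
     {''edge_count'', ''edge_applicant'', ''edge_post'', ''edge_rank'', ''quota'',
      ''class_count'', ''class_start'', ''class_quota'',
      ''member_count'', ''member_start'', ''member''}"

text \<open>
  The edges are listed, each once and in any order, with endpoints and rank.  The quotas and
  classes are accessed through the vertex: the classes of \<open>u\<close>, each listed once and in any
  order, occupy consecutive class numbers beginning at \<open>class_start[u]\<close>, and the elements of the class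
  with number \<open>c\<close>, each listed once and in any order, occupy consecutive cells of
  \<open>member\<close> beginning at \<open>member_start[c]\<close>.  So a program can ignore isolated vertices, whose number
  is not bounded by the number of edges.  All non-input arrays are initially zero; input cells not
  mentioned have arbitrary contents.
\<close>

definition encodes :: "cm_instance \<Rightarrow> state \<Rightarrow> bool" where
  "encodes I s \<longleftrightarrow>
     (\<exists>es. distinct es \<and> set es = edges I \<and>
        s ''edge_count'' 0 = length es \<and>
        stores s ''edge_applicant'' 0 (map fst es) \<and>
        stores s ''edge_post'' 0 (map snd es) \<and>
        (\<forall>i<length es. has_rank I (es ! i) (s ''edge_rank'' i))) \<and>
     (\<forall>u\<in>vertices I. s ''quota'' u = quota I u) \<and>
     (\<forall>u\<in>vertices I. \<exists>Cs. distinct Cs \<and> set Cs = classes I u \<and>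
        s ''class_count'' u = length Cs \<and>
        (\<forall>j<length Cs. let c = s ''class_start'' u + j in
           s ''class_quota'' c = class_quota I u (Cs ! j) \<and>
           (\<exists>xs. distinct xs \<and> set xs = Cs ! j \<and>
              s ''member_count'' c = length xs \<and>
              stores s ''member'' (s ''member_start'' c) xs))) \<and>
     (\<forall>x i. x \<notin> input_arrays \<longrightarrow> s x i = 0)"

definition output_edges :: "state \<Rightarrow> (nat \<times> nat) set" where
  "output_edges s =
     {(s ''out_applicant'' i, s ''out_post'' i) | i. i < s ''out_count'' 0}"

lemma encoding_exists:
  assumes "valid_instance I"
  shows "\<exists>s. encodes I s"
proof -
  let ?V = "vertices I"
  have finV: "finite ?V" using assms by (simp add: valid_instance_def vertices_def)
  have "finite (edges I)"
    using assms by (meson finite_cartesian_product finite_subset valid_instance_def)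
  then obtain es where es: "set es = edges I" "distinct es"
    using finite_distinct_list by blast
  have sub: "C \<subseteq> ?V" if "u \<in> ?V" "C \<in> classes I u" for u C
  proof -
    have "C \<subseteq> partners (edges I) u" using assms that by (simp add: valid_instance_def)
    moreover have "edges I \<subseteq> applicants I \<times> posts I" using assms by (simp add: valid_instance_def)
    ultimately show ?thesis unfolding partners_def vertices_def by blast
  qed
  define L where "L = (\<lambda>X::nat set. SOME xs. distinct xs \<and> set xs = X)"
  have L: "distinct (L X) \<and> set (L X) = X" if "finite X" for X
    unfolding L_def
    by (rule someI_ex[of "\<lambda>xs. distinct xs \<and> set xs = X"]) (use finite_distinct_list[OF that] in blast)
  define D where "D = (\<lambda>F::nat set set. SOME xs. distinct xs \<and> set xs = F)"
  have D: "distinct (D F) \<and> set (D F) = F" if "finite F" for F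
    unfolding D_def
    by (rule someI_ex[of "\<lambda>xs. distinct xs \<and> set xs = F"]) (use finite_distinct_list[OF that] in blast)
  define N where "N = Suc (2 ^ card ?V)"
  define K where "K = Suc (card ?V)"
  have finC: "finite (classes I u)" if "u \<in> ?V" for u
    by (rule finite_subset[of _ "Pow ?V"]) (use sub that finV in auto)
  have lenC: "length (D (classes I u)) < N" if "u \<in> ?V" for u
  proof -
    have "card (classes I u) \<le> card (Pow ?V)"
      using sub that finV by (intro card_mono) auto
    then show ?thesis
      using D[OF finC[OF that]] by (metis N_def card_Pow distinct_card finV less_Suc_eq_le)
  qed
  have lenL: "length (L C) < K" if "u \<in> ?V" "C \<in> classes I u" for u C
    using L[of C] sub[OF that] finV
    by (metis K_def card_mono distinct_card finite_subset less_Suc_eq_le)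
  have rank: "\<exists>k. has_rank I e k" if e: "e \<in> edges I" for e
  proof -
    obtain a p where ap: "e = (a, p)" by (cases e)
    then have "a \<in> applicants I" "p \<in> partners (edges I) a"
      using assms e by (auto simp: valid_instance_def partners_def)
    then have "p \<in> \<Union> (set (pref I a))"
      using assms by (simp add: valid_instance_def preference_list_def)
    then obtain i where "i < length (pref I a)" "p \<in> pref I a ! i"
      by (auto simp: in_set_conv_nth)
    then have "has_rank I e (Suc i)" by (simp add: ap has_rank_def)
    then show ?thesis ..
  qed
  define cl where "cl = (\<lambda>c. D (classes I (c div N)) ! (c mod N))"
  define s :: state where "s = (\<lambda>x i.
     if x = ''edge_count'' then length es
     else if x = ''edge_applicant'' then fst (es ! i)
     else if x = ''edge_post'' then snd (es ! i)
     else if x = ''edge_rank'' then (SOME k. has_rank I (es ! i) k)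
     else if x = ''quota'' then quota I i
     else if x = ''class_count'' then length (D (classes I i))
     else if x = ''class_start'' then i * N
     else if x = ''class_quota'' then class_quota I (i div N) (cl i)
     else if x = ''member_count'' then length (L (cl i))
     else if x = ''member_start'' then i * K
     else if x = ''member'' then L (cl (i div K)) ! (i mod K)
     else 0)"
  have E: "\<exists>es. distinct es \<and> set es = edges I \<and> s ''edge_count'' 0 = length es \<and>
        stores s ''edge_applicant'' 0 (map fst es) \<and> stores s ''edge_post'' 0 (map snd es) \<and>
        (\<forall>i<length es. has_rank I (es ! i) (s ''edge_rank'' i))"
  proof (intro exI[of _ es] conjI allI impI)
    fix i assume "i < length es"
    then have "\<exists>k. has_rank I (es ! i) k" using rank es(1) nth_mem by blast
    then show "has_rank I (es ! i) (s ''edge_rank'' i)"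
      by (simp add: s_def someI_ex)
  qed (use es in \<open>simp_all add: s_def stores_def\<close>)
  have C: "\<exists>Cs. distinct Cs \<and> set Cs = classes I u \<and> s ''class_count'' u = length Cs \<and>
        (\<forall>j<length Cs. let c = s ''class_start'' u + j in
           s ''class_quota'' c = class_quota I u (Cs ! j) \<and>
           (\<exists>xs. distinct xs \<and> set xs = Cs ! j \<and> s ''member_count'' c = length xs \<and>
              stores s ''member'' (s ''member_start'' c) xs))" if u: "u \<in> ?V" for u
  proof (intro exI[of _ "D (classes I u)"] conjI allI impI)
    fix j assume j: "j < length (D (classes I u))"
    then have jN: "j < N" using lenC[OF u] by simp
    let ?C = "D (classes I u) ! j"
    have mem: "?C \<in> classes I u" using j D[OF finC[OF u]] nth_mem by blast
    have finX: "finite ?C" using sub[OF u mem] finV finite_subset by blast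
    have div: "(u * N + j) div N = u" "(u * N + j) mod N = j" using jN by simp_all
    have cl: "cl (u * N + j) = ?C" by (simp only: cl_def div)
    have "stores s ''member'' ((u * N + j) * K) (L ?C)"
      unfolding stores_def
    proof (intro allI impI)
      fix i assume "i < length (L ?C)"
      then have "i < K" using lenL[OF u mem] by simp
      then have "((u * N + j) * K + i) div K = u * N + j" "((u * N + j) * K + i) mod K = i"
        by simp_all
      then show "s ''member'' ((u * N + j) * K + i) = L ?C ! i"
        by (simp add: s_def cl)
    qed
    then show "let c = s ''class_start'' u + j in
           s ''class_quota'' c = class_quota I u ?C \<and>
           (\<exists>xs. distinct xs \<and> set xs = ?C \<and> s ''member_count'' c = length xs \<and>
              stores s ''member'' (s ''member_start'' c) xs)"
      unfolding Let_def using L[OF finX]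
      by (intro conjI exI[of _ "L ?C"]) (simp_all add: s_def cl div(1))
  qed (use D[OF finC[OF u]] in \<open>simp_all add: s_def\<close>)
  have "encodes I s"
    unfolding encodes_def
  proof (intro conjI ballI allI impI)
    show "s ''quota'' u = quota I u" for u by (simp add: s_def)
    show "s x i = 0" if "x \<notin> input_arrays" for x i
      using that by (auto simp: input_arrays_def s_def)
  qed (use E C in auto)
  then show ?thesis by blast
qed

end

theory Submission
  imports Defs
begin

text \<open>
  A matching is a flow: for each vertex the root (its quota) and its classes form a forest ordered by
  inclusion, and an edge of the instance is a unit link from the smallest class of its applicant to
  the smallest class of its post.  Ranks are treated one after the other.  In stage \<open>k\<close> the flow is
  augmented along the links that are not frozen, using edges of rank at most \<open>k\<close>.  When the
  sink is out of reach, every link that crosses the boundary of the reachable set \<open>R\<close> is frozen; an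
  edge of rank above \<open>k\<close> is frozen unless it leaves \<open>R\<close>.  This keeps the counts of the ranks
  up to \<open>k\<close> maximal for ever.

  The reason is linear programming duality.  With \<open>\<beta>\<close> larger than every count, the weights
  \<open>w\<^sub>k e = \<beta> * w\<^sub>k\<^sub>-\<^sub>1 e + (if rank e \<le> k then 1 else 0)\<close> order matchings lexicographically.
  If \<open>\<pi>\<close> is an optimal dual solution for \<open>w\<^sub>k\<^sub>-\<^sub>1\<close>, then
  \<open>\<pi>' z = \<beta> * \<pi> z + (if z is on the side of the applicants then 1 else 0) - (if z \<in> R then 1 else 0)\<close>
  is one for \<open>w\<^sub>k\<close> at the end of stage \<open>k\<close>.  Exactly the links with nonzero reduced cost are
  frozen, and scaling by \<open>\<beta>\<close> preserves their signs, so the program needs the flags only, not the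
  potentials.

  A laminar family of nonempty subsets of an \<open>n\<close>-set has at most \<open>2 * n\<close> members, so the network has
  size \<open>O(m)\<close>.  There are at most \<open>m\<close> augmentations and \<open>m\<close> stages, and each takes one search.
\<close>

section \<open>Total correctness with running times\<close>

definition runs :: "com \<Rightarrow> state \<Rightarrow> nat \<Rightarrow> (state \<Rightarrow> bool) \<Rightarrow> bool" where
  "runs c s b Q \<longleftrightarrow> (\<exists>t s'. exec c s t s' \<and> t \<le> b \<and> Q s')"

fun written :: "com \<Rightarrow> vname set" where
  "written Skip = {}"
| "written (Write x i a) = {x}"
| "written (Seq c d) = written c \<union> written d"
| "written (Cond b c d) = written c \<union> written d"
| "written (While b c) = written c"

abbreviation unchanged_except :: "vname set \<Rightarrow> state \<Rightarrow> state \<Rightarrow> bool" where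
  "unchanged_except X s s' \<equiv> \<forall>x. x \<notin> X \<longrightarrow> s' x = s x"

fun loop_free :: "com \<Rightarrow> bool" where
  "loop_free Skip \<longleftrightarrow> True"
| "loop_free (Write x i a) \<longleftrightarrow> True"
| "loop_free (Seq c d) \<longleftrightarrow> loop_free c \<and> loop_free d"
| "loop_free (Cond b c d) \<longleftrightarrow> loop_free c \<and> loop_free d"
| "loop_free (While b c) \<longleftrightarrow> False"

text \<open>The value of \<open>effect\<close> and \<open>max_cost\<close> on a loop is irrelevant.\<close>

fun effect :: "com \<Rightarrow> state \<Rightarrow> state" where
  "effect Skip s = s"
| "effect (Write x i a) s = s(x := (s x)(aval i s := aval a s))"
| "effect (Seq c d) s = effect d (effect c s)"
| "effect (Cond b c d) s = (if bval b s then effect c s else effect d s)"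
| "effect (While b c) s = s"

fun max_cost :: "com \<Rightarrow> nat" where
  "max_cost Skip = 1"
| "max_cost (Write x i a) = 1 + acost i + acost a"
| "max_cost (Seq c d) = max_cost c + max_cost d"
| "max_cost (Cond b c d) = 1 + bcost b + max_cost c + max_cost d"
| "max_cost (While b c) = 0"

lemma exec_unchanged: "exec c s t s' \<Longrightarrow> unchanged_except (written c) s s'"
  by (induction rule: exec.induct) auto

lemma runs_weaken: "runs c s b Q \<Longrightarrow> b \<le> b' \<Longrightarrow> (\<And>s'. Q s' \<Longrightarrow> Q' s') \<Longrightarrow> runs c s b' Q'"
  unfolding runs_def by (meson le_trans)

lemma runs_frame:
  assumes "runs c s b Q"
    and "\<And>s'. Q s' \<Longrightarrow> unchanged_except (written c) s s' \<Longrightarrow> Q' s'"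
  shows "runs c s b Q'"
  using assms exec_unchanged unfolding runs_def by meson

lemma runs_Skip: "Q s \<Longrightarrow> 1 \<le> b \<Longrightarrow> runs Skip s b Q"
  unfolding runs_def using exec.Skip by blast

lemma runs_Write:
  "Q (s(x := (s x)(aval i s := aval a s))) \<Longrightarrow> 1 + acost i + acost a \<le> b \<Longrightarrow> runs (Write x i a) s b Q"
  unfolding runs_def using exec.Write by blast

lemma runs_Seq:
  assumes "runs c s b R"
    and "\<And>s'. R s' \<Longrightarrow> unchanged_except (written c) s s' \<Longrightarrow> runs d s' b' Q"
    and "b + b' \<le> B"
  shows "runs (Seq c d) s B Q"
proof -
  obtain t s' where c: "exec c s t s'" "t \<le> b" "R s'" using assms(1) unfolding runs_def by blast
  then obtain t' s'' where d: "exec d s' t' s''" "t' \<le> b'" "Q s''"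
    using assms(2)[OF c(3) exec_unchanged[OF c(1)]] unfolding runs_def by blast
  have "t + t' \<le> B" using c(2) d(2) assms(3) by linarith
  then show ?thesis using exec.Seq[OF c(1) d(1)] d(3) unfolding runs_def by blast
qed

lemma runs_Cond:
  assumes "bval b s \<Longrightarrow> runs c s k Q" "\<not> bval b s \<Longrightarrow> runs d s k Q" "1 + bcost b + k \<le> B"
  shows "runs (Cond b c d) s B Q"
proof (cases "bval b s")
  case True
  then obtain t s' where "exec c s t s'" "t \<le> k" "Q s'" using assms(1) unfolding runs_def by blast
  moreover from this have "1 + bcost b + t \<le> B" using assms(3) by linarith
  ultimately show ?thesis using exec.CondTrue[OF True] unfolding runs_def by blast
next
  case False
  then obtain t s' where "exec d s t s'" "t \<le> k" "Q s'" using assms(2) unfolding runs_def by blast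
  moreover from this have "1 + bcost b + t \<le> B" using assms(3) by linarith
  ultimately show ?thesis using exec.CondFalse[OF False] unfolding runs_def by blast
qed

lemma runs_loop_free_effect: "loop_free c \<Longrightarrow> runs c s (max_cost c) (\<lambda>s'. s' = effect c s)"
proof (induction c arbitrary: s)
  case Skip
  show ?case by (rule runs_Skip) simp_all
next
  case (Write x i a)
  show ?case by (rule runs_Write) simp_all
next
  case (Seq c d)
  then show ?case by (intro runs_Seq[OF Seq.IH(1)]) auto
next
  case (Cond b c d)
  have "runs c s (max_cost c + max_cost d) (\<lambda>s'. s' = effect c s)"
    "runs d s (max_cost c + max_cost d) (\<lambda>s'. s' = effect d s)"
    using Cond.prems by (auto intro: runs_weaken[OF Cond.IH(1)] runs_weaken[OF Cond.IH(2)])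
  then show ?case by (intro runs_Cond[where k = "max_cost c + max_cost d"]) (auto elim: runs_weaken)
qed simp

lemma runs_loop_free:
  assumes "loop_free c" "Q (effect c s)" "max_cost c \<le> b"
  shows "runs c s b Q"
  using runs_weaken[OF runs_loop_free_effect[OF assms(1)] assms(3)] assms(2) by blast

lemma runs_loop_free_Seq:
  assumes "loop_free c" "runs d (effect c s) b Q" "max_cost c + b \<le> B"
  shows "runs (Seq c d) s B Q"
  by (rule runs_Seq[OF runs_loop_free_effect[OF assms(1)] _ assms(3)]) (use assms(2) in simp)

lemma runs_While_potential:
  fixes \<Phi> k :: "state \<Rightarrow> nat"
  assumes "J s"
    and body: "\<And>s. J s \<Longrightarrow> bval b s \<Longrightarrow> runs c s (k s) (\<lambda>s'. J s' \<and> k s + 1 + bcost b + \<Phi> s' \<le> \<Phi> s)"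
  shows "runs (While b c) s (\<Phi> s + 1 + bcost b) (\<lambda>s'. J s' \<and> \<not> bval b s')"
  using \<open>J s\<close>
proof (induction "\<Phi> s" arbitrary: s rule: less_induct)
  case less
  show ?case
  proof (cases "bval b s")
    case False
    then show ?thesis using less.prems exec.WhileFalse[OF False] unfolding runs_def by fastforce
  next
    case True
    then obtain t s1 where c: "exec c s t s1" "t \<le> k s" "J s1" "k s + 1 + bcost b + \<Phi> s1 \<le> \<Phi> s"
      using body less.prems unfolding runs_def by blast
    then obtain t' s2 where w: "exec (While b c) s1 t' s2" "t' \<le> \<Phi> s1 + 1 + bcost b" "J s2" "\<not> bval b s2"
      using less.hyps[of s1] unfolding runs_def by auto
    have "1 + bcost b + t + t' \<le> \<Phi> s + 1 + bcost b" using c w by linarith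
    then show ?thesis using exec.WhileTrue[OF True c(1) w(1)] w unfolding runs_def by blast
  qed
qed

lemma runs_While:
  fixes \<mu> :: "state \<Rightarrow> nat"
  assumes init: "J s"
    and body: "\<And>s'. J s' \<Longrightarrow> bval b s' \<Longrightarrow> unchanged_except (written c) s s' \<Longrightarrow>
      runs c s' k (\<lambda>s''. J s'' \<and> \<mu> s'' < \<mu> s')"
    and exit: "\<And>s'. J s' \<Longrightarrow> \<not> bval b s' \<Longrightarrow> unchanged_except (written c) s s' \<Longrightarrow> Q s'"
    and bound: "\<mu> s * (k + 1 + bcost b) + 1 + bcost b \<le> B"
  shows "runs (While b c) s B Q"
proof -
  let ?J = "\<lambda>s'. J s' \<and> unchanged_except (written c) s s'"
  let ?\<Phi> = "\<lambda>s'. \<mu> s' * (k + 1 + bcost b)"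
  have "runs (While b c) s (?\<Phi> s + 1 + bcost b) (\<lambda>s'. ?J s' \<and> \<not> bval b s')"
  proof (rule runs_While_potential[where k = "\<lambda>_. k"])
    fix s' assume J: "?J s'" and b: "bval b s'"
    show "runs c s' k (\<lambda>s''. ?J s'' \<and> k + 1 + bcost b + ?\<Phi> s'' \<le> ?\<Phi> s')"
    proof (rule runs_frame[OF body])
      fix s'' assume "J s'' \<and> \<mu> s'' < \<mu> s'" and "unchanged_except (written c) s' s''"
      moreover from this have "Suc (\<mu> s'') * (k + 1 + bcost b) \<le> ?\<Phi> s'" by (intro mult_le_mono1) simp
      ultimately show "?J s'' \<and> k + 1 + bcost b + ?\<Phi> s'' \<le> ?\<Phi> s'" using J by simp
    qed (use J b in auto)
  qed (use init in simp)
  then show ?thesis by (rule runs_weaken) (use exit bound in auto)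
qed

abbreviation V :: "vname \<Rightarrow> aexp" where "V x \<equiv> Read x (Num 0)"

abbreviation assign :: "vname \<Rightarrow> aexp \<Rightarrow> com" (infix "::=" 61) where
  "x ::= a \<equiv> Write x (Num 0) a"

notation Seq (infixr ";;" 60)

definition For :: "vname \<Rightarrow> aexp \<Rightarrow> com \<Rightarrow> com" where
  "For x e c = (x ::= Num 0;; While (Less (V x) e) (c;; x ::= Add (V x) (Num 1)))"

lemma written_For [simp]: "written (For x e c) = insert x (written c)"
  by (auto simp: For_def)

text \<open>The invariant has to be insensitive to the loop variable, so it takes the loop count as an argument.\<close>

lemma runs_For_loop:
  assumes fresh: "x \<notin> written c"
    and limit: "\<And>s'. unchanged_except (insert x (written c)) s s' \<Longrightarrow> aval e s' = n"
    and insensitive: "\<And>i s' v. I i s' \<Longrightarrow> I i (s'(x := v))"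
    and body: "\<And>i s'. i < n \<Longrightarrow> I i s' \<Longrightarrow> s' x 0 = i \<Longrightarrow> unchanged_except (insert x (written c)) s s' \<Longrightarrow>
      runs c s' (k i) (I (Suc i))"
    and start: "I 0 s0" "s0 x 0 = 0" "unchanged_except (insert x (written c)) s s0"
  shows "runs (While (Less (V x) e) (c;; x ::= Add (V x) (Num 1))) s0
    ((\<Sum>i<n. k i) + n * (acost e + 10) + 1 + bcost (Less (V x) e))
    (\<lambda>s'. I n s' \<and> unchanged_except (insert x (written c)) s s')"
proof -
  let ?b = "Less (V x) e" and ?c = "c;; x ::= Add (V x) (Num 1)"
  let ?J = "\<lambda>s'. s' x 0 \<le> n \<and> I (s' x 0) s' \<and> unchanged_except (insert x (written c)) s s'"
  let ?\<Phi> = "\<lambda>s'. \<Sum>i\<in>{s' x 0..<n}. k i + acost e + 10"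
  have "runs (While ?b ?c) s0 (?\<Phi> s0 + 1 + bcost ?b) (\<lambda>s'. ?J s' \<and> \<not> bval ?b s')"
  proof (rule runs_While_potential[where k = "\<lambda>s'. k (s' x 0) + 6"])
    fix s' assume J: "?J s'" and b: "bval ?b s'"
    let ?i = "s' x 0"
    have i: "?i < n" using b limit J by simp
    show "runs ?c s' (k ?i + 6) (\<lambda>s''. ?J s'' \<and> k ?i + 6 + 1 + bcost ?b + ?\<Phi> s'' \<le> ?\<Phi> s')"
    proof (rule runs_Seq[OF body[OF i]])
      fix s1 assume I: "I (Suc ?i) s1" and frame: "unchanged_except (written c) s' s1"
      have "?\<Phi> s' = k ?i + acost e + 10 + (\<Sum>i\<in>{Suc ?i..<n}. k i + acost e + 10)"
        using i by (simp add: sum.atLeast_Suc_lessThan)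
      then show "runs (x ::= Add (V x) (Num 1)) s1 6
          (\<lambda>s''. ?J s'' \<and> k ?i + 6 + 1 + bcost ?b + ?\<Phi> s'' \<le> ?\<Phi> s')"
        using frame fresh J i insensitive[OF I] by (intro runs_Write) auto
    qed (use J in auto)
  qed (use start in simp)
  then show ?thesis
  proof (rule runs_weaken)
    show "?\<Phi> s0 + 1 + bcost ?b \<le> (\<Sum>i<n. k i) + n * (acost e + 10) + 1 + bcost ?b"
      by (simp add: start(2) lessThan_atLeast0 sum.distrib distrib_left)
    fix s' assume J: "?J s' \<and> \<not> bval ?b s'"
    moreover from this have "aval e s' = n" using limit by blast
    ultimately have "s' x 0 = n" by simp
    then show "I n s' \<and> unchanged_except (insert x (written c)) s s'" using J by blast
  qed
qed

lemma runs_For: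
  assumes fresh: "x \<notin> written c"
    and limit: "\<And>s'. unchanged_except (insert x (written c)) s s' \<Longrightarrow> aval e s' = n"
    and insensitive: "\<And>i s' v. I i s' \<Longrightarrow> I i (s'(x := v))"
    and init: "I 0 s"
    and body: "\<And>i s'. i < n \<Longrightarrow> I i s' \<Longrightarrow> s' x 0 = i \<Longrightarrow> unchanged_except (insert x (written c)) s s' \<Longrightarrow>
      runs c s' (k i) (I (Suc i))"
    and exit: "\<And>s'. I n s' \<Longrightarrow> unchanged_except (insert x (written c)) s s' \<Longrightarrow> Q s'"
    and bound: "(\<Sum>i<n. k i) + Suc n * (acost e + 10) \<le> B"
  shows "runs (For x e c) s B Q"
  unfolding For_def
proof (rule runs_loop_free_Seq)
  let ?s0 = "effect (x ::= Num 0) s"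
  have "I 0 ?s0" "?s0 x 0 = 0" "unchanged_except (insert x (written c)) s ?s0"
    using insensitive[OF init] by (simp_all add: fun_upd_def)
  from runs_For_loop[OF fresh limit insensitive body this]
  show "runs (While (Less (V x) e) (c;; x ::= Add (V x) (Num 1))) ?s0
      ((\<Sum>i<n. k i) + n * (acost e + 10) + 1 + bcost (Less (V x) e)) Q"
    by (rule runs_weaken) (use exit in auto)
qed (use bound in simp_all)

section \<open>Flow networks between two forests\<close>

declare add_2_eq_Suc [simp del] add_2_eq_Suc' [simp del]

function ancestors :: "nat \<Rightarrow> (nat \<Rightarrow> nat) \<Rightarrow> nat \<Rightarrow> nat set" where
  "ancestors n up z = (if n \<le> z \<and> up z < z then insert z (ancestors n up (up z)) else {})"
  by pat_completeness auto
termination by (relation "measure (\<lambda>(n, up, z). z)") auto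

declare ancestors.simps [simp del]

lemma ancestors_cong:
  "(\<And>y. n \<le> y \<Longrightarrow> y \<le> z \<Longrightarrow> up y = up' y) \<Longrightarrow> ancestors n up z = ancestors n up' z"
proof (induction z rule: less_induct)
  case (less z)
  have "ancestors n up (up z) = ancestors n up' (up z)" if "n \<le> z" "up z < z"
    using less.prems that by (intro less.IH) auto
  then show ?case using less.prems[of z] by (subst (1 2) ancestors.simps) auto
qed

lemma ancestors_bounds: "x \<in> ancestors n up z \<Longrightarrow> n \<le> x \<and> x \<le> z"
proof (induction z rule: less_induct)
  case (less z)
  from less.prems have "n \<le> z \<and> up z < z \<and> (x = z \<or> x \<in> ancestors n up (up z))"
    by (subst (asm) ancestors.simps) (auto split: if_splits)
  then show ?case using less.IH[of "up z"] by auto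
qed

lemma ancestors_empty: "z < n \<or> z \<le> up z \<Longrightarrow> ancestors n up z = {}"
  by (subst ancestors.simps) auto

lemma ancestors_insert: "n \<le> z \<Longrightarrow> up z < z \<Longrightarrow> ancestors n up z = insert z (ancestors n up (up z))"
  by (subst ancestors.simps) simp

lemma finite_ancestors [simp]: "finite (ancestors n up z)"
  by (rule finite_subset[of _ "{..z}"]) (use ancestors_bounds in auto)

lemma sum_ancestors_telescope:
  fixes \<pi> :: "nat \<Rightarrow> 'a::ab_group_add"
  assumes "\<And>x. n \<le> x \<Longrightarrow> x \<le> z \<Longrightarrow> up x = r \<or> n \<le> up x \<and> up x < x" "r < n" "n \<le> z"
  shows "(\<Sum>x\<in>ancestors n up z. \<pi> x - \<pi> (up x)) = \<pi> z - \<pi> r"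
  using assms
proof (induction z rule: less_induct)
  case (less z)
  have lt: "up z < z" using less.prems(1)[of z] less.prems(2,3) by auto
  have notin: "z \<notin> ancestors n up (up z)" using ancestors_bounds[of z n up "up z"] lt by auto
  have "(\<Sum>x\<in>ancestors n up (up z). \<pi> x - \<pi> (up x)) = \<pi> (up z) - \<pi> r"
  proof (cases "up z = r")
    case True
    then show ?thesis using less.prems(2) by (simp add: ancestors_empty)
  next
    case False
    then have "n \<le> up z" using less.prems(1)[of z] less.prems(2,3) by auto
    then show ?thesis using less.IH[OF lt] less.prems lt by auto
  qed
  then show ?case using lt notin less.prems(3) by (simp add: ancestors_insert)
qed

lemma sum_fun_upd:
  fixes f :: "'a \<Rightarrow> nat"
  assumes "finite A"
  shows "(\<Sum>i\<in>A. int ((f(j := v)) i)) = (\<Sum>i\<in>A. int (f i)) + (if j \<in> A then int v - int (f j) else 0)"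
proof (cases "j \<in> A")
  case True
  then show ?thesis using assms by (simp add: sum.remove)
next
  case False
  then have "(\<Sum>i\<in>A. int ((f(j := v)) i)) = (\<Sum>i\<in>A. int (f i))" by (intro sum.cong) auto
  then show ?thesis using False by simp
qed

text \<open>
  Link \<open>j < m\<close> is the \<open>j\<close>-th edge of the instance; \<open>m\<close> and \<open>m + 1\<close> are the source and the sink.  Every
  other node \<open>x\<close> has exactly one link towards its root, also called \<open>x\<close>: it enters \<open>x\<close> in the
  forest of the applicants (\<open>x < n1\<close>) and leaves \<open>x\<close> in the forest of the posts.
\<close>

locale network =
  fixes m n1 n2 :: nat and tail head :: "nat \<Rightarrow> nat" and node_quota rank :: "nat \<Rightarrow> nat"
  assumes n1: "m + 2 \<le> n1" and n2: "n1 \<le> n2"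
    and applicant_link: "\<And>x. m + 2 \<le> x \<Longrightarrow> x < n1 \<Longrightarrow> head x = x \<and> (tail x = m \<or> m + 2 \<le> tail x \<and> tail x < x)"
    and post_link: "\<And>x. n1 \<le> x \<Longrightarrow> x < n2 \<Longrightarrow> tail x = x \<and> (head x = m + 1 \<or> n1 \<le> head x \<and> head x < x)"
    and edge_link: "\<And>j. j < m \<Longrightarrow> m + 2 \<le> tail j \<and> tail j < n1 \<and> n1 \<le> head j \<and> head j < n2"
    and rank_bounds: "\<And>j. j < m \<Longrightarrow> 1 \<le> rank j \<and> rank j \<le> m"
begin

definition tree_links :: "nat set" where
  "tree_links = {m + 2..<n2}"

definition links :: "nat set" where
  "links = {..<m} \<union> tree_links"

lemma finite_tree_links [simp]: "finite tree_links"
  by (simp add: tree_links_def)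

lemma links_cases [consumes 1, case_names edge applicant post]:
  assumes "j \<in> links"
  obtains "j < m" | "m + 2 \<le> j" "j < n1" | "n1 \<le> j" "j < n2"
  using assms n1 n2 by (fastforce simp: links_def tree_links_def)

lemma link_ends:
  assumes "j \<in> links"
  shows "tail j < n2" "head j < n2" "tail j \<noteq> head j" "j < n2"
  using assms edge_link[of j] applicant_link[of j] post_link[of j] n1 n2
  by (cases rule: links_cases; force)+

definition above :: "nat \<Rightarrow> nat set" where
  "above z = ancestors (m + 2) tail z \<union> ancestors n1 head z"

lemma above_applicant: "z < n1 \<Longrightarrow> above z = ancestors (m + 2) tail z"
  by (simp add: above_def ancestors_empty)

lemma above_post: "n1 \<le> z \<Longrightarrow> z < n2 \<Longrightarrow> above z = ancestors n1 head z"
  using post_link[of z] by (simp add: above_def ancestors_empty)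

lemma above_source [simp]: "above m = {}" and above_sink [simp]: "above (m + 1) = {}"
  using n1 by (simp_all add: above_applicant ancestors_empty)

lemma above_bounds:
  assumes "x \<in> above z" "z < n2"
  shows "m + 2 \<le> x" "x \<le> z" "x < n1 \<longleftrightarrow> z < n1"
  using assms ancestors_bounds[of x "m + 2" tail z] ancestors_bounds[of x n1 head z] n1
  by (cases "z < n1"; force simp: above_applicant above_post)+

lemma above_applicant_link:
  assumes "m + 2 \<le> x" "x < n1"
  shows "above x = insert x (above (tail x))"
proof -
  have "tail x < x" using applicant_link[OF assms] assms by auto
  then show ?thesis using assms by (simp add: above_applicant ancestors_insert)
qed

lemma above_post_link:
  assumes "n1 \<le> x" "x < n2"
  shows "above x = insert x (above (head x))"
  using assms post_link[OF assms] n1 by (fastforce simp: above_post above_applicant ancestors_insert ancestors_empty)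

definition route :: "nat \<Rightarrow> nat set" where
  "route j = above (tail j) \<union> above (head j)"

lemma route_tree_links: "j < m \<Longrightarrow> route j \<subseteq> tree_links"
  using above_bounds[of _ "tail j"] above_bounds[of _ "head j"] edge_link[of j] n1 n2
  by (fastforce simp: route_def tree_links_def)

definition class_edges :: "nat \<Rightarrow> nat set" where
  "class_edges x = {j. j < m \<and> x \<in> route j}"

lemma finite_class_edges [simp]: "finite (class_edges x)"
  by (simp add: class_edges_def)

lemma class_edges_applicant:
  assumes "x < n1"
  shows "class_edges x = {j. j < m \<and> x \<in> ancestors (m + 2) tail (tail j)}"
proof -
  have "x \<in> route j \<longleftrightarrow> x \<in> ancestors (m + 2) tail (tail j)" if "j < m" for j
    using above_bounds(3)[of x "head j"] edge_link[OF that] assms by (auto simp: route_def above_applicant)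
  then show ?thesis by (auto simp: class_edges_def)
qed

lemma class_edges_post:
  assumes "n1 \<le> x"
  shows "class_edges x = {j. j < m \<and> x \<in> ancestors n1 head (head j)}"
proof -
  have "x \<in> route j \<longleftrightarrow> x \<in> ancestors n1 head (head j)" if "j < m" for j
    using above_bounds(3)[of x "tail j"] edge_link[OF that] assms n2 by (auto simp: route_def above_post)
  then show ?thesis by (auto simp: class_edges_def)
qed

text \<open>Value of the cut around the subtree of \<open>x\<close>, signed so that link \<open>x\<close> itself counts \<open>1\<close>.\<close>

definition subtree_sign :: "nat \<Rightarrow> nat \<Rightarrow> int" where
  "subtree_sign x z = (if x \<in> above z then if x < n1 then - 1 else 1 else 0)"

lemma subtree_sign_link:
  assumes j: "j \<in> links" and x: "x \<in> tree_links"
  shows "subtree_sign x (tail j) - subtree_sign x (head j) =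
    (if j = x then 1 else if j \<in> class_edges x then - 1 else 0)"
  using j
proof (cases rule: links_cases)
  case edge
  note ends = edge_link[OF edge]
  have "j \<noteq> x" using edge x by (auto simp: tree_links_def)
  moreover have "x \<in> above (tail j) \<Longrightarrow> x < n1" using above_bounds(3)[of x "tail j"] ends n2 by simp
  moreover have "x \<in> above (head j) \<Longrightarrow> \<not> x < n1" using above_bounds(3)[of x "head j"] ends by simp
  ultimately show ?thesis using edge by (auto simp: subtree_sign_def class_edges_def route_def)
next
  case applicant
  have "head j = j" "tail j < j" using applicant applicant_link[OF applicant] by auto
  moreover from this have "j \<notin> above (tail j)" using applicant above_bounds(2)[of j "tail j"] n2 by auto
  moreover have "j \<notin> class_edges x" using applicant by (simp add: class_edges_def)
  ultimately show ?thesis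
    using applicant above_applicant_link[OF applicant] by (auto simp: subtree_sign_def)
next
  case post
  have "tail j = j" "head j < j" using post post_link[OF post] n1 by auto
  moreover from this have "j \<notin> above (head j)" using post above_bounds(2)[of j "head j"] by auto
  moreover have "j \<notin> class_edges x" using post n1 by (simp add: class_edges_def)
  ultimately show ?thesis
    using post above_post_link[OF post] by (auto simp: subtree_sign_def)
qed

lemma subtree_sign_source [simp]: "subtree_sign x m = 0"
  and subtree_sign_sink [simp]: "subtree_sign x (m + 1) = 0"
  by (simp_all only: subtree_sign_def above_source above_sink empty_iff if_False)

definition applicant_side :: "nat \<Rightarrow> int" where
  "applicant_side z = of_bool (z = m \<or> m + 2 \<le> z \<and> z < n1)"

lemma applicant_side_source [simp]: "applicant_side m = 1"
  and applicant_side_sink [simp]: "applicant_side (m + 1) = 0"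
  by (simp_all add: applicant_side_def)

lemma applicant_side_link:
  assumes "j \<in> links"
  shows "applicant_side (tail j) - applicant_side (head j) = of_bool (j < m)"
  using assms edge_link[of j] applicant_link[of j] post_link[of j] n1
  by (cases rule: links_cases) (auto simp: applicant_side_def)

definition chosen :: "(nat \<Rightarrow> nat) \<Rightarrow> nat set" where
  "chosen f = {j. j < m \<and> f j = 1}"

definition fits :: "nat set \<Rightarrow> bool" where
  "fits X \<longleftrightarrow> X \<subseteq> {..<m} \<and> (\<forall>x\<in>tree_links. card (X \<inter> class_edges x) \<le> node_quota x)"

text \<open>
  \<open>f\<close> becomes a flow when one unit is sent from the source to \<open>y\<close>.  The flow of a tree link is
  stored plus one, with its capacity, so that tree links can always be used backwards.
\<close>

definition balanced :: "(nat \<Rightarrow> nat) \<Rightarrow> nat \<Rightarrow> bool" where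
  "balanced f y \<longleftrightarrow>
     (\<forall>x\<in>tree_links. int (f x) = 1 + (\<Sum>j\<in>class_edges x. int (f j)) + subtree_sign x y)"

lemma balanced_source_iff_sink: "balanced f (m + 1) \<longleftrightarrow> balanced f m"
  unfolding balanced_def subtree_sign_source subtree_sign_sink ..

definition backward_step :: "(nat \<Rightarrow> nat) \<Rightarrow> nat \<Rightarrow> nat \<Rightarrow> nat \<Rightarrow> nat \<Rightarrow> bool" where
  "backward_step f j y y' v \<longleftrightarrow>
     y = head j \<and> y' = tail j \<and> v = f j + 1 \<or> y = tail j \<and> y' = head j \<and> 0 < f j \<and> v = f j - 1"

lemma balanced_backward_step:
  assumes "balanced f y" "j \<in> links" "backward_step f j y y' v"
  shows "balanced (f(j := v)) y'"
  unfolding balanced_def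
proof
  fix x assume x: "x \<in> tree_links"
  then have "x \<notin> class_edges x" by (auto simp: tree_links_def class_edges_def)
  moreover have "int (f x) = 1 + (\<Sum>j\<in>class_edges x. int (f j)) + subtree_sign x y"
    using assms(1) x by (simp add: balanced_def)
  moreover have "(\<Sum>i\<in>class_edges x. int ((f(j := v)) i)) =
      (\<Sum>i\<in>class_edges x. int (f i)) + (if j \<in> class_edges x then int v - int (f j) else 0)"
    by (rule sum_fun_upd) simp
  ultimately show "int ((f(j := v)) x) = 1 + (\<Sum>i\<in>class_edges x. int ((f(j := v)) i)) + subtree_sign x y'"
    using subtree_sign_link[OF assms(2) x] assms(3)
    by (auto simp del: fun_upd_apply simp: backward_step_def fun_upd_same fun_upd_other split: if_splits)
qed

lemma edge_flow_backward_step: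
  assumes "j \<in> links" "backward_step f j y y' v"
  shows "(\<Sum>i<m. int ((f(j := v)) i)) - applicant_side y' = (\<Sum>i<m. int (f i)) - applicant_side y"
proof -
  have "(\<Sum>i<m. int ((f(j := v)) i)) = (\<Sum>i<m. int (f i)) + (if j \<in> {..<m} then int v - int (f j) else 0)"
    by (rule sum_fun_upd) simp
  then show ?thesis
    using applicant_side_link[OF assms(1)] assms(2)
    by (auto simp del: fun_upd_apply simp: backward_step_def split: if_splits)
qed

subsection \<open>Linear programming duality\<close>

definition reduced :: "(nat \<Rightarrow> int) \<Rightarrow> (nat \<Rightarrow> int) \<Rightarrow> nat \<Rightarrow> int" where
  "reduced w \<pi> j = \<pi> (head j) - \<pi> (tail j) + (if j < m then w j else 0)"

lemma sum_reduced_above_applicant: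
  assumes "m + 2 \<le> z" "z < n1"
  shows "(\<Sum>x\<in>above z. reduced w \<pi> x) = \<pi> z - \<pi> m"
proof -
  have "(\<Sum>x\<in>above z. reduced w \<pi> x) = (\<Sum>x\<in>ancestors (m + 2) tail z. \<pi> x - \<pi> (tail x))"
    unfolding above_applicant[OF assms(2)]
  proof (rule sum.cong)
    fix x assume "x \<in> ancestors (m + 2) tail z"
    then have "m + 2 \<le> x" "x < n1" using ancestors_bounds assms(2) by fastforce+
    then show "reduced w \<pi> x = \<pi> x - \<pi> (tail x)" using applicant_link by (simp add: reduced_def)
  qed simp
  also have "\<dots> = \<pi> z - \<pi> m"
    by (rule sum_ancestors_telescope) (use applicant_link assms in auto)
  finally show ?thesis .
qed

lemma sum_reduced_above_post:
  assumes "n1 \<le> z" "z < n2"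
  shows "(\<Sum>x\<in>above z. reduced w \<pi> x) = \<pi> (m + 1) - \<pi> z"
proof -
  have "(\<Sum>x\<in>above z. reduced w \<pi> x) = (\<Sum>x\<in>ancestors n1 head z. - \<pi> x - - \<pi> (head x))"
    unfolding above_post[OF assms]
  proof (rule sum.cong)
    fix x assume "x \<in> ancestors n1 head z"
    then have "n1 \<le> x" "x < n2" using ancestors_bounds assms(2) by fastforce+
    then show "reduced w \<pi> x = - \<pi> x - - \<pi> (head x)" using post_link n1 by (simp add: reduced_def)
  qed simp
  also have "\<dots> = - \<pi> z - - \<pi> (m + 1)"
    by (rule sum_ancestors_telescope) (use post_link assms n1 in auto)
  finally show ?thesis by simp
qed

lemma weight_eq_sum_reduced:
  assumes "j < m" "\<pi> m = \<pi> (m + 1)"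
  shows "w j = reduced w \<pi> j + (\<Sum>x\<in>route j. reduced w \<pi> x)"
proof -
  have "(\<Sum>x\<in>route j. reduced w \<pi> x) =
      (\<Sum>x\<in>above (tail j). reduced w \<pi> x) + (\<Sum>x\<in>above (head j). reduced w \<pi> x)"
    unfolding route_def using above_bounds(3)[of _ "tail j"] above_bounds(3)[of _ "head j"] edge_link[OF assms(1)] n2
    by (intro sum.union_disjoint) (fastforce simp: above_def)+
  then show ?thesis
    using edge_link[OF assms(1)] assms
    by (simp add: sum_reduced_above_applicant sum_reduced_above_post reduced_def[of w \<pi> j])
qed

lemma sum_weight_eq:
  assumes X: "X \<subseteq> {..<m}" and \<pi>: "\<pi> m = \<pi> (m + 1)"
  shows "(\<Sum>j\<in>X. w j) =
    (\<Sum>j\<in>X. reduced w \<pi> j) + (\<Sum>x\<in>tree_links. reduced w \<pi> x * int (card (X \<inter> class_edges x)))"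
proof -
  let ?r = "reduced w \<pi>"
  have fin: "finite X" using X finite_subset by blast
  have "(\<Sum>x\<in>route j. ?r x) = (\<Sum>x\<in>tree_links. if j \<in> class_edges x then ?r x else 0)" if "j \<in> X" for j
  proof -
    have "j < m" using X that by auto
    then have "route j = {x \<in> tree_links. j \<in> class_edges x}"
      using route_tree_links[of j] by (auto simp: class_edges_def)
    then show ?thesis by (simp add: sum.inter_filter)
  qed
  then have "(\<Sum>j\<in>X. \<Sum>x\<in>route j. ?r x) = (\<Sum>j\<in>X. \<Sum>x\<in>tree_links. if j \<in> class_edges x then ?r x else 0)"
    by (rule sum.cong[OF refl])
  also have "\<dots> = (\<Sum>x\<in>tree_links. \<Sum>j\<in>X. if j \<in> class_edges x then ?r x else 0)"
    by (rule sum.swap)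
  also have "\<dots> = (\<Sum>x\<in>tree_links. ?r x * int (card (X \<inter> class_edges x)))"
    using fin by (intro sum.cong) (simp_all add: sum.inter_restrict[symmetric] mult.commute)
  finally have "(\<Sum>j\<in>X. \<Sum>x\<in>route j. ?r x) = (\<Sum>x\<in>tree_links. ?r x * int (card (X \<inter> class_edges x)))" .
  moreover have "(\<Sum>j\<in>X. w j) = (\<Sum>j\<in>X. ?r j + (\<Sum>x\<in>route j. ?r x))"
    using X \<pi> by (intro sum.cong weight_eq_sum_reduced) auto
  ultimately show ?thesis by (simp add: sum.distrib)
qed

lemma complementary_slackness_optimal:
  assumes X: "fits X" and M: "M \<subseteq> {..<m}" and \<pi>: "\<pi> m = \<pi> (m + 1)"
    and tree: "\<And>x. x \<in> tree_links \<Longrightarrow>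
      0 \<le> reduced w \<pi> x \<and> (0 < reduced w \<pi> x \<longrightarrow> card (M \<inter> class_edges x) = node_quota x)"
    and edges: "\<And>j. j < m \<Longrightarrow> (0 < reduced w \<pi> j \<longrightarrow> j \<in> M) \<and> (reduced w \<pi> j < 0 \<longrightarrow> j \<notin> M)"
  shows "(\<Sum>j\<in>X. w j) \<le> (\<Sum>j\<in>M. w j)"
proof -
  let ?r = "reduced w \<pi>"
  have XM: "X \<subseteq> {..<m}" using X by (simp add: fits_def)
  have "(\<Sum>x\<in>tree_links. ?r x * int (card (X \<inter> class_edges x))) \<le>
      (\<Sum>x\<in>tree_links. ?r x * int (card (M \<inter> class_edges x)))"
  proof (rule sum_mono)
    fix x assume x: "x \<in> tree_links"
    have "card (X \<inter> class_edges x) \<le> node_quota x" using X x by (simp add: fits_def)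
    then show "?r x * int (card (X \<inter> class_edges x)) \<le> ?r x * int (card (M \<inter> class_edges x))"
      using tree[OF x] by (cases "?r x = 0") (auto intro!: mult_left_mono)
  qed
  moreover have "(\<Sum>j<m. if j \<in> X then ?r j else 0) \<le> (\<Sum>j<m. if j \<in> M then ?r j else 0)"
  proof (rule sum_mono)
    fix j assume "j \<in> {..<m}"
    then show "(if j \<in> X then ?r j else 0) \<le> (if j \<in> M then ?r j else 0)"
      using edges[of j] by (cases "?r j" "0::int" rule: linorder_cases) auto
  qed
  then have "(\<Sum>j\<in>X. ?r j) \<le> (\<Sum>j\<in>M. ?r j)"
    using XM M by (simp add: sum.If_cases Int_absorb1)
  ultimately show ?thesis using sum_weight_eq[OF XM \<pi>, of w] sum_weight_eq[OF M \<pi>, of w] by linarith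
qed

end

section \<open>Lexicographic weights\<close>

definition rank_count :: "('a \<Rightarrow> nat) \<Rightarrow> nat \<Rightarrow> 'a set \<Rightarrow> nat" where
  "rank_count rank k X = card {j \<in> X. rank j = k}"

fun lex_weight :: "int \<Rightarrow> ('a \<Rightarrow> nat) \<Rightarrow> nat \<Rightarrow> 'a \<Rightarrow> int" where
  "lex_weight \<beta> rank 0 j = 0"
| "lex_weight \<beta> rank (Suc k) j = \<beta> * lex_weight \<beta> rank k j + of_bool (rank j \<le> Suc k)"

lemma card_rank_le:
  assumes "finite X" "\<forall>j\<in>X. 1 \<le> rank j"
  shows "card {j \<in> X. rank j \<le> k} = (\<Sum>i=1..k. rank_count rank i X)"
proof -
  have "{j \<in> X. rank j \<le> k} = (\<Union>i\<in>{1..k}. {j \<in> X. rank j = i})" using assms(2) by force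
  also have "card \<dots> = (\<Sum>i=1..k. card {j \<in> X. rank j = i})"
    using \<open>finite X\<close> by (intro card_UN_disjoint) auto
  finally show ?thesis by (simp add: rank_count_def)
qed

lemma sum_lex_weight_Suc:
  assumes "finite X" "\<forall>j\<in>X. 1 \<le> rank j"
  shows "sum (lex_weight \<beta> rank (Suc k)) X =
    \<beta> * sum (lex_weight \<beta> rank k) X + int (\<Sum>i=1..Suc k. rank_count rank i X)"
proof -
  have "sum (lex_weight \<beta> rank (Suc k)) X =
      (\<Sum>j\<in>X. \<beta> * lex_weight \<beta> rank k j + of_bool (rank j \<le> Suc k))" by simp
  also have "\<dots> = \<beta> * sum (lex_weight \<beta> rank k) X + int (card {j \<in> X. rank j \<le> Suc k})"
    using assms(1) by (simp add: sum.distrib sum_distrib_left Int_def)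
  finally show ?thesis by (simp only: card_rank_le[OF assms])
qed

lemma sum_lex_weight_eq:
  assumes X: "finite X" "\<forall>j\<in>X. 1 \<le> rank j" and Y: "finite Y" "\<forall>j\<in>Y. 1 \<le> rank j"
    and eq: "\<And>i. 1 \<le> i \<Longrightarrow> i \<le> k \<Longrightarrow> rank_count rank i X = rank_count rank i Y"
  shows "sum (lex_weight \<beta> rank k) X = sum (lex_weight \<beta> rank k) Y"
  using eq
proof (induction k)
  case 0
  show ?case by simp
next
  case (Suc k)
  then have "(\<Sum>i=1..Suc k. rank_count rank i X) = (\<Sum>i=1..Suc k. rank_count rank i Y)"
    by (intro sum.cong) auto
  moreover have "sum (lex_weight \<beta> rank k) X = sum (lex_weight \<beta> rank k) Y" using Suc by simp
  ultimately show ?case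
    using sum_lex_weight_Suc[OF X, of \<beta> k] sum_lex_weight_Suc[OF Y, of \<beta> k] by presburger
qed

lemma sum_lex_weight_less:
  assumes X: "finite X" "\<forall>j\<in>X. 1 \<le> rank j" and Y: "finite Y" "\<forall>j\<in>Y. 1 \<le> rank j"
    and \<beta>: "int (card Y) < \<beta>" and \<kappa>: "1 \<le> \<kappa>" "\<kappa> \<le> k"
    and eq: "\<And>i. 1 \<le> i \<Longrightarrow> i < \<kappa> \<Longrightarrow> rank_count rank i X = rank_count rank i Y"
    and greater: "rank_count rank \<kappa> Y < rank_count rank \<kappa> X"
  shows "sum (lex_weight \<beta> rank k) Y < sum (lex_weight \<beta> rank k) X"
  using \<kappa>(2)
proof (induction k rule: dec_induct)
  case base
  obtain l where l: "\<kappa> = Suc l" using \<kappa>(1) by (cases \<kappa>) auto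
  have "(\<Sum>i=1..l. rank_count rank i X) = (\<Sum>i=1..l. rank_count rank i Y)"
    using eq l by (intro sum.cong) auto
  then have "(\<Sum>i=1..Suc l. rank_count rank i Y) < (\<Sum>i=1..Suc l. rank_count rank i X)"
    using greater l by simp
  moreover have "sum (lex_weight \<beta> rank l) X = sum (lex_weight \<beta> rank l) Y"
    using eq l by (intro sum_lex_weight_eq X Y) auto
  ultimately show ?case
    using sum_lex_weight_Suc[OF X, of \<beta> l] sum_lex_weight_Suc[OF Y, of \<beta> l]
    by (simp only: l add_less_cancel_left of_nat_less_iff)
next
  case (step k)
  let ?W = "\<lambda>Z. sum (lex_weight \<beta> rank k) Z" and ?N = "\<lambda>Z. int (\<Sum>i=1..Suc k. rank_count rank i Z)"
  have "?N Y \<le> int (card Y)"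
    unfolding card_rank_le[OF Y, symmetric] of_nat_le_iff using Y(1) by (intro card_mono) auto
  have "sum (lex_weight \<beta> rank (Suc k)) Y = \<beta> * ?W Y + ?N Y" by (rule sum_lex_weight_Suc[OF Y])
  also have "\<dots> < \<beta> * ?W Y + \<beta>" using \<open>?N Y \<le> int (card Y)\<close> \<beta> by (intro add_strict_left_mono) (rule le_less_trans)
  also have "\<dots> = \<beta> * (?W Y + 1)" by (simp add: distrib_left)
  also have "\<dots> \<le> \<beta> * ?W X" using step.IH \<beta> by (intro mult_left_mono) auto
  also have "\<dots> \<le> \<beta> * ?W X + ?N X" by (simp only: le_add_same_cancel1 of_nat_0_le_iff)
  also have "\<dots> = sum (lex_weight \<beta> rank (Suc k)) X" by (rule sum_lex_weight_Suc[OF X, symmetric])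
  finally show ?case .
qed

section \<open>Stages\<close>

lemma scaled_add_sign:
  fixes \<beta> \<delta> r :: int
  assumes "\<bar>\<delta>\<bar> < \<beta>"
  shows "0 < r \<Longrightarrow> 0 < \<beta> * r + \<delta>" and "r < 0 \<Longrightarrow> \<beta> * r + \<delta> < 0"
proof -
  show "0 < \<beta> * r + \<delta>" if "0 < r"
  proof -
    have "\<beta> * 1 \<le> \<beta> * r" using that assms by (intro mult_left_mono) auto
    then show ?thesis using assms by linarith
  qed
  show "\<beta> * r + \<delta> < 0" if "r < 0"
  proof -
    have "\<beta> * r \<le> \<beta> * (- 1)" using that assms by (intro mult_left_mono) auto
    then show ?thesis using assms by linarith
  qed
qed

context network
begin

abbreviation weight :: "nat \<Rightarrow> nat \<Rightarrow> int" where
  "weight \<equiv> lex_weight (int (m + 3)) rank"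

definition residual :: "(nat \<Rightarrow> nat) \<Rightarrow> (nat \<Rightarrow> nat) \<Rightarrow> (nat \<Rightarrow> nat) \<Rightarrow> nat \<Rightarrow> nat \<Rightarrow> nat \<Rightarrow> bool" where
  "residual f cap frozen j x y \<longleftrightarrow> j \<in> links \<and> frozen j = 0 \<and>
     (tail j = x \<and> head j = y \<and> f j < cap j \<or> head j = x \<and> tail j = y \<and> 0 < f j)"

definition complementary ::
  "(nat \<Rightarrow> int) \<Rightarrow> nat \<Rightarrow> (nat \<Rightarrow> nat) \<Rightarrow> (nat \<Rightarrow> nat) \<Rightarrow> (nat \<Rightarrow> nat) \<Rightarrow> nat \<Rightarrow> bool" where
  "complementary \<pi> k f cap frozen j \<longleftrightarrow> (let r = reduced (weight (k - 1)) \<pi> j in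
     (frozen j = 0 \<longleftrightarrow> r = 0) \<and> (0 < r \<longrightarrow> f j = cap j) \<and> (r < 0 \<longrightarrow> j < m \<and> f j = 0) \<and>
     (j < m \<and> k < rank j \<longrightarrow> r \<le> 0))"

text \<open>The potential is only asserted to exist, for it never appears in the program.\<close>

definition stage :: "nat \<Rightarrow> (nat \<Rightarrow> nat) \<Rightarrow> (nat \<Rightarrow> nat) \<Rightarrow> (nat \<Rightarrow> nat) \<Rightarrow> bool" where
  "stage k f cap frozen \<longleftrightarrow>
     (\<forall>j<m. cap j = of_bool (rank j \<le> k)) \<and> (\<forall>x\<in>tree_links. cap x = node_quota x + 1) \<and>
     (\<forall>j\<in>links. f j \<le> cap j) \<and> balanced f m \<and>
     (\<exists>\<pi>. \<pi> m = 0 \<and> \<pi> (m + 1) = 0 \<and> (\<forall>j\<in>links. complementary \<pi> k f cap frozen j))"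

lemma stage_edge_flow_le:
  assumes "stage k f cap frozen" "j < m"
  shows "f j \<le> of_bool (rank j \<le> k)"
  using assms by (metis UnI1 lessThan_iff links_def stage_def)

lemma stage_sum_flow_le:
  assumes "stage k f cap frozen"
  shows "(\<Sum>i<m. f i) \<le> m"
proof -
  have "f i \<le> 1" if "i < m" for i
    using stage_edge_flow_le[OF assms that] by (auto simp: of_bool_def split: if_splits)
  then have "(\<Sum>i<m. f i) \<le> (\<Sum>i<m. 1)" by (intro sum_mono) simp
  then show ?thesis by simp
qed

lemma stage_tree_flow:
  assumes "stage k f cap frozen" "x \<in> tree_links"
  shows "f x = 1 + card (chosen f \<inter> class_edges x)"
proof -
  have "f j = of_bool (j \<in> chosen f)" if "j < m" for j
    using stage_edge_flow_le[OF assms(1) that] that by (auto simp: chosen_def of_bool_def split: if_splits)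
  then have "(\<Sum>j\<in>class_edges x. int (f j)) = (\<Sum>j\<in>class_edges x. of_bool (j \<in> chosen f))"
    by (intro sum.cong) (auto simp: class_edges_def)
  also have "\<dots> = int (card (chosen f \<inter> class_edges x))" by (simp add: Int_commute)
  finally have "(\<Sum>j\<in>class_edges x. int (f j)) = int (card (chosen f \<inter> class_edges x))" .
  moreover have "int (f x) = 1 + (\<Sum>j\<in>class_edges x. int (f j)) + subtree_sign x m"
    using assms unfolding stage_def balanced_def by blast
  ultimately show ?thesis by simp
qed

lemma stage_fits: "stage k f cap frozen \<Longrightarrow> fits (chosen f)"
  unfolding fits_def
proof (intro conjI ballI)
  fix x assume st: "stage k f cap frozen" and x: "x \<in> tree_links"
  have "f x \<le> node_quota x + 1" using st x unfolding stage_def links_def by (metis UnI2)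
  then show "card (chosen f \<inter> class_edges x) \<le> node_quota x" using stage_tree_flow[OF st x] by simp
qed (auto simp: chosen_def)

lemma stage_init:
  assumes "\<And>j. j < m \<Longrightarrow> f j = 0" "\<And>x. x \<in> tree_links \<Longrightarrow> f x = 1" "\<And>j. j \<in> links \<Longrightarrow> frozen j = 0"
    "\<And>j. j < m \<Longrightarrow> cap j = of_bool (rank j \<le> 1)" "\<And>x. x \<in> tree_links \<Longrightarrow> cap x = node_quota x + 1"
  shows "stage 1 f cap frozen"
proof -
  have "balanced f m"
    unfolding balanced_def using assms(1,2) by (simp add: class_edges_def)
  moreover have "\<forall>j\<in>links. f j \<le> cap j" using assms by (auto simp: links_def)
  moreover have "\<forall>j\<in>links. complementary (\<lambda>_. 0) 1 f cap frozen j"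
    using assms(3) by (simp add: complementary_def reduced_def)
  ultimately show ?thesis
    using assms(4,5) unfolding stage_def by (intro conjI exI[of _ "\<lambda>_. 0"]) auto
qed

lemma stage_augment:
  assumes "stage k f cap frozen" "balanced f' m" "\<And>j. j \<in> links \<Longrightarrow> f' j \<le> cap j"
    "\<And>j. j \<in> links \<Longrightarrow> frozen j \<noteq> 0 \<Longrightarrow> f' j = f j"
  shows "stage k f' cap frozen"
proof -
  obtain \<pi> where \<pi>: "\<pi> m = 0" "\<pi> (m + 1) = 0" "\<forall>j\<in>links. complementary \<pi> k f cap frozen j"
    using assms(1) unfolding stage_def by blast
  have "\<forall>j\<in>links. complementary \<pi> k f' cap frozen j"
    using \<pi>(3) assms(4) unfolding complementary_def Let_def by (metis less_irrefl)
  then show ?thesis using assms \<pi>(1,2) unfolding stage_def by blast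
qed

definition crosses :: "nat \<Rightarrow> nat set \<Rightarrow> nat \<Rightarrow> bool" where
  "crosses k R j \<longleftrightarrow> (if j < m \<and> k < rank j then \<not> (tail j \<in> R \<and> head j \<notin> R)
     else (tail j \<in> R) \<noteq> (head j \<in> R))"

definition lifted_potential :: "nat set \<Rightarrow> (nat \<Rightarrow> int) \<Rightarrow> nat \<Rightarrow> int" where
  "lifted_potential R \<pi> z = int (m + 3) * \<pi> z + applicant_side z - of_bool (z \<in> R)"

definition reduced_change :: "nat \<Rightarrow> nat set \<Rightarrow> nat \<Rightarrow> int" where
  "reduced_change k R j = of_bool (tail j \<in> R) - of_bool (head j \<in> R) - of_bool (j < m \<and> k < rank j)"

lemma reduced_lifted_potential:
  assumes "j \<in> links" "1 \<le> k"
  shows "reduced (weight k) (lifted_potential R \<pi>) j =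
    int (m + 3) * reduced (weight (k - 1)) \<pi> j + reduced_change k R j"
proof -
  obtain l where "k = Suc l" using assms(2) by (cases k) auto
  then show ?thesis using applicant_side_link[OF assms(1)]
    by (auto simp: reduced_def lifted_potential_def reduced_change_def algebra_simps)
qed

lemma reduced_change_abs_less: "\<bar>reduced_change k R j\<bar> < int (m + 3)"
  by (simp add: reduced_change_def)

lemma reduced_change_eq_0_iff: "reduced_change k R j = 0 \<longleftrightarrow> \<not> crosses k R j"
  by (simp add: reduced_change_def crosses_def)

lemma unfrozen_link_full:
  assumes j: "j \<in> links" "frozen j = 0" "f j \<le> cap j"
    and closed: "\<And>x y. residual f cap frozen j x y \<Longrightarrow> x \<in> R \<Longrightarrow> y \<in> R"
    and change: "0 < reduced_change k R j"
  shows "f j = cap j"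
proof (rule ccontr)
  assume "f j \<noteq> cap j"
  then have "tail j \<in> R \<Longrightarrow> head j \<in> R" using closed[of "tail j" "head j"] j by (simp add: residual_def)
  then show False using change by (auto simp: reduced_change_def of_bool_def split: if_splits)
qed

lemma unfrozen_link_empty:
  assumes j: "j \<in> links" "frozen j = 0"
    and closed: "\<And>x y. residual f cap frozen j x y \<Longrightarrow> x \<in> R \<Longrightarrow> y \<in> R"
    and change: "reduced_change k R j < 0" and early: "\<not> (j < m \<and> k < rank j)"
  shows "f j = 0"
proof (rule ccontr)
  assume "f j \<noteq> 0"
  then have "head j \<in> R \<Longrightarrow> tail j \<in> R" using closed[of "head j" "tail j"] j by (simp add: residual_def)
  then show False using change early by (auto simp: reduced_change_def)
qed

lemma complementary_lifted:
  assumes compl: "complementary \<pi> k f cap frozen j" and j: "j \<in> links" and k: "1 \<le> k"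
    and f: "f j \<le> cap j" "j < m \<Longrightarrow> k < rank j \<Longrightarrow> f j = 0" "\<not> j < m \<Longrightarrow> 0 < f j"
    and closed: "\<And>x y. residual f cap frozen j x y \<Longrightarrow> x \<in> R \<Longrightarrow> y \<in> R"
    and cap': "\<not> (j < m \<and> k < rank j) \<Longrightarrow> cap' j = cap j"
    and frozen': "frozen' j = 0 \<longleftrightarrow> frozen j = 0 \<and> \<not> crosses k R j"
  shows "complementary (lifted_potential R \<pi>) (Suc k) f cap' frozen' j"
proof -
  define r r' \<delta> where "r = reduced (weight (k - 1)) \<pi> j"
    and "r' = reduced (weight k) (lifted_potential R \<pi>) j" and "\<delta> = reduced_change k R j"
  have "r' = int (m + 3) * r + \<delta>" unfolding r_def r'_def \<delta>_def by (rule reduced_lifted_potential[OF j k])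
  moreover have "\<bar>\<delta>\<bar> < int (m + 3)" unfolding \<delta>_def by (rule reduced_change_abs_less)
  ultimately have pos: "0 < r \<Longrightarrow> 0 < r'" and neg: "r < 0 \<Longrightarrow> r' < 0" and zero: "r = 0 \<Longrightarrow> r' = \<delta>"
    using scaled_add_sign by simp_all
  have old: "(frozen j = 0 \<longleftrightarrow> r = 0) \<and> (0 < r \<longrightarrow> f j = cap j) \<and> (r < 0 \<longrightarrow> j < m \<and> f j = 0) \<and>
      (j < m \<and> k < rank j \<longrightarrow> r \<le> 0)"
    using compl unfolding complementary_def Let_def r_def .
  have "(frozen' j = 0 \<longleftrightarrow> r' = 0) \<and> (0 < r' \<longrightarrow> f j = cap' j) \<and> (r' < 0 \<longrightarrow> j < m \<and> f j = 0) \<and>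
      (j < m \<and> Suc k < rank j \<longrightarrow> r' \<le> 0)"
  proof (cases r "0::int" rule: linorder_cases)
    case less
    then show ?thesis using old neg frozen' by simp
  next
    case greater
    then have "\<not> (j < m \<and> k < rank j)" using old by auto
    then show ?thesis using greater old pos frozen' cap' by auto
  next
    case equal
    then have unfrozen: "frozen j = 0" using old by simp
    then have frozen_iff: "frozen' j = 0 \<longleftrightarrow> \<delta> = 0" using frozen' by (simp add: \<delta>_def reduced_change_eq_0_iff)
    show ?thesis
    proof (cases "j < m \<and> k < rank j")
      case True
      moreover from this have "\<delta> \<le> 0" by (simp add: \<delta>_def reduced_change_def)
      ultimately show ?thesis using equal zero frozen_iff f(2) by simp
    next
      case False
      have pos_full: "0 < \<delta> \<Longrightarrow> f j = cap j"
        unfolding \<delta>_def by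
          (rule unfrozen_link_full[where f = f and cap = cap and frozen = frozen, OF j unfrozen f(1) closed])
      have "\<delta> < 0 \<Longrightarrow> f j = 0"
        unfolding \<delta>_def by
          (rule unfrozen_link_empty[where f = f and cap = cap and frozen = frozen, OF j unfrozen closed _ False])
      then have neg_empty: "\<delta> < 0 \<Longrightarrow> j < m \<and> f j = 0" using f(3) by fastforce
      show ?thesis
        unfolding zero[OF equal] cap'[OF False] using False frozen_iff pos_full neg_empty by linarith
    qed
  qed
  then show ?thesis by (simp add: complementary_def Let_def r'_def)
qed

lemma stage_Suc:
  assumes st: "stage k f cap frozen" and k: "1 \<le> k"
    and closed: "\<And>j x y. residual f cap frozen j x y \<Longrightarrow> x \<in> R \<Longrightarrow> y \<in> R"
    and source: "m \<in> R" and sink: "m + 1 \<notin> R"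
    and cap': "\<And>j. j \<in> links \<Longrightarrow> cap' j = (if j < m \<and> rank j = Suc k then 1 else cap j)"
    and frozen': "\<And>j. j \<in> links \<Longrightarrow> frozen' j = 0 \<longleftrightarrow> frozen j = 0 \<and> \<not> crosses k R j"
  shows "stage (Suc k) f cap' frozen'"
proof -
  obtain \<pi> where \<pi>: "\<pi> m = 0" "\<pi> (m + 1) = 0" "\<And>j. j \<in> links \<Longrightarrow> complementary \<pi> k f cap frozen j"
    using st unfolding stage_def by blast
  have cap: "\<And>j. j < m \<Longrightarrow> cap j = of_bool (rank j \<le> k)" "\<And>x. x \<in> tree_links \<Longrightarrow> cap x = node_quota x + 1"
    and le: "\<And>j. j \<in> links \<Longrightarrow> f j \<le> cap j" and bal: "balanced f m"
    using st unfolding stage_def by auto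
  have "complementary (lifted_potential R \<pi>) (Suc k) f cap' frozen' j" if j: "j \<in> links" for j
  proof (rule complementary_lifted[OF \<pi>(3)[OF j] j k le[OF j]])
    show "f j = 0" if "j < m" "k < rank j" using le[OF j] cap(1) that by simp
    show "0 < f j" if "\<not> j < m" using stage_tree_flow[OF st, of j] j that by (simp add: links_def)
  qed (use closed cap'[OF j] frozen'[OF j] in auto)
  moreover have "lifted_potential R \<pi> m = 0" "lifted_potential R \<pi> (m + 1) = 0"
    unfolding lifted_potential_def applicant_side_source applicant_side_sink using \<pi>(1,2) source sink by simp_all
  moreover have "\<forall>j<m. cap' j = of_bool (rank j \<le> Suc k)"
    using cap(1) cap' by (auto simp: links_def)
  moreover have "\<forall>x\<in>tree_links. cap' x = node_quota x + 1"
    using cap(2) cap' by (auto simp: links_def tree_links_def)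
  moreover have "\<forall>j\<in>links. f j \<le> cap' j"
    using le cap' cap(1) by (fastforce simp: links_def)
  ultimately show ?thesis unfolding stage_def using bal by blast
qed

lemma last_stage_weight_maximal:
  assumes st: "stage (Suc m) f cap frozen" and X: "fits X"
  shows "sum (weight m) X \<le> sum (weight m) (chosen f)"
proof -
  obtain \<pi> where ends: "\<pi> m = 0" "\<pi> (m + 1) = 0"
    and \<pi>: "\<forall>j\<in>links. complementary \<pi> (Suc m) f cap frozen j"
    using st unfolding stage_def by blast
  let ?M = "chosen f" and ?r = "reduced (weight m) \<pi>"
  have edge_cap: "cap j = 1" if "j < m" for j
    using st rank_bounds[OF that] that unfolding stage_def by simp
  have tree_cap: "cap x = node_quota x + 1" if "x \<in> tree_links" for x
    using st that unfolding stage_def by blast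
  show ?thesis
  proof (rule complementary_slackness_optimal[OF X])
    show "?M \<subseteq> {..<m}" by (auto simp: chosen_def)
    show "\<pi> m = \<pi> (m + 1)" using ends by simp
    fix x assume x: "x \<in> tree_links"
    then have "complementary \<pi> (Suc m) f cap frozen x" "\<not> x < m"
      using \<pi> by (auto simp: links_def tree_links_def)
    then have "(0 < ?r x \<longrightarrow> f x = cap x) \<and> \<not> ?r x < 0" by (simp add: complementary_def Let_def)
    then show "0 \<le> ?r x \<and> (0 < ?r x \<longrightarrow> card (?M \<inter> class_edges x) = node_quota x)"
      using tree_cap[OF x] stage_tree_flow[OF st x] by linarith
  next
    fix j assume j: "j < m"
    then have "complementary \<pi> (Suc m) f cap frozen j" using \<pi> by (simp add: links_def)
    then have "(0 < ?r j \<longrightarrow> f j = cap j) \<and> (?r j < 0 \<longrightarrow> f j = 0)" by (simp add: complementary_def Let_def)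
    then show "(0 < ?r j \<longrightarrow> j \<in> ?M) \<and> (?r j < 0 \<longrightarrow> j \<notin> ?M)"
      using edge_cap[OF j] j by (simp add: chosen_def)
  qed
qed

lemma last_stage_lex_maximal:
  assumes st: "stage (Suc m) f cap frozen" and X: "fits X" and \<kappa>: "1 \<le> \<kappa>" "\<kappa> \<le> m"
    and eq: "\<And>i. 1 \<le> i \<Longrightarrow> i < \<kappa> \<Longrightarrow> rank_count rank i X = rank_count rank i (chosen f)"
  shows "rank_count rank \<kappa> X \<le> rank_count rank \<kappa> (chosen f)"
proof (rule ccontr)
  assume greater: "\<not> ?thesis"
  let ?M = "chosen f"
  have sub: "X \<subseteq> {..<m}" "?M \<subseteq> {..<m}" using X by (auto simp: fits_def chosen_def)
  have "sum (weight m) ?M < sum (weight m) X"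
  proof (rule sum_lex_weight_less[where \<kappa> = \<kappa>])
    show "finite X" "finite ?M" using sub finite_subset by blast+
    show "int (card ?M) < int (m + 3)" using card_mono[OF _ sub(2)] by simp
    show "\<forall>j\<in>X. 1 \<le> rank j" "\<forall>j\<in>?M. 1 \<le> rank j" using rank_bounds sub by blast+
  qed (use \<kappa> eq greater in auto)
  then show False using last_stage_weight_maximal[OF st X] by simp
qed

end

section \<open>Laminar families and their forests\<close>

lemma laminarD: "laminar F \<Longrightarrow> X \<in> F \<Longrightarrow> Y \<in> F \<Longrightarrow> X \<subseteq> Y \<or> Y \<subseteq> X \<or> X \<inter> Y = {}"
  unfolding laminar_def by blast

definition redundant_at :: "'a \<Rightarrow> 'a set set \<Rightarrow> 'a set set" where
  "redundant_at x F = {C \<in> F. x \<in> C \<and> (C = {x} \<or> C - {x} \<in> F)}"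

lemma card_redundant_at_le:
  assumes "laminar F"
  shows "card (redundant_at x F) \<le> 2"
proof -
  let ?H = "redundant_at x F - {{x}}"
  have "C \<subseteq> D" if "C \<in> ?H" "D \<in> ?H" for C D
  proof -
    have C: "C \<in> F" "x \<in> C" "C - {x} \<in> F" "C - {x} \<noteq> {}" using that by (auto simp: redundant_at_def)
    have D: "D \<in> F" "x \<in> D" "D - {x} \<in> F" "D - {x} \<noteq> {}" using that by (auto simp: redundant_at_def)
    consider "C \<subseteq> D" | "D \<subseteq> C" using laminarD[OF assms C(1) D(1)] C(2) D(2) by blast
    then show ?thesis
    proof cases
      case 2
      then show ?thesis using laminarD[OF assms D(1) C(3)] C D by blast
    qed
  qed
  then have "\<forall>C\<in>?H. \<forall>D\<in>?H. C = D" by blast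
  then have "card ?H \<le> 1"
    by (metis card_le_Suc0_iff_eq card.infinite One_nat_def zero_le)
  then show ?thesis by (cases "{x} \<in> redundant_at x F") (auto simp: card_Diff_singleton_if)
qed

lemma card_Diff_redundant_at_le:
  assumes "finite F" "{} \<notin> F"
  shows "card (F - redundant_at x F) \<le> card ((\<lambda>C. C - {x}) ` F - {{}})"
proof (rule card_inj_on_le[of "\<lambda>C. C - {x}"])
  show "inj_on (\<lambda>C. C - {x}) (F - redundant_at x F)"
  proof (rule inj_onI)
    fix C D assume "C \<in> F - redundant_at x F" "D \<in> F - redundant_at x F" "C - {x} = D - {x}"
    then show "C = D" unfolding redundant_at_def
      by (cases "x \<in> C"; cases "x \<in> D") (auto simp: insert_absorb Diff_insert_absorb)
  qed
  show "(\<lambda>C. C - {x}) ` (F - redundant_at x F) \<subseteq> (\<lambda>C. C - {x}) ` F - {{}}"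
  proof (rule image_subsetI)
    fix C assume C: "C \<in> F - redundant_at x F"
    then have "C \<noteq> {}" "C \<noteq> {x}" using assms(2) by (auto simp: redundant_at_def)
    then have "C - {x} \<noteq> {}" by auto
    then show "C - {x} \<in> (\<lambda>C. C - {x}) ` F - {{}}" using C by simp
  qed
  show "finite ((\<lambda>C. C - {x}) ` F - {{}})" using assms(1) by simp
qed

lemma card_laminar_le:
  assumes "finite X" "F \<subseteq> Pow X" "laminar F" "{} \<notin> F"
  shows "card F \<le> 2 * card X"
  using assms
proof (induction X arbitrary: F rule: finite_induct)
  case empty
  then have "F = {}" by auto
  then show ?case by simp
next
  case (insert x X)
  let ?H = "redundant_at x F" and ?G = "(\<lambda>C. C - {x}) ` F - {{}}"
  have finF: "finite F" using insert.prems insert.hyps by (meson finite.insertI finite_Pow_iff finite_subset)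
  have "card ?G \<le> 2 * card X"
  proof (rule insert.IH)
    show "?G \<subseteq> Pow X" using insert.prems(1) by auto
    show "laminar ?G" using insert.prems(2) unfolding laminar_def by blast
  qed simp
  moreover have "card (F - ?H) \<le> card ?G" using finF insert.prems(3) by (rule card_Diff_redundant_at_le)
  moreover have "card ?H \<le> 2" using insert.prems(2) by (rule card_redundant_at_le)
  moreover have "?H \<subseteq> F" by (auto simp: redundant_at_def)
  then have "card F = card (F - ?H) + card ?H"
    using finF by (metis card_Diff_subset card_mono finite_subset le_add_diff_inverse2)
  ultimately show ?case using insert.hyps by simp
qed

text \<open>
  Node \<open>x\<close> with \<open>n0 \<le> x < n\<close> stands for the set \<open>E (lab x)\<close> of elements below \<open>n0\<close>, and \<open>up\<close> maps it to
  the smallest set above it, or to \<open>r\<close>.  An element is mapped to the smallest set containing it.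
\<close>

definition laminar_forest ::
  "nat \<Rightarrow> nat \<Rightarrow> ('k \<Rightarrow> nat set) \<Rightarrow> (nat \<Rightarrow> 'k) \<Rightarrow> nat \<Rightarrow> (nat \<Rightarrow> nat) \<Rightarrow> bool" where
  "laminar_forest r n0 E lab n up \<longleftrightarrow>
     (\<forall>x\<in>{n0..<n}. up x = r \<or> n0 \<le> up x \<and> up x < x) \<and>
     (\<forall>j\<in>\<Union>(E ` lab ` {n0..<n}). n0 \<le> up j \<and> up j < n \<and>
        (\<forall>x\<in>{n0..<n}. x \<in> ancestors n0 up (up j) \<longleftrightarrow> j \<in> E (lab x)))"

lemma laminar_forest_cong:
  assumes "laminar_forest r n0 E lab n up"
    and "\<And>y. y \<in> \<Union>(E ` lab ` {n0..<n}) \<union> {n0..<n} \<Longrightarrow> up' y = up y"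
  shows "laminar_forest r n0 E lab n up'"
proof -
  have "ancestors n0 up' z = ancestors n0 up z" if "z < n" for z
    by (rule ancestors_cong) (use assms(2) that in auto)
  then show ?thesis using assms unfolding laminar_forest_def by simp
qed

lemma laminar_forest_empty: "laminar_forest r n0 E lab n0 up"
  by (simp add: laminar_forest_def)

lemma laminar_forest_parent:
  assumes forest: "laminar_forest r n0 E lab n up" and r: "r < n0"
    and nested: "\<And>x. x \<in> {n0..<n} \<Longrightarrow> E k \<subseteq> E (lab x) \<or> E k \<inter> E (lab x) = {}"
    and j0: "j0 \<in> E k" and p: "p = (if j0 \<in> \<Union>(E ` lab ` {n0..<n}) then up j0 else r)"
  shows "p = r \<or> n0 \<le> p \<and> p < n"
    and "j \<in> E k \<Longrightarrow> x \<in> {n0..<n} \<Longrightarrow> x \<in> ancestors n0 up p \<longleftrightarrow> j \<in> E (lab x)"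
proof -
  have elems: "n0 \<le> up j0 \<and> up j0 < n \<and> (\<forall>x\<in>{n0..<n}. x \<in> ancestors n0 up (up j0) \<longleftrightarrow> j0 \<in> E (lab x))"
    if "j0 \<in> \<Union>(E ` lab ` {n0..<n})"
    using forest that unfolding laminar_forest_def by blast
  show "p = r \<or> n0 \<le> p \<and> p < n" using elems p by simp
  assume j: "j \<in> E k" and x: "x \<in> {n0..<n}"
  have "x \<in> ancestors n0 up p \<longleftrightarrow> j0 \<in> E (lab x)"
    using elems x r by (auto simp: p ancestors_empty)
  then show "x \<in> ancestors n0 up p \<longleftrightarrow> j \<in> E (lab x)" using nested[OF x] j0 j by blast
qed

lemma laminar_forest_insert:
  assumes forest: "laminar_forest r n0 E lab n up" and n: "r < n0" "n0 \<le> n"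
    and below: "\<And>k. E k \<subseteq> {..<n0}"
    and nested: "\<And>x. x \<in> {n0..<n} \<Longrightarrow> E k \<subseteq> E (lab x) \<or> E k \<inter> E (lab x) = {}"
    and j0: "j0 \<in> E k" and up'_n: "up' n = (if j0 \<in> \<Union>(E ` lab ` {n0..<n}) then up j0 else r)"
    and up'_new: "\<And>j. j \<in> E k \<Longrightarrow> up' j = n" and up'_old: "\<And>y. y \<noteq> n \<Longrightarrow> y \<notin> E k \<Longrightarrow> up' y = up y"
  shows "laminar_forest r n0 E (lab(n := k)) (Suc n) up'"
proof -
  let ?old = "\<Union>(E ` lab ` {n0..<n})" and ?lab = "lab(n := k)"
  have nodes: "up x = r \<or> n0 \<le> up x \<and> up x < x" if "x \<in> {n0..<n}" for x
    using forest that unfolding laminar_forest_def by blast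
  have up'_node: "up' x = up x" if "x \<in> {n0..<n}" for x
    using that below[of k] by (intro up'_old) auto
  have anc: "ancestors n0 up' z = ancestors n0 up z" if "z < n" for z
    by (rule ancestors_cong) (use up'_node that in auto)
  have parent: "up' n = r \<or> n0 \<le> up' n \<and> up' n < n"
    using forest n(1) nested j0 up'_n by (rule laminar_forest_parent(1))
  have anc_parent: "x \<in> ancestors n0 up (up' n) \<longleftrightarrow> j \<in> E (lab x)" if "j \<in> E k" "x \<in> {n0..<n}" for j x
    using forest n(1) nested j0 up'_n that by (rule laminar_forest_parent(2))
  have "up' n < n" using parent n by auto
  then have anc_n: "ancestors n0 up' n = insert n (ancestors n0 up (up' n))"
    using n(2) by (simp add: ancestors_insert anc)
  have elems': "n0 \<le> up' j \<and> up' j < Suc n \<and> (\<forall>x\<in>{n0..<Suc n}. x \<in> ancestors n0 up' (up' j) \<longleftrightarrow> j \<in> E (?lab x))"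
    if "j \<in> E k \<union> ?old" for j
  proof (cases "j \<in> E k")
    case True
    then show ?thesis using anc_parent[OF True] n(2) by (auto simp: up'_new anc_n less_Suc_eq)
  next
    case False
    then have j: "j \<in> ?old" using that by blast
    then have old: "n0 \<le> up j" "up j < n" "\<And>x. x \<in> {n0..<n} \<Longrightarrow> x \<in> ancestors n0 up (up j) \<longleftrightarrow> j \<in> E (lab x)"
      using forest unfolding laminar_forest_def by blast+
    have "j < n0" using j below by blast
    then have "up' j = up j" using False n(2) by (intro up'_old) auto
    moreover have "n \<notin> ancestors n0 up (up j)" using ancestors_bounds[of n n0 up "up j"] old(2) by auto
    ultimately show ?thesis using old False anc[of "up j"] by (auto simp: less_Suc_eq)
  qed
  have covered: "\<Union>(E ` ?lab ` {n0..<Suc n}) = E k \<union> ?old"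
    using n(2) by (auto simp: atLeastLessThanSuc)
  have "up' x = r \<or> n0 \<le> up' x \<and> up' x < x" if "x \<in> {n0..<Suc n}" for x
    using nodes[of x] up'_node[of x] parent that by (cases "x = n") auto
  then show ?thesis unfolding laminar_forest_def covered using elems' by blast
qed

section \<open>Classifications seen from one side of the graph\<close>

text \<open>
  Class numbers alone would not identify a class, because two vertices may share them.  \<open>Root u\<close>
  stands for the whole neighbourhood of \<open>u\<close>, with the quota of \<open>u\<close>.
\<close>

datatype class_key = Root nat | Class nat nat

fun owner :: "class_key \<Rightarrow> nat" where
  "owner (Root u) = u"
| "owner (Class u c) = u"

text \<open>Edge \<open>j\<close> joins the vertex \<open>own j\<close> of the side under consideration to \<open>opp j\<close>.\<close>

locale classified_side =
  fixes m :: nat and own opp vertex_quota class_bound :: "nat \<Rightarrow> nat"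
    and numbers members :: "nat \<Rightarrow> nat set"
  assumes inj_edges: "inj_on (\<lambda>j. (own j, opp j)) {..<m}"
    and finite_numbers: "\<And>u. u \<in> own ` {..<m} \<Longrightarrow> finite (numbers u)"
    and members_subset: "\<And>u c. u \<in> own ` {..<m} \<Longrightarrow> c \<in> numbers u \<Longrightarrow> members c \<subseteq> opp ` {j. j < m \<and> own j = u}"
    and inj_members: "\<And>u. u \<in> own ` {..<m} \<Longrightarrow> inj_on members (numbers u)"
    and laminar_members: "\<And>u. u \<in> own ` {..<m} \<Longrightarrow> laminar (members ` numbers u)"
begin

definition ends :: "nat set" where
  "ends = own ` {..<m}"

fun key_edges :: "class_key \<Rightarrow> nat set" where
  "key_edges (Root u) = {j. j < m \<and> own j = u}"
| "key_edges (Class u c) = {j. j < m \<and> own j = u \<and> opp j \<in> members c}"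

fun key_quota :: "class_key \<Rightarrow> nat" where
  "key_quota (Root u) = vertex_quota u"
| "key_quota (Class u c) = class_bound c"

definition vertex_keys :: "nat \<Rightarrow> class_key set" where
  "vertex_keys u = insert (Root u) (Class u ` {c \<in> numbers u. members c \<noteq> {}})"

definition keys :: "nat set \<Rightarrow> class_key set" where
  "keys A = (\<Union>u\<in>A. vertex_keys u)"

lemma keys_empty [simp]: "keys {} = {}"
  and keys_insert: "keys (insert u A) = vertex_keys u \<union> keys A"
  by (simp_all add: keys_def)

lemma key_edgesD: "j \<in> key_edges k \<Longrightarrow> j < m \<and> own j = owner k"
  by (cases k) auto

lemma owner_vertex_keys: "k \<in> vertex_keys u \<Longrightarrow> owner k = u"
  by (auto simp: vertex_keys_def)

lemma owner_keys: "owner ` keys A = A"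
  by (force simp: keys_def vertex_keys_def)

lemma opp_image_key_edges:
  assumes "u \<in> ends" "c \<in> numbers u"
  shows "opp ` key_edges (Class u c) = members c"
  using members_subset assms by (fastforce simp: ends_def)

lemma finite_members: "u \<in> ends \<Longrightarrow> c \<in> numbers u \<Longrightarrow> finite (members c)"
  using opp_image_key_edges[of u c]
  by (metis finite_imageI finite_lessThan finite_subset key_edgesD lessThan_iff subsetI)

lemma card_members_le:
  assumes "u \<in> ends" "c \<in> numbers u"
  shows "card (members c) \<le> m"
proof -
  have "key_edges (Class u c) \<subseteq> {..<m}" using key_edgesD by blast
  then have "card (opp ` key_edges (Class u c)) \<le> card {..<m}"
    by (meson card_image_le card_mono finite_lessThan finite_subset order_trans)
  then show ?thesis by (simp only: opp_image_key_edges[OF assms] card_lessThan)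
qed

lemma members_laminarD:
  assumes "u \<in> ends" "c \<in> numbers u" "d \<in> numbers u"
  shows "members c \<subseteq> members d \<or> members d \<subseteq> members c \<or> members c \<inter> members d = {}"
  by (rule laminarD[OF laminar_members]) (use assms in \<open>auto simp: ends_def\<close>)

lemma Root_edges_disjoint: "owner k \<noteq> u \<Longrightarrow> key_edges (Root u) \<inter> key_edges k = {}"
  using key_edgesD[of _ k] by auto

lemma Class_edges_subset_or_disjoint:
  assumes u: "u \<in> ends" and c: "c \<in> numbers u" and k: "k \<noteq> Class u c"
    and larger: "\<And>c'. k = Class u c' \<Longrightarrow> c' \<in> numbers u \<and> card (members c) \<le> card (members c')"
  shows "key_edges (Class u c) \<subseteq> key_edges k \<or> key_edges (Class u c) \<inter> key_edges k = {}"
proof (cases "owner k = u")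
  case False
  then show ?thesis using key_edgesD[of _ k] by auto
next
  case True
  show ?thesis
  proof (cases k)
    case (Root v)
    then show ?thesis using True by auto
  next
    case (Class v c')
    then have c': "k = Class u c'" "c' \<in> numbers u" "card (members c) \<le> card (members c')" "c' \<noteq> c"
      using True larger[of c'] k by auto
    have "members c' \<noteq> members c"
      using inj_onD[OF inj_members, of u c' c] u c c' by (auto simp: ends_def)
    moreover have "\<not> members c' \<subset> members c"
      using psubset_card_mono[OF finite_members[OF u c]] c'(3) by (meson not_less)
    ultimately have "members c \<subseteq> members c' \<or> members c' \<inter> members c = {}"
      using members_laminarD[OF u c'(2) c] by blast
    then show ?thesis using c'(1) by auto
  qed
qed

lemma card_numbers_le_vertex_keys:
  assumes "u \<in> ends"
  shows "card (numbers u) \<le> card (vertex_keys u)"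
proof -
  have fin: "finite (numbers u)" using finite_numbers assms by (simp add: ends_def)
  have "c = d" if "c \<in> numbers u" "d \<in> numbers u" "members c = {}" "members d = {}" for c d
    using inj_onD[OF inj_members, of u c d] that assms by (simp add: ends_def)
  then have "card {c \<in> numbers u. members c = {}} \<le> 1"
    using fin by (simp add: card_le_Suc0_iff_eq)
  moreover have "{c \<in> numbers u. members c = {}} \<union> {c \<in> numbers u. members c \<noteq> {}} = numbers u" by auto
  then have "card (numbers u) \<le> card {c \<in> numbers u. members c = {}} + card {c \<in> numbers u. members c \<noteq> {}}"
    using card_Un_le[of "{c \<in> numbers u. members c = {}}" "{c \<in> numbers u. members c \<noteq> {}}"] by (simp only:)
  moreover have "card (vertex_keys u) = card {c \<in> numbers u. members c \<noteq> {}} + 1"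
    unfolding vertex_keys_def using fin by (subst card_insert_disjoint) (auto simp: card_image inj_on_def)
  ultimately show ?thesis by simp
qed

lemma finite_vertex_keys: "u \<in> ends \<Longrightarrow> finite (vertex_keys u)"
  using finite_numbers by (simp add: vertex_keys_def ends_def)

lemma sum_card_numbers_le: "(\<Sum>u\<in>ends. card (numbers u)) \<le> card (keys ends)"
proof -
  have "(\<Sum>u\<in>ends. card (numbers u)) \<le> (\<Sum>u\<in>ends. card (vertex_keys u))"
    by (intro sum_mono card_numbers_le_vertex_keys)
  also have "\<dots> = card (keys ends)"
    unfolding keys_def
  proof (rule card_UN_disjoint[symmetric])
    show "finite ends" by (simp add: ends_def)
    show "\<forall>u\<in>ends. finite (vertex_keys u)" using finite_vertex_keys by blast
    show "\<forall>u\<in>ends. \<forall>v\<in>ends. u \<noteq> v \<longrightarrow> vertex_keys u \<inter> vertex_keys v = {}"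
      using owner_vertex_keys by blast
  qed
  finally show ?thesis .
qed

definition class_keys :: "class_key set" where
  "class_keys = {Class u c | u c. u \<in> ends \<and> c \<in> numbers u \<and> members c \<noteq> {}}"

lemma inj_on_key_edges: "inj_on key_edges class_keys"
proof (rule inj_onI)
  fix k k' assume keys: "k \<in> class_keys" "k' \<in> class_keys" and eq: "key_edges k = key_edges k'"
  from keys obtain u c u' c' where k: "k = Class u c" "u \<in> ends" "c \<in> numbers u" "members c \<noteq> {}"
    and k': "k' = Class u' c'" "u' \<in> ends" "c' \<in> numbers u'" unfolding class_keys_def by blast
  have members: "members c = members c'"
    using opp_image_key_edges[OF k(2,3)] opp_image_key_edges[OF k'(2,3)] eq k(1) k'(1) by metis
  obtain j where "j \<in> key_edges k" using opp_image_key_edges[OF k(2,3)] k(1,4) by blast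
  then have "owner k = owner k'" using key_edgesD eq by metis
  then have "u = u'" using k(1) k'(1) by simp
  moreover have "inj_on members (numbers u)" using inj_members k(2) by (simp only: ends_def)
  ultimately have "c = c'" using members k(3) k'(3) by (meson inj_onD)
  then show "k = k'" using k(1) k'(1) \<open>u = u'\<close> by simp
qed

lemma laminar_key_edges: "laminar (key_edges ` class_keys)"
  unfolding laminar_def
proof (intro ballI)
  fix X Y assume "X \<in> key_edges ` class_keys" "Y \<in> key_edges ` class_keys"
  then obtain u c u' c' where X: "X = key_edges (Class u c)" "u \<in> ends" "c \<in> numbers u"
    and Y: "Y = key_edges (Class u' c')" "c' \<in> numbers u'"
    unfolding class_keys_def by blast
  show "X \<subseteq> Y \<or> Y \<subseteq> X \<or> X \<inter> Y = {}"
  proof (cases "u = u'")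
    case True
    then show ?thesis using members_laminarD[OF X(2,3), of c'] X Y by auto
  qed (use X Y in auto)
qed

lemma card_keys_ends_le: "card (keys ends) \<le> 3 * m"
proof -
  have "card (key_edges ` class_keys) \<le> 2 * card {..<m}"
  proof (rule card_laminar_le[OF _ _ laminar_key_edges])
    show "key_edges ` class_keys \<subseteq> Pow {..<m}" using key_edgesD by auto
    show "{} \<notin> key_edges ` class_keys"
    proof
      assume "{} \<in> key_edges ` class_keys"
      then obtain u c where "u \<in> ends" "c \<in> numbers u" "members c \<noteq> {}" "key_edges (Class u c) = {}"
        unfolding class_keys_def by blast
      then show False using opp_image_key_edges by (metis image_empty)
    qed
  qed simp
  then have "card class_keys \<le> 2 * m" by (simp add: card_image inj_on_key_edges)
  moreover have "card (Root ` ends) \<le> m"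
    unfolding ends_def by (metis card_image_le card_lessThan finite_imageI finite_lessThan order_trans)
  moreover have "keys ends = Root ` ends \<union> class_keys" by (auto simp: keys_def vertex_keys_def class_keys_def)
  ultimately show ?thesis using card_Un_le[of "Root ` ends" class_keys] by simp
qed

definition partners_in :: "nat set \<Rightarrow> nat \<Rightarrow> nat set" where
  "partners_in X u = opp ` {j \<in> X. own j = u}"

lemma card_partners_in:
  assumes "X \<subseteq> {..<m}"
  shows "card (partners_in X u) = card (X \<inter> key_edges (Root u))"
    and "card (partners_in X u \<inter> members c) = card (X \<inter> key_edges (Class u c))"
proof -
  have inj: "inj_on opp {j \<in> X. own j = u}"
    using inj_on_subset[OF inj_edges assms] by (auto simp: inj_on_def)
  have "X \<inter> key_edges (Root u) = {j \<in> X. own j = u}" using assms by auto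
  then show "card (partners_in X u) = card (X \<inter> key_edges (Root u))"
    using card_image[OF inj] by (simp add: partners_in_def)
  have "partners_in X u \<inter> members c = opp ` (X \<inter> key_edges (Class u c))"
    using assms by (auto simp: partners_in_def)
  moreover have "inj_on opp (X \<inter> key_edges (Class u c))" by (rule inj_on_subset[OF inj]) auto
  ultimately show "card (partners_in X u \<inter> members c) = card (X \<inter> key_edges (Class u c))"
    by (simp only: card_image)
qed

lemma keys_fit_iff:
  assumes X: "X \<subseteq> {..<m}"
  shows "(\<forall>k\<in>keys ends. card (X \<inter> key_edges k) \<le> key_quota k) \<longleftrightarrow>
    (\<forall>u\<in>ends. card (partners_in X u) \<le> vertex_quota u \<and>
       (\<forall>c\<in>numbers u. card (partners_in X u \<inter> members c) \<le> class_bound c))"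
proof -
  have "card (X \<inter> key_edges (Class u c)) = 0" if "members c = {}" for u c using that by simp
  then have "(\<forall>k\<in>vertex_keys u. card (X \<inter> key_edges k) \<le> key_quota k) \<longleftrightarrow>
      card (X \<inter> key_edges (Root u)) \<le> vertex_quota u \<and>
      (\<forall>c\<in>numbers u. card (X \<inter> key_edges (Class u c)) \<le> class_bound c)" for u
    unfolding vertex_keys_def by (simp del: key_edges.simps) (metis le0)
  then show ?thesis unfolding keys_def card_partners_in[OF X] by blast
qed

end

section \<open>Constructing the forests\<close>

lemma bij_betw_fun_upd:
  assumes "bij_betw f A B" "a \<notin> A" "b \<notin> B"
  shows "bij_betw (f(a := b)) (insert a A) (insert b B)"
proof -
  have "inj_on (f(a := b)) A" using assms by (simp add: bij_betw_def inj_on_fun_updI)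
  moreover have "f(a := b) ` A = B" using assms by (auto simp: bij_betw_def)
  ultimately show ?thesis using assms by (simp add: bij_betw_def)
qed

lemma sum_first_occurrences:
  fixes g :: "'a \<Rightarrow> nat" and n :: nat
  shows "(\<Sum>i<n. if f i \<in> f ` {..<i} then 0 else g (f i)) = sum g (f ` {..<n})"
  by (induction n) (auto simp: lessThan_Suc insert_absorb)

definition node_com :: "vname \<Rightarrow> vname \<Rightarrow> com" where
  "node_com Up Self =
     (Write Up (V ''n'') (V ''parent'');; Write Self (V ''n'') (V ''n'');;
      Write ''cap'' (V ''n'') (Add (V ''bound'') (Num 1));; Write ''flow'' (V ''n'') (Num 1);;
      ''n'' ::= Add (V ''n'') (Num 1))"

definition attach_root_com :: "vname \<Rightarrow> vname \<Rightarrow> vname \<Rightarrow> com" where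
  "attach_root_com Own Opp Up =
     For ''j'' (V ''edge_count'')
       (Cond (Equal (Read Own (V ''j'')) (V ''u''))
         (Write ''idx'' (Read Opp (V ''j'')) (V ''j'');; Write Up (V ''j'') (V ''n'')) Skip)"

definition root_com :: "vname \<Rightarrow> vname \<Rightarrow> vname \<Rightarrow> vname \<Rightarrow> aexp \<Rightarrow> com" where
  "root_com Own Opp Up Self root_node =
     (attach_root_com Own Opp Up;; ''parent'' ::= root_node;; ''bound'' ::= Read ''quota'' (V ''u'');;
      node_com Up Self)"

definition attach_class_com :: "vname \<Rightarrow> com" where
  "attach_class_com Up =
     For ''j'' (Read ''member_count'' (V ''c''))
       (Write Up (Read ''idx'' (Read ''member'' (Add (Read ''member_start'' (V ''c'')) (V ''j'')))) (V ''n''))"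

definition class_com :: "vname \<Rightarrow> vname \<Rightarrow> com" where
  "class_com Up Self =
     (''parent'' ::= Read Up (Read ''idx'' (Read ''member'' (Read ''member_start'' (V ''c''))));;
      attach_class_com Up;; ''bound'' ::= Read ''class_quota'' (V ''c'');; node_com Up Self)"

text \<open>
  The classes of a vertex are inserted by decreasing size, so that every class is below the ones
  containing it; \<open>z\<close> is the number of edges minus the current size.
\<close>

definition sized_class_com :: "vname \<Rightarrow> vname \<Rightarrow> com" where
  "sized_class_com Up Self =
     (''c'' ::= Add (Read ''class_start'' (V ''u'')) (V ''l'');;
      Cond (Equal (Add (Read ''member_count'' (V ''c'')) (V ''z'')) (V ''edge_count''))
        (class_com Up Self) Skip)"

definition size_com :: "vname \<Rightarrow> vname \<Rightarrow> com" where
  "size_com Up Self = For ''l'' (Read ''class_count'' (V ''u'')) (sized_class_com Up Self)"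

definition classes_com :: "vname \<Rightarrow> vname \<Rightarrow> com" where
  "classes_com Up Self = For ''z'' (V ''edge_count'') (size_com Up Self)"

definition vertex_com :: "vname \<Rightarrow> vname \<Rightarrow> vname \<Rightarrow> vname \<Rightarrow> aexp \<Rightarrow> com" where
  "vertex_com Own Opp Up Self root_node =
     (''u'' ::= Read Own (V ''i'');;
      Cond (Equal (Read ''seen'' (V ''u'')) (Num 0))
        (Write ''seen'' (V ''u'') (Num 1);; root_com Own Opp Up Self root_node;; classes_com Up Self) Skip)"

definition side_com :: "vname \<Rightarrow> vname \<Rightarrow> vname \<Rightarrow> vname \<Rightarrow> aexp \<Rightarrow> com" where
  "side_com Own Opp Up Self root_node =
     For ''i'' (V ''edge_count'') (vertex_com Own Opp Up Self root_node)"

lemma written_node [simp]: "written (node_com Up Self) = {Up, Self, ''cap'', ''flow'', ''n''}"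
  by (auto simp: node_com_def)
lemma written_attach_root [simp]: "written (attach_root_com Own Opp Up) = {Up, ''idx'', ''j''}"
  by (auto simp: attach_root_com_def)
lemma written_attach_class [simp]: "written (attach_class_com Up) = {Up, ''j''}"
  by (auto simp: attach_class_com_def)
lemma written_root [simp]:
  "written (root_com Own Opp Up Self root_node) =
    {Up, Self, ''cap'', ''flow'', ''n'', ''idx'', ''j'', ''parent'', ''bound''}"
  by (auto simp: root_com_def)
lemma written_class [simp]:
  "written (class_com Up Self) = {Up, Self, ''cap'', ''flow'', ''n'', ''j'', ''parent'', ''bound''}"
  by (auto simp: class_com_def)
lemma written_sized_class [simp]:
  "written (sized_class_com Up Self) = {Up, Self, ''cap'', ''flow'', ''n'', ''j'', ''parent'', ''bound'', ''c''}"
  by (auto simp: sized_class_com_def)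
lemma written_size [simp]:
  "written (size_com Up Self) = {Up, Self, ''cap'', ''flow'', ''n'', ''j'', ''parent'', ''bound'', ''c'', ''l''}"
  by (auto simp: size_com_def)
lemma written_classes [simp]:
  "written (classes_com Up Self) =
    {Up, Self, ''cap'', ''flow'', ''n'', ''j'', ''parent'', ''bound'', ''c'', ''l'', ''z''}"
  by (auto simp: classes_com_def)
lemma written_vertex [simp]: "written (vertex_com Own Opp Up Self root_node) =
    {Up, Self, ''cap'', ''flow'', ''n'', ''j'', ''parent'', ''bound'', ''c'', ''l'', ''z'', ''idx'', ''seen'', ''u''}"
  by (auto simp: vertex_com_def)
lemma written_side [simp]: "written (side_com Own Opp Up Self root_node) =
    {Up, Self, ''cap'', ''flow'', ''n'', ''j'', ''parent'', ''bound'', ''c'', ''l'', ''z'', ''idx'', ''seen'',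
      ''u'', ''i''}"
  by (auto simp: side_com_def)

lemma loop_free_node [simp]: "loop_free (node_com Up Self)"
  and max_cost_node [simp]: "max_cost (node_com Up Self) = 27"
  by (simp_all add: node_com_def)

definition class_numbers :: "state \<Rightarrow> nat \<Rightarrow> nat set" where
  "class_numbers s u = {s ''class_start'' u..<s ''class_start'' u + s ''class_count'' u}"

definition member_cells :: "state \<Rightarrow> nat \<Rightarrow> nat set" where
  "member_cells s c = {s ''member_start'' c..<s ''member_start'' c + s ''member_count'' c}"

definition class_members :: "state \<Rightarrow> nat \<Rightarrow> nat set" where
  "class_members s c = s ''member'' ` member_cells s c"

definition same_inputs :: "state \<Rightarrow> state \<Rightarrow> bool" where
  "same_inputs s s' \<longleftrightarrow> (\<forall>x\<in>input_arrays. s' x = s x)"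

lemma same_inputsD: "same_inputs s s' \<Longrightarrow> x \<in> input_arrays \<Longrightarrow> s' x = s x"
  by (simp add: same_inputs_def)

lemma same_inputs_simps:
  assumes "same_inputs s s'"
  shows "s' ''edge_count'' = s ''edge_count''" "s' ''quota'' = s ''quota''"
    "s' ''class_count'' = s ''class_count''" "s' ''class_start'' = s ''class_start''"
    "s' ''class_quota'' = s ''class_quota''" "s' ''member_count'' = s ''member_count''"
    "s' ''member_start'' = s ''member_start''" "s' ''member'' = s ''member''"
  using assms by (simp_all add: same_inputs_def input_arrays_def)

locale side_program =
  classified_side "s ''edge_count'' 0" "s Own" "s Opp" "s ''quota''" "s ''class_quota''"
    "class_numbers s" "class_members s"
  for s :: state and Own Opp :: vname +
  fixes Up Self :: vname and root_node :: aexp and n0 r :: nat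
  assumes names: "(Own, Opp, Up, Self) = (''edge_applicant'', ''edge_post'', ''tail'', ''head'') \<or>
      (Own, Opp, Up, Self) = (''edge_post'', ''edge_applicant'', ''head'', ''tail'')"
    and aval_root_node: "\<And>s'. same_inputs s s' \<Longrightarrow> aval root_node s' = r"
    and acost_root_node: "acost root_node \<le> 4"
    and r: "r < n0" and n0: "s ''edge_count'' 0 \<le> n0"
    and inj_member: "\<And>u c. u \<in> s Own ` {..<s ''edge_count'' 0} \<Longrightarrow> c \<in> class_numbers s u \<Longrightarrow>
      inj_on (s ''member'') (member_cells s c)"
begin

abbreviation "m \<equiv> s ''edge_count'' 0"
abbreviation "own \<equiv> s Own"
abbreviation "opp \<equiv> s Opp"

lemma Own_Opp_inputs [simp]: "Own \<in> input_arrays" "Opp \<in> input_arrays"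
  using names by (auto simp: input_arrays_def)

lemma Up_Self_neq:
  "\<forall>x\<in>{''edge_count'', ''edge_applicant'', ''edge_post'', ''edge_rank'', ''quota'', ''class_count'',
    ''class_start'', ''class_quota'', ''member_count'', ''member_start'', ''member'', ''n'', ''u'', ''c'', ''i'',
    ''j'', ''z'', ''l'', ''idx'', ''seen'', ''cap'', ''flow'', ''parent'', ''bound''}.
    Up \<noteq> x \<and> x \<noteq> Up \<and> Self \<noteq> x \<and> x \<noteq> Self"
  using names by auto

lemma Own_Opp_neq:
  "\<forall>x\<in>{''n'', ''u'', ''c'', ''i'', ''j'', ''z'', ''l'', ''idx'', ''seen'', ''cap'', ''flow'', ''parent'', ''bound''}.
    Own \<noteq> x \<and> Opp \<noteq> x"
  using names by auto

lemmas names_neq [simp] = Up_Self_neq[unfolded ball_simps] Own_Opp_neq[unfolded ball_simps]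

lemma array_names_distinct [simp]:
  "Own \<noteq> Up" "Own \<noteq> Self" "Opp \<noteq> Up" "Opp \<noteq> Self" "Up \<noteq> Self" "Self \<noteq> Up"
  using names by auto

lemmas same_inputs_facts =
  same_inputs_simps same_inputsD[OF _ Own_Opp_inputs(1)] same_inputsD[OF _ Own_Opp_inputs(2)]

lemma member_count_eq:
  assumes "u \<in> ends" "c \<in> class_numbers s u"
  shows "s ''member_count'' c = card (class_members s c)"
  using inj_member[of u c] assms by (simp add: class_members_def card_image ends_def member_cells_def)

definition forest_built :: "(nat \<Rightarrow> class_key) \<Rightarrow> class_key set \<Rightarrow> nat \<Rightarrow> state \<Rightarrow> bool" where
  "forest_built lab K n s' \<longleftrightarrow> n0 \<le> n \<and> bij_betw lab {n0..<n} K \<and> laminar_forest r n0 key_edges lab n (s' Up) \<and>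
     (\<forall>x\<in>{n0..<n}. s' Self x = x \<and> s' ''flow'' x = 1 \<and> s' ''cap'' x = key_quota (lab x) + 1)"

definition lower_kept :: "state \<Rightarrow> state \<Rightarrow> bool" where
  "lower_kept \<sigma> s' \<longleftrightarrow> (\<forall>y. m \<le> y \<and> y < n0 \<longrightarrow> s' Up y = \<sigma> Up y) \<and>
     (\<forall>y<n0. s' Self y = \<sigma> Self y \<and> s' ''cap'' y = \<sigma> ''cap'' y \<and> s' ''flow'' y = \<sigma> ''flow'' y)"

definition constructed :: "state \<Rightarrow> class_key set \<Rightarrow> state \<Rightarrow> bool" where
  "constructed \<sigma> K s' \<longleftrightarrow> same_inputs s s' \<and> (\<exists>lab. forest_built lab K (s' ''n'' 0) s') \<and> lower_kept \<sigma> s'"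

lemma forest_built_cong:
  assumes built: "forest_built lab K n s1"
    and "\<And>y. y < m \<or> n0 \<le> y \<and> y < n \<Longrightarrow> s2 Up y = s1 Up y"
    and "\<And>y. n0 \<le> y \<Longrightarrow> y < n \<Longrightarrow>
      s2 Self y = s1 Self y \<and> s2 ''flow'' y = s1 ''flow'' y \<and> s2 ''cap'' y = s1 ''cap'' y"
  shows "forest_built lab K n s2"
proof -
  have "laminar_forest r n0 key_edges lab n (s2 Up)"
    using built unfolding forest_built_def
    by (elim conjE laminar_forest_cong) (use assms(2) key_edgesD in auto)
  then show ?thesis using built assms(3) unfolding forest_built_def by simp
qed

lemma forest_built_edge:
  assumes built: "forest_built lab (keys ends) n s'" and j: "j < m"
  shows "n0 \<le> s' Up j" "s' Up j < n"
    and "x \<in> {n0..<n} \<Longrightarrow> x \<in> ancestors n0 (s' Up) (s' Up j) \<longleftrightarrow> j \<in> key_edges (lab x)"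
proof -
  have "Root (own j) \<in> keys ends" using j by (auto simp: keys_def vertex_keys_def ends_def)
  then have "Root (own j) \<in> lab ` {n0..<n}" using built by (simp add: forest_built_def bij_betw_def)
  moreover have "j \<in> key_edges (Root (own j))" using j by simp
  ultimately have "j \<in> \<Union>(key_edges ` lab ` {n0..<n})" by blast
  then have "n0 \<le> s' Up j \<and> s' Up j < n \<and>
      (\<forall>x\<in>{n0..<n}. x \<in> ancestors n0 (s' Up) (s' Up j) \<longleftrightarrow> j \<in> key_edges (lab x))"
    using built unfolding forest_built_def laminar_forest_def by blast
  then show "n0 \<le> s' Up j" "s' Up j < n"
    "x \<in> {n0..<n} \<Longrightarrow> x \<in> ancestors n0 (s' Up) (s' Up j) \<longleftrightarrow> j \<in> key_edges (lab x)" by blast+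
qed

lemma forest_built_node:
  assumes "forest_built lab K n s'" "x \<in> {n0..<n}"
  shows "s' Up x = r \<or> n0 \<le> s' Up x \<and> s' Up x < x" "s' Self x = x" "s' ''flow'' x = 1"
    "s' ''cap'' x = key_quota (lab x) + 1"
  using assms unfolding forest_built_def laminar_forest_def by blast+

lemma forest_built_fit_iff:
  assumes "forest_built lab K n s'"
  shows "(\<forall>x\<in>{n0..<n}. card (X \<inter> key_edges (lab x)) \<le> s' ''cap'' x - 1) \<longleftrightarrow>
    (\<forall>k\<in>K. card (X \<inter> key_edges k) \<le> key_quota k)"
proof -
  have "K = lab ` {n0..<n}" using assms by (simp add: forest_built_def bij_betw_def)
  then show ?thesis using forest_built_node(4)[OF assms] by simp
qed

lemma forest_built_node_count:
  assumes "forest_built lab K n s'"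
  shows "n = n0 + card K"
proof -
  have "n0 \<le> n" "bij_betw lab {n0..<n} K" using assms by (simp_all add: forest_built_def)
  then show ?thesis using bij_betw_same_card by fastforce
qed

lemma constructed_inputs: "constructed \<sigma> K s' \<Longrightarrow> same_inputs s s'"
  by (simp add: constructed_def)

lemma constructed_node_count: "constructed \<sigma> K s' \<Longrightarrow> s' ''n'' 0 = n0 + card K"
  unfolding constructed_def using forest_built_node_count by blast

lemma constructed_node_fresh: "constructed \<sigma> K s' \<Longrightarrow> s' ''n'' 0 \<notin> key_edges k"
  using constructed_node_count[of \<sigma> K s'] key_edgesD[of _ k] n0 by fastforce

lemma constructed_frame:
  assumes "constructed \<sigma> K s'" "unchanged_except X s' s''"
    and "X \<inter> (input_arrays \<union> {Up, Self, ''cap'', ''flow'', ''n''}) = {}"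
  shows "constructed \<sigma> K s''"
proof -
  have same: "s'' x = s' x" if "x \<in> input_arrays \<union> {Up, Self, ''cap'', ''flow'', ''n''}" for x
    using assms(2,3) that by blast
  then have "same_inputs s s''" using assms(1) by (simp add: constructed_def same_inputs_def)
  then show ?thesis
    using assms(1) same[of Up] same[of Self] same[of "''cap''"] same[of "''flow''"] same[of "''n''"]
    by (simp add: constructed_def forest_built_def lower_kept_def)
qed

lemma constructed_empty:
  assumes "same_inputs s \<sigma>" "\<sigma> ''n'' 0 = n0"
  shows "constructed \<sigma> {} \<sigma>"
  using assms by (simp add: constructed_def forest_built_def lower_kept_def laminar_forest_empty bij_betw_def)

definition node_added :: "class_key \<Rightarrow> nat \<Rightarrow> state \<Rightarrow> state \<Rightarrow> bool" where
  "node_added k p s1 s2 \<longleftrightarrow> (let n = s1 ''n'' 0 in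
     s2 ''n'' 0 = Suc n \<and> s2 Up = (\<lambda>y. if y \<in> key_edges k then n else if y = n then p else s1 Up y) \<and>
     s2 Self = (s1 Self)(n := n) \<and> s2 ''cap'' = (s1 ''cap'')(n := key_quota k + 1) \<and>
     s2 ''flow'' = (s1 ''flow'')(n := 1))"

lemma effect_node_added:
  assumes "s2 Up = (\<lambda>y. if y \<in> key_edges k then s1 ''n'' 0 else s1 Up y)"
    and "s2 Self = s1 Self" "s2 ''cap'' = s1 ''cap''" "s2 ''flow'' = s1 ''flow''" "s2 ''n'' = s1 ''n''"
    and "s2 ''parent'' 0 = p" "s2 ''bound'' 0 = key_quota k" "s1 ''n'' 0 \<notin> key_edges k"
  shows "node_added k p s1 (effect (node_com Up Self) s2)"
  using assms by (auto simp: node_added_def node_com_def fun_eq_iff)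

lemma constructed_insert:
  assumes con: "constructed \<sigma> K s1" and added: "node_added k p s1 s2" and inputs: "same_inputs s s2"
    and k: "k \<notin> K" "\<And>k'. k' \<in> K \<Longrightarrow> key_edges k \<subseteq> key_edges k' \<or> key_edges k \<inter> key_edges k' = {}"
    and j0: "j0 \<in> key_edges k" and p: "p = (if j0 \<in> \<Union>(key_edges ` K) then s1 Up j0 else r)"
  shows "constructed \<sigma> (insert k K) s2"
proof -
  let ?n = "s1 ''n'' 0"
  obtain lab where n: "n0 \<le> ?n" and bij: "bij_betw lab {n0..<?n} K"
    and forest: "laminar_forest r n0 key_edges lab ?n (s1 Up)"
    and nodes: "\<forall>x\<in>{n0..<?n}. s1 Self x = x \<and> s1 ''flow'' x = 1 \<and> s1 ''cap'' x = key_quota (lab x) + 1"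
    using con unfolding constructed_def forest_built_def by blast
  have K: "K = lab ` {n0..<?n}" using bij by (simp add: bij_betw_def)
  have s2: "s2 ''n'' 0 = Suc ?n"
    "s2 Up = (\<lambda>y. if y \<in> key_edges k then ?n else if y = ?n then p else s1 Up y)"
    "s2 Self = (s1 Self)(?n := ?n)" "s2 ''cap'' = (s1 ''cap'')(?n := key_quota k + 1)"
    "s2 ''flow'' = (s1 ''flow'')(?n := 1)"
    using added by (simp_all add: node_added_def Let_def)
  have edges_less: "y < n0" if "y \<in> key_edges k'" for y k'
    using key_edgesD[OF that] n0 by simp
  have interval: "{n0..<Suc ?n} = insert ?n {n0..<?n}" using n by auto
  have "laminar_forest r n0 key_edges (lab(?n := k)) (Suc ?n) (s2 Up)"
  proof (rule laminar_forest_insert[OF forest r n])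
    show "key_edges k' \<subseteq> {..<n0}" for k' using edges_less by auto
    show "key_edges k \<subseteq> key_edges (lab x) \<or> key_edges k \<inter> key_edges (lab x) = {}" if "x \<in> {n0..<?n}" for x
      using k(2) that K by blast
    show "s2 Up ?n = (if j0 \<in> \<Union>(key_edges ` lab ` {n0..<?n}) then s1 Up j0 else r)"
      using edges_less[of ?n k] n p K by (auto simp: s2(2))
    show "j0 \<in> key_edges k" by (rule j0)
  qed (simp_all add: s2(2))
  moreover have "bij_betw (lab(?n := k)) {n0..<Suc ?n} (insert k K)"
    unfolding interval by (rule bij_betw_fun_upd[OF bij _ k(1)]) simp
  ultimately have "forest_built (lab(?n := k)) (insert k K) (Suc ?n) s2"
    using nodes n unfolding forest_built_def interval by (simp add: s2)
  moreover have "lower_kept \<sigma> s2"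
    using con n key_edgesD[of _ k] unfolding constructed_def lower_kept_def s2 by fastforce
  ultimately show ?thesis using inputs unfolding constructed_def s2(1) by blast
qed

definition edge_index :: "nat \<Rightarrow> state \<Rightarrow> bool" where
  "edge_index u s' \<longleftrightarrow> (\<forall>j<m. own j = u \<longrightarrow> s' ''idx'' (opp j) = j)"

lemma runs_attach_root:
  assumes inputs: "same_inputs s s'" and su: "s' ''u'' 0 = u"
  shows "runs (attach_root_com Own Opp Up) s' (42 * m + 12)
    (\<lambda>s2. s2 Up = (\<lambda>y. if y \<in> key_edges (Root u) then s' ''n'' 0 else s' Up y) \<and> edge_index u s2)"
proof -
  let ?body = "Cond (Equal (Read Own (V ''j'')) (V ''u''))
    (Write ''idx'' (Read Opp (V ''j'')) (V ''j'');; Write Up (V ''j'') (V ''n'')) Skip"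
  note inputs = same_inputs_facts[OF inputs]
  let ?I = "\<lambda>i s2. s2 Up = (\<lambda>y. if y < i \<and> own y = u then s' ''n'' 0 else s' Up y) \<and>
    (\<forall>j<i. own j = u \<longrightarrow> s2 ''idx'' (opp j) = j)"
  show ?thesis
    unfolding attach_root_com_def
  proof (rule runs_For[where n = m and I = ?I and k = "\<lambda>_. 30"])
    fix i s2 assume i: "i < m" and I: "?I i s2" and j: "s2 ''j'' 0 = i"
      and frame: "unchanged_except (insert ''j'' (written ?body)) s' s2"
    have s2: "s2 Own = own" "s2 Opp = opp" "s2 ''u'' 0 = u" "s2 ''n'' 0 = s' ''n'' 0"
      using frame inputs su by simp_all
    have "opp j \<noteq> opp i" if "j < i" "own j = u" "own i = u" for j
      using inj_onD[OF inj_edges, of j i] that i by auto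
    then show "runs ?body s2 30 (?I (Suc i))"
      using I j s2 by (intro runs_loop_free) (auto simp: fun_eq_iff less_Suc_eq)
  next
    fix s2 assume "unchanged_except (insert ''j'' (written ?body)) s' s2"
    then show "aval (V ''edge_count'') s2 = m" using inputs by simp
  next
    fix s2 assume "?I m s2"
    then show "s2 Up = (\<lambda>y. if y \<in> key_edges (Root u) then s' ''n'' 0 else s' Up y) \<and> edge_index u s2"
      by (simp add: edge_index_def)
  qed simp_all
qed

lemma runs_root:
  assumes con: "constructed \<sigma> K s'" and u: "u \<in> ends" "u \<notin> owner ` K" and su: "s' ''u'' 0 = u"
  shows "runs (root_com Own Opp Up Self root_node) s' (80 * (m + 2))
    (\<lambda>s2. constructed \<sigma> (insert (Root u) K) s2 \<and> edge_index u s2)"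
  unfolding root_com_def
proof (rule runs_Seq[OF runs_attach_root[OF constructed_inputs[OF con] su]])
  let ?rest = "''parent'' ::= root_node;; ''bound'' ::= Read ''quota'' (V ''u'');; node_com Up Self"
  fix s2 assume loop: "s2 Up = (\<lambda>y. if y \<in> key_edges (Root u) then s' ''n'' 0 else s' Up y) \<and> edge_index u s2"
  assume "unchanged_except (written (attach_root_com Own Opp Up)) s' s2"
  then have frame: "unchanged_except {Up, ''idx'', ''j''} s' s2" by simp
  have inputs2: "same_inputs s s2"
    using constructed_inputs[OF con] frame by (auto simp: same_inputs_def input_arrays_def)
  note inputs = same_inputs_facts[OF inputs2]
  have added: "node_added (Root u) r s' (effect ?rest s2)"
    unfolding effect.simps
    using frame su inputs aval_root_node[OF inputs2] loop[THEN conjunct1] constructed_node_fresh[OF con, of "Root u"]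
    by (intro effect_node_added) simp_all
  obtain j0 where j0: "j0 \<in> key_edges (Root u)" using u(1) by (auto simp: ends_def)
  have disjoint: "key_edges (Root u) \<inter> key_edges k = {}" if "k \<in> K" for k
    using Root_edges_disjoint[of k u] u(2) that by blast
  have "constructed \<sigma> (insert (Root u) K) (effect ?rest s2)"
  proof (rule constructed_insert[OF con added _ _ _ j0])
    show "same_inputs s (effect ?rest s2)"
      using inputs2 by (auto simp: same_inputs_def node_com_def input_arrays_def)
    show "r = (if j0 \<in> \<Union> (key_edges ` K) then s' Up j0 else r)" using disjoint j0 by auto
    show "Root u \<notin> K" using u(2) by force
  qed (use disjoint in auto)
  moreover have "edge_index u (effect ?rest s2)"
    using loop by (simp add: edge_index_def node_com_def)
  ultimately show "runs ?rest s2 60 (\<lambda>s2. constructed \<sigma> (insert (Root u) K) s2 \<and> edge_index u s2)"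
    using acost_root_node by (intro runs_loop_free) simp_all
qed simp

lemma indexed_class_edges:
  assumes "u \<in> ends" "c \<in> class_numbers s u" "edge_index u s'"
  shows "(\<lambda>i. s' ''idx'' (s ''member'' (s ''member_start'' c + i))) ` {..<s ''member_count'' c} = key_edges (Class u c)"
proof -
  have "member_cells s c = (+) (s ''member_start'' c) ` {..<s ''member_count'' c}"
    by (simp add: member_cells_def lessThan_atLeast0 add.commute)
  then have "(\<lambda>i. s' ''idx'' (s ''member'' (s ''member_start'' c + i))) ` {..<s ''member_count'' c} =
      s' ''idx'' ` class_members s c"
    by (simp add: class_members_def image_image)
  also have "\<dots> = (\<lambda>j. s' ''idx'' (opp j)) ` key_edges (Class u c)"
    using opp_image_key_edges[OF assms(1,2)] by (metis image_image)
  also have "\<dots> = key_edges (Class u c)"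
    using assms(3) by (auto simp: edge_index_def image_iff)
  finally show ?thesis .
qed

lemma runs_attach_class:
  assumes inputs: "same_inputs s s'" and u: "u \<in> ends" and c: "c \<in> class_numbers s u"
    and idx: "edge_index u s'" and sc: "s' ''c'' 0 = c"
  shows "runs (attach_class_com Up) s' (24 * m + 13)
    (\<lambda>s2. s2 Up = (\<lambda>y. if y \<in> key_edges (Class u c) then s' ''n'' 0 else s' Up y))"
proof -
  let ?body = "Write Up (Read ''idx'' (Read ''member'' (Add (Read ''member_start'' (V ''c'')) (V ''j'')))) (V ''n'')"
  let ?cell = "\<lambda>i. s' ''idx'' (s ''member'' (s ''member_start'' c + i))"
  let ?I = "\<lambda>i s2. s2 Up = (\<lambda>y. if y \<in> ?cell ` {..<i} then s' ''n'' 0 else s' Up y)"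
  note inputs = same_inputs_facts[OF inputs]
  show ?thesis
    unfolding attach_class_com_def
  proof (rule runs_For[where n = "s ''member_count'' c" and I = ?I and k = "\<lambda>_. 11"])
    fix i s2 assume I: "?I i s2" and j: "s2 ''j'' 0 = i"
      and frame: "unchanged_except (insert ''j'' (written ?body)) s' s2"
    have s2: "s2 ''idx'' = s' ''idx''" "s2 ''member'' = s ''member''" "s2 ''member_start'' = s ''member_start''"
      "s2 ''c'' 0 = c" "s2 ''n'' 0 = s' ''n'' 0"
      using frame inputs sc by simp_all
    show "runs ?body s2 11 (?I (Suc i))"
      using I j s2 by (intro runs_loop_free) (auto simp: fun_eq_iff lessThan_Suc)
  next
    fix s2 assume "unchanged_except (insert ''j'' (written ?body)) s' s2"
    then show "aval (Read ''member_count'' (V ''c'')) s2 = s ''member_count'' c" using inputs sc by simp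
  next
    fix s2 assume "?I (s ''member_count'' c) s2"
    then show "s2 Up = (\<lambda>y. if y \<in> key_edges (Class u c) then s' ''n'' 0 else s' Up y)"
      by (simp only: indexed_class_edges[OF u c idx])
  next
    have "s ''member_count'' c \<le> m" using card_members_le[OF u c] member_count_eq[OF u c] by simp
    then show "(\<Sum>i<s ''member_count'' c. 11) + Suc (s ''member_count'' c) *
        (acost (Read ''member_count'' (V ''c'')) + 10) \<le> 24 * m + 13" by simp
  qed simp_all
qed

lemma first_member_edge:
  assumes "u \<in> ends" "c \<in> class_numbers s u" "edge_index u s'" "class_members s c \<noteq> {}"
  shows "s' ''idx'' (s ''member'' (s ''member_start'' c)) \<in> key_edges (Class u c)"
proof -
  have "0 < s ''member_count'' c"
    using assms(4) by (auto simp: class_members_def member_cells_def)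
  then have "(\<lambda>i. s' ''idx'' (s ''member'' (s ''member_start'' c + i))) 0 \<in> key_edges (Class u c)"
    unfolding indexed_class_edges[OF assms(1-3), symmetric] by (intro imageI) simp
  then show ?thesis by simp
qed

lemma constructed_insert_Class:
  assumes con: "constructed \<sigma> K s1" and u: "u \<in> ends" "Root u \<in> K"
    and c: "c \<in> class_numbers s u" "class_members s c \<noteq> {}" "Class u c \<notin> K"
    and larger: "\<And>c'. Class u c' \<in> K \<Longrightarrow>
      c' \<in> class_numbers s u \<and> card (class_members s c) \<le> card (class_members s c')"
    and idx: "edge_index u s1" and inputs: "same_inputs s s2"
    and added: "node_added (Class u c) (s1 Up (s1 ''idx'' (s ''member'' (s ''member_start'' c)))) s1 s2"
  shows "constructed \<sigma> (insert (Class u c) K) s2"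
proof (rule constructed_insert[OF con added inputs c(3)])
  let ?j0 = "s1 ''idx'' (s ''member'' (s ''member_start'' c))"
  show j0: "?j0 \<in> key_edges (Class u c)" by (rule first_member_edge[OF u(1) c(1) idx c(2)])
  then have "?j0 \<in> key_edges (Root u)" by simp
  then show "s1 Up ?j0 = (if ?j0 \<in> \<Union> (key_edges ` K) then s1 Up ?j0 else r)" using u(2) by auto
  show "key_edges (Class u c) \<subseteq> key_edges k \<or> key_edges (Class u c) \<inter> key_edges k = {}" if "k \<in> K" for k
    using Class_edges_subset_or_disjoint[OF u(1) c(1), of k] larger c(3) that by blast
qed

lemma runs_class:
  assumes con: "constructed \<sigma> K s'" and u: "u \<in> ends" "Root u \<in> K"
    and c: "c \<in> class_numbers s u" "class_members s c \<noteq> {}" "Class u c \<notin> K"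
    and larger: "\<And>c'. Class u c' \<in> K \<Longrightarrow>
      c' \<in> class_numbers s u \<and> card (class_members s c) \<le> card (class_members s c')"
    and idx: "edge_index u s'" and sc: "s' ''c'' 0 = c"
  shows "runs (class_com Up Self) s' (40 * (m + 2)) (constructed \<sigma> (insert (Class u c) K))"
  unfolding class_com_def
proof (rule runs_loop_free_Seq)
  let ?p = "s' Up (s' ''idx'' (s ''member'' (s ''member_start'' c)))" and ?k = "Class u c"
  let ?first = "''parent'' ::= Read Up (Read ''idx'' (Read ''member'' (Read ''member_start'' (V ''c''))))"
    and ?rest = "''bound'' ::= Read ''class_quota'' (V ''c'');; node_com Up Self"
  let ?s1 = "effect ?first s'"
  note inputs = same_inputs_facts[OF constructed_inputs[OF con]]
  have inputs1: "same_inputs s ?s1"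
    using constructed_inputs[OF con] by (auto simp: same_inputs_def input_arrays_def)
  have s1: "edge_index u ?s1" "?s1 ''c'' 0 = c" "?s1 ''parent'' 0 = ?p" "?s1 ''n'' = s' ''n''" "?s1 Up = s' Up"
    using idx sc inputs by (simp_all add: edge_index_def)
  show "runs (attach_class_com Up;; ?rest) ?s1 (24 * m + 45) (constructed \<sigma> (insert ?k K))"
  proof (rule runs_Seq[OF runs_attach_class[OF inputs1 u(1) c(1) s1(1,2)]])
    fix s2 assume "s2 Up = (\<lambda>y. if y \<in> key_edges ?k then ?s1 ''n'' 0 else ?s1 Up y)"
    then have up: "s2 Up = (\<lambda>y. if y \<in> key_edges ?k then s' ''n'' 0 else s' Up y)" unfolding s1(4,5) .
    assume "unchanged_except (written (attach_class_com Up)) ?s1 s2"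
    then have frame: "unchanged_except {Up, ''j'', ''parent''} s' s2" "s2 ''parent'' = ?s1 ''parent''" by simp_all
    have inputs2: "same_inputs s s2"
      using constructed_inputs[OF con] frame(1) by (auto simp: same_inputs_def input_arrays_def)
    have "node_added ?k ?p s' (effect ?rest s2)"
      unfolding effect.simps
      using frame(1) sc same_inputs_facts[OF inputs2] up constructed_node_fresh[OF con, of ?k] frame(2) s1(3)
      by (intro effect_node_added) simp_all
    moreover have "same_inputs s (effect ?rest s2)"
      using inputs2 by (auto simp: same_inputs_def node_com_def input_arrays_def)
    ultimately have "constructed \<sigma> (insert ?k K) (effect ?rest s2)"
      using constructed_insert_Class[OF con u c larger idx] by blast
    then show "runs ?rest s2 32 (constructed \<sigma> (insert ?k K))" by (intro runs_loop_free) simp_all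
  qed simp
qed simp_all

definition keys_upto :: "nat set \<Rightarrow> nat \<Rightarrow> nat \<Rightarrow> nat \<Rightarrow> class_key set" where
  "keys_upto A u z l = insert (Root u) (keys A) \<union>
     {Class u c | c. c \<in> class_numbers s u \<and> class_members s c \<noteq> {} \<and>
        (m < card (class_members s c) + z \<or>
         card (class_members s c) + z = m \<and> c < s ''class_start'' u + l)}"

lemma keys_upto_first:
  assumes "u \<in> ends"
  shows "keys_upto A u 0 0 = insert (Root u) (keys A)"
proof -
  have "\<not> m < card (class_members s c)" "\<not> c < s ''class_start'' u" if "c \<in> class_numbers s u" for c
    using card_members_le[OF assms that] that by (simp_all add: class_numbers_def)
  then show ?thesis by (auto simp: keys_upto_def)
qed

lemma keys_upto_last: "u \<in> ends \<Longrightarrow> keys_upto A u m 0 = keys (insert u A)"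
  using finite_members[of u] by (auto simp: keys_upto_def keys_insert vertex_keys_def card_gt_0_iff)

lemma keys_upto_next_size: "keys_upto A u (Suc z) 0 = keys_upto A u z (s ''class_count'' u)"
  by (auto simp: keys_upto_def class_numbers_def)

lemma keys_upto_Suc:
  assumes "l < s ''class_count'' u" "z < m"
  shows "keys_upto A u z (Suc l) = (let c = s ''class_start'' u + l in
    if card (class_members s c) + z = m then insert (Class u c) (keys_upto A u z l) else keys_upto A u z l)"
proof -
  let ?c = "s ''class_start'' u + l"
  have "?c \<in> class_numbers s u" using assms(1) by (simp add: class_numbers_def)
  moreover have "class_members s ?c \<noteq> {}" if "card (class_members s ?c) + z = m"
    using that assms(2) by auto
  ultimately show ?thesis by (auto simp: keys_upto_def less_Suc_eq Let_def)
qed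

definition insertion_cost :: "nat \<Rightarrow> nat \<Rightarrow> nat" where
  "insertion_cost z c = (if card (class_members s c) + z = m then 40 * (m + 2) else 0)"

lemma sum_insertion_cost_le: "(\<Sum>z<m. \<Sum>l<n. insertion_cost z (c l)) \<le> 40 * (m + 2) * n"
proof -
  have "(\<Sum>z<m. insertion_cost z d) \<le> 40 * (m + 2)" for d
  proof -
    have "(\<Sum>z<m. insertion_cost z d) \<le> (\<Sum>z<m. if z = m - card (class_members s d) then 40 * (m + 2) else 0)"
      by (intro sum_mono) (auto simp: insertion_cost_def)
    then show ?thesis by (simp add: sum.delta' split: if_splits)
  qed
  then have "(\<Sum>l<n. \<Sum>z<m. insertion_cost z (c l)) \<le> (\<Sum>l<n. 40 * (m + 2))" by (intro sum_mono)
  then show ?thesis by (subst sum.swap) (simp add: mult.commute)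
qed

lemma runs_sized_class:
  assumes con: "constructed \<sigma> (keys_upto A u z l) s'" and u: "u \<in> ends" "u \<notin> A"
    and z: "z < m" and l: "l < s ''class_count'' u" and idx: "edge_index u s'"
    and s': "s' ''u'' 0 = u" "s' ''z'' 0 = z" "s' ''l'' 0 = l"
  shows "runs (sized_class_com Up Self) s' (insertion_cost z (s ''class_start'' u + l) + 20)
    (constructed \<sigma> (keys_upto A u z (Suc l)))" (is "runs _ _ (insertion_cost z ?c + 20) ?Q")
  unfolding sized_class_com_def
proof (rule runs_loop_free_Seq)
  let ?cond = "Equal (Add (Read ''member_count'' (V ''c'')) (V ''z'')) (V ''edge_count'')"
    and ?s1 = "effect (''c'' ::= Add (Read ''class_start'' (V ''u'')) (V ''l'')) s'"
  have c: "?c \<in> class_numbers s u" using l by (simp add: class_numbers_def)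
  have con1: "constructed \<sigma> (keys_upto A u z l) ?s1"
    by (rule constructed_frame[OF con, where X = "{''c''}"]) (auto simp: input_arrays_def)
  note inputs = same_inputs_facts[OF constructed_inputs[OF con]]
  have s1: "?s1 ''c'' 0 = ?c" "edge_index u ?s1" "bval ?cond ?s1 \<longleftrightarrow> card (class_members s ?c) + z = m"
    using s' idx inputs member_count_eq[OF u(1) c] by (simp_all add: edge_index_def)
  show "runs (Cond ?cond (class_com Up Self) Skip) ?s1 (insertion_cost z ?c + 12) ?Q"
  proof (rule runs_Cond)
    assume "bval ?cond ?s1"
    then have size: "card (class_members s ?c) + z = m" using s1(3) by simp
    have "runs (class_com Up Self) ?s1 (40 * (m + 2)) (constructed \<sigma> (insert (Class u ?c) (keys_upto A u z l)))"
      using size z u c by (intro runs_class[OF con1 u(1) _ c _ _ _ s1(2,1)])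
        (auto simp: keys_upto_def keys_def vertex_keys_def)
    then show "runs (class_com Up Self) ?s1 (insertion_cost z ?c + 1) ?Q"
      by (rule runs_weaken) (use size keys_upto_Suc[OF l z] in \<open>simp_all add: insertion_cost_def Let_def\<close>)
  next
    assume "\<not> bval ?cond ?s1"
    then show "runs Skip ?s1 (insertion_cost z ?c + 1) ?Q"
      using con1 s1(3) keys_upto_Suc[OF l z] by (intro runs_Skip) (simp_all add: Let_def)
  qed simp
qed simp_all

lemma runs_size:
  assumes con: "constructed \<sigma> (keys_upto A u z 0) s'" and u: "u \<in> ends" "u \<notin> A" and z: "z < m"
    and idx: "edge_index u s'" and su: "s' ''u'' 0 = u" and sz: "s' ''z'' 0 = z"
  shows "runs (size_com Up Self) s'
    ((\<Sum>l<s ''class_count'' u. insertion_cost z (s ''class_start'' u + l)) + 50 * (s ''class_count'' u + 1))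
    (constructed \<sigma> (keys_upto A u (Suc z) 0))"
  unfolding size_com_def keys_upto_next_size
proof (rule runs_For[where n = "s ''class_count'' u" and I = "\<lambda>l. constructed \<sigma> (keys_upto A u z l)"
      and k = "\<lambda>l. insertion_cost z (s ''class_start'' u + l) + 20"])
  fix l s2 assume l: "l < s ''class_count'' u" and I: "constructed \<sigma> (keys_upto A u z l) s2" and sl: "s2 ''l'' 0 = l"
    and frame: "unchanged_except (insert ''l'' (written (sized_class_com Up Self))) s' s2"
  have "s2 ''u'' 0 = u" "s2 ''z'' 0 = z" "edge_index u s2" using frame su sz idx by (simp_all add: edge_index_def)
  then show "runs (sized_class_com Up Self) s2 (insertion_cost z (s ''class_start'' u + l) + 20)
      (constructed \<sigma> (keys_upto A u z (Suc l)))"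
    by (intro runs_sized_class[OF I u z l _ _ _ sl])
next
  fix s2 assume "unchanged_except (insert ''l'' (written (sized_class_com Up Self))) s' s2"
  then show "aval (Read ''class_count'' (V ''u'')) s2 = s ''class_count'' u"
    using same_inputs_facts[OF constructed_inputs[OF con]] su by simp
next
  fix l s2 v assume "constructed \<sigma> (keys_upto A u z l) s2"
  then show "constructed \<sigma> (keys_upto A u z l) (s2(''l'' := v))"
    by (rule constructed_frame[where X = "{''l''}"]) (auto simp: input_arrays_def)
qed (use con in \<open>simp_all add: sum.distrib\<close>)

lemma runs_classes:
  assumes con: "constructed \<sigma> (insert (Root u) (keys A)) s'" and u: "u \<in> ends" "u \<notin> A"
    and idx: "edge_index u s'" and su: "s' ''u'' 0 = u"
  shows "runs (classes_com Up Self) s' (100 * (m + 2) * (s ''class_count'' u + 1)) (constructed \<sigma> (keys (insert u A)))"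
proof -
  let ?cc = "s ''class_count'' u" and ?cost = "\<lambda>z. \<Sum>l<s ''class_count'' u. insertion_cost z (s ''class_start'' u + l)"
  let ?I = "\<lambda>z. constructed \<sigma> (keys_upto A u z 0)"
  note inputs = same_inputs_facts[OF constructed_inputs[OF con]]
  show ?thesis
    unfolding classes_com_def
  proof (rule runs_For[where n = m and I = ?I and k = "\<lambda>z. ?cost z + 50 * (?cc + 1)"])
    fix z s2 assume z: "z < m" and I: "?I z s2" and sz: "s2 ''z'' 0 = z"
      and frame: "unchanged_except (insert ''z'' (written (size_com Up Self))) s' s2"
    have "s2 ''u'' 0 = u" "edge_index u s2" using frame su idx by (simp_all add: edge_index_def)
    then show "runs (size_com Up Self) s2 (?cost z + 50 * (?cc + 1)) (?I (Suc z))"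
      by (intro runs_size[OF I u z _ _ sz])
  next
    fix s2 assume "unchanged_except (insert ''z'' (written (size_com Up Self))) s' s2"
    then show "aval (V ''edge_count'') s2 = m" using inputs by simp
  next
    fix z s2 v assume "?I z s2"
    then show "?I z (s2(''z'' := v))"
      by (rule constructed_frame[where X = "{''z''}"]) (auto simp: input_arrays_def)
  next
    show "(\<Sum>z<m. ?cost z + 50 * (?cc + 1)) + Suc m * (acost (V ''edge_count'') + 10) \<le> 100 * (m + 2) * (?cc + 1)"
      using sum_insertion_cost_le[of "\<lambda>l. s ''class_start'' u + l" ?cc] by (simp add: sum.distrib algebra_simps)
  qed (use con keys_upto_first[OF u(1)] keys_upto_last[OF u(1)] in simp_all)
qed

lemma sum_vertex_cost_le:
  "(\<Sum>i<m. (if own i \<in> own ` {..<i} then 0 else (m + 2) * (100 * s ''class_count'' (own i) + 180)) + 20) +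
    Suc m * 12 \<le> 500 * (m + 2) * (m + 2)"
proof -
  have "(\<Sum>i<m. if own i \<in> own ` {..<i} then 0 else (m + 2) * (100 * s ''class_count'' (own i) + 180)) =
      (\<Sum>u\<in>ends. (m + 2) * (100 * card (class_numbers s u) + 180))"
    using sum_first_occurrences[where g = "\<lambda>u. (m + 2) * (100 * s ''class_count'' u + 180)"]
    by (simp add: ends_def class_numbers_def)
  also have "\<dots> = (m + 2) * (100 * (\<Sum>u\<in>ends. card (class_numbers s u)) + 180 * card ends)"
    by (simp add: sum_distrib_left sum.distrib algebra_simps)
  also have "\<dots> \<le> (m + 2) * (100 * (3 * m) + 180 * m)"
  proof -
    have "card ends \<le> m" unfolding ends_def using card_image_le[of "{..<m}" own] by simp
    moreover have "(\<Sum>u\<in>ends. card (class_numbers s u)) \<le> 3 * m"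
      using sum_card_numbers_le card_keys_ends_le by (rule order_trans)
    ultimately show ?thesis by (intro mult_le_mono2 add_mono) simp_all
  qed
  finally show ?thesis by (simp add: sum.distrib algebra_simps)
qed

lemma runs_new_vertex:
  assumes con: "constructed \<sigma> (keys A) s1" and u: "u \<in> ends" "u \<notin> A" and su: "s1 ''u'' 0 = u"
  shows "runs (root_com Own Opp Up Self root_node;; classes_com Up Self) s1
    ((m + 2) * (100 * s ''class_count'' u + 180))
    (\<lambda>s2. constructed \<sigma> (keys (insert u A)) s2 \<and> s2 ''seen'' = s1 ''seen'')"
proof (rule runs_Seq[OF runs_root[OF con u(1) _ su]])
  show "u \<notin> owner ` keys A" using u(2) by (simp only: owner_keys not_False_eq_True)
  fix s2 assume root_added: "constructed \<sigma> (insert (Root u) (keys A)) s2 \<and> edge_index u s2"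
    and frame: "unchanged_except (written (root_com Own Opp Up Self root_node)) s1 s2"
  have "s2 ''u'' 0 = u" using frame su by simp
  with root_added u have "runs (classes_com Up Self) s2 (100 * (m + 2) * (s ''class_count'' u + 1))
      (constructed \<sigma> (keys (insert u A)))" by (intro runs_classes) simp_all
  then show "runs (classes_com Up Self) s2 (100 * (m + 2) * (s ''class_count'' u + 1))
      (\<lambda>s3. constructed \<sigma> (keys (insert u A)) s3 \<and> s3 ''seen'' = s1 ''seen'')"
    by (rule runs_frame) (use frame in simp)
qed (simp add: algebra_simps)

lemma runs_vertex:
  assumes con: "constructed \<sigma> (keys A) s1" and u: "own i \<in> ends" and si: "s1 ''i'' 0 = i"
    and seen: "s1 ''seen'' (own i) = of_bool (own i \<in> A)"
  shows "runs (vertex_com Own Opp Up Self root_node) s1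
    ((if own i \<in> A then 0 else (m + 2) * (100 * s ''class_count'' (own i) + 180)) + 20)
    (\<lambda>s2. constructed \<sigma> (keys (insert (own i) A)) s2 \<and> s2 ''seen'' = (s1 ''seen'')(own i := 1))"
    (is "runs _ _ (?cost + 20) ?Q")
  unfolding vertex_com_def
proof (rule runs_loop_free_Seq)
  let ?s2 = "effect (''u'' ::= Read Own (V ''i'')) s1" and ?new = "Equal (Read ''seen'' (V ''u'')) (Num 0)"
    and ?mark = "Write ''seen'' (V ''u'') (Num 1)"
    and ?insert = "root_com Own Opp Up Self root_node;; classes_com Up Self"
  have s2: "?s2 ''u'' 0 = own i" "bval ?new ?s2 \<longleftrightarrow> own i \<notin> A"
    using si seen same_inputs_facts[OF constructed_inputs[OF con]] by simp_all
  show "runs (Cond ?new (?mark;; ?insert) Skip) ?s2 (?cost + 15) ?Q"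
  proof (rule runs_Cond)
    assume "bval ?new ?s2"
    then have new: "own i \<notin> A" using s2(2) by simp
    have s3: "effect ?mark ?s2 ''u'' 0 = own i" "effect ?mark ?s2 ''seen'' = (s1 ''seen'')(own i := 1)"
      using s2(1) by simp_all
    have "constructed \<sigma> (keys A) (effect ?mark ?s2)"
      by (rule constructed_frame[OF con, where X = "{''u'', ''seen''}"]) (auto simp: input_arrays_def)
    from runs_new_vertex[OF this u new s3(1)]
    show "runs (?mark;; ?insert) ?s2 (?cost + 5) ?Q"
      unfolding s3(2) by (rule runs_loop_free_Seq[rotated]) (simp_all add: new)
  next
    assume "\<not> bval ?new ?s2"
    then have old: "own i \<in> A" using s2(2) by simp
    have "constructed \<sigma> (keys A) ?s2"
      by (rule constructed_frame[OF con, where X = "{''u''}"]) (auto simp: input_arrays_def)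
    then show "runs Skip ?s2 (?cost + 5) ?Q"
      using old seen by (intro runs_Skip) (simp_all add: insert_absorb fun_upd_idem)
  qed simp
qed simp_all

lemma runs_side:
  assumes inputs: "same_inputs s \<sigma>" and n: "\<sigma> ''n'' 0 = n0" and unseen: "\<And>u. u \<in> ends \<Longrightarrow> \<sigma> ''seen'' u = 0"
  shows "runs (side_com Own Opp Up Self root_node) \<sigma> (500 * (m + 2) * (m + 2))
    (\<lambda>s2. constructed \<sigma> (keys ends) s2 \<and> (\<forall>u. u \<notin> ends \<longrightarrow> s2 ''seen'' u = \<sigma> ''seen'' u))"
proof -
  let ?done = "\<lambda>i. own ` {..<i}"
  let ?cost = "\<lambda>i. if own i \<in> ?done i then 0 else (m + 2) * (100 * s ''class_count'' (own i) + 180)"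
  let ?I = "\<lambda>i s2. constructed \<sigma> (keys (?done i)) s2 \<and>
    (\<forall>u. s2 ''seen'' u = (if u \<in> ?done i then 1 else \<sigma> ''seen'' u))"
  show ?thesis
    unfolding side_com_def
  proof (rule runs_For[where n = m and I = ?I and k = "\<lambda>i. ?cost i + 20"])
    fix i s1 assume i: "i < m" and I: "?I i s1" and si: "s1 ''i'' 0 = i"
    have done_Suc: "?done (Suc i) = insert (own i) (?done i)" by (simp add: lessThan_Suc)
    have u: "own i \<in> ends" using i by (simp add: ends_def)
    have "s1 ''seen'' (own i) = of_bool (own i \<in> ?done i)" using I unseen[OF u] by simp
    from runs_vertex[OF conjunct1[OF I] u si this]
    show "runs (vertex_com Own Opp Up Self root_node) s1 (?cost i + 20) (?I (Suc i))"
      unfolding done_Suc by (rule runs_weaken) (use I in simp_all)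
  next
    fix s2 assume "unchanged_except (insert ''i'' (written (vertex_com Own Opp Up Self root_node))) \<sigma> s2"
    then show "aval (V ''edge_count'') s2 = m" using same_inputs_facts[OF inputs] by simp
  next
    fix i s2 v assume I: "?I i s2"
    then have "constructed \<sigma> (keys (?done i)) (s2(''i'' := v))"
      by (intro constructed_frame[OF conjunct1[OF I], where X = "{''i''}"]) (auto simp: input_arrays_def)
    then show "?I i (s2(''i'' := v))" using I by simp
  next
    show "(\<Sum>i<m. ?cost i + 20) + Suc m * (acost (V ''edge_count'') + 10) \<le> 500 * (m + 2) * (m + 2)"
      using sum_vertex_cost_le by simp
  qed (use constructed_empty[OF inputs n] in \<open>auto simp: ends_def\<close>)
qed

end

section \<open>Breadth-first search\<close>

definition search_tree ::
  "nat \<Rightarrow> nat \<Rightarrow> (nat \<Rightarrow> nat \<Rightarrow> nat \<Rightarrow> bool) \<Rightarrow> (nat \<Rightarrow> nat) \<Rightarrow> (nat \<Rightarrow> nat) \<Rightarrow> bool" where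
  "search_tree n source arc vis pred \<longleftrightarrow> vis source = 1 \<and>
     (\<forall>y<n. vis y \<noteq> 0 \<and> y \<noteq> source \<longrightarrow>
        (\<exists>x. arc (pred y) x y \<and> vis x \<noteq> 0 \<and> vis y = vis x + 1))"

definition search_completed ::
  "nat \<Rightarrow> nat \<Rightarrow> (nat \<Rightarrow> nat \<Rightarrow> nat \<Rightarrow> bool) \<Rightarrow> (nat \<Rightarrow> nat) \<Rightarrow> (nat \<Rightarrow> nat) \<Rightarrow> bool" where
  "search_completed n source arc vis pred \<longleftrightarrow> search_tree n source arc vis pred \<and> (\<forall>y<n. vis y \<le> n) \<and>
     (\<forall>j x y. arc j x y \<longrightarrow> vis x \<noteq> 0 \<longrightarrow> vis y \<noteq> 0)"

lemma search_tree_insert: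
  assumes tree: "search_tree n source arc vis pred" and x: "vis x \<noteq> 0" and arc: "arc j x y" and y: "vis y = 0"
  shows "search_tree n source arc (vis(y := vis x + 1)) (pred(y := j))"
  unfolding search_tree_def
proof (intro conjI allI impI)
  let ?vis = "vis(y := vis x + 1)" and ?pred = "pred(y := j)"
  show "?vis source = 1" using tree y by (auto simp: search_tree_def)
  fix z assume z: "z < n" "?vis z \<noteq> 0 \<and> z \<noteq> source"
  show "\<exists>w. arc (?pred z) w z \<and> ?vis w \<noteq> 0 \<and> ?vis z = ?vis w + 1"
  proof (cases "z = y")
    case True
    then show ?thesis using arc x y by (intro exI[of _ x]) auto
  next
    case False
    then obtain w where "arc (pred z) w z" "vis w \<noteq> 0" "vis z = vis w + 1"
      using tree z unfolding search_tree_def by auto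
    then show ?thesis using False y by (intro exI[of _ w]) auto
  qed
qed

text \<open>
  \<open>arc j x y\<close> means that the search may pass along link \<open>j\<close> from \<open>x\<close> to \<open>y\<close>; the links at \<open>x\<close> are
  stored in the cells of \<open>adj\<close> from \<open>start x\<close> to \<open>start (x + 1)\<close>.
\<close>

locale search_graph =
  fixes n source :: nat and arc :: "nat \<Rightarrow> nat \<Rightarrow> nat \<Rightarrow> bool" and start adj :: "nat \<Rightarrow> nat"
  assumes source: "source < n"
    and arc_ends: "arc j x y \<Longrightarrow> x < n \<and> y < n"
    and arc_unique: "arc j x y \<Longrightarrow> arc j x y' \<Longrightarrow> y = y'"
    and arc_listed: "arc j x y \<Longrightarrow> \<exists>q\<in>{start x..<start (Suc x)}. adj q = j"
    and start_mono: "x < n \<Longrightarrow> start x \<le> start (Suc x)"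
begin

definition bfs :: "nat \<Rightarrow> nat \<Rightarrow> nat \<Rightarrow> (nat \<Rightarrow> nat) \<Rightarrow> (nat \<Rightarrow> nat) \<Rightarrow> (nat \<Rightarrow> nat) \<Rightarrow> bool" where
  "bfs qh qt p queue vis pred \<longleftrightarrow>
     inj_on queue {..<qt} \<and> queue ` {..<qt} = {y. y < n \<and> vis y \<noteq> 0} \<and> qh \<le> qt \<and>
     (\<forall>y<n. vis y \<le> qt) \<and> search_tree n source arc vis pred \<and>
     (\<forall>i<qh. \<forall>j y. arc j (queue i) y \<longrightarrow> vis y \<noteq> 0) \<and>
     (qh < qt \<longrightarrow> start (queue qh) \<le> p \<and> p \<le> start (Suc (queue qh)) \<and>
        (\<forall>q y. start (queue qh) \<le> q \<and> q < p \<and> arc (adj q) (queue qh) y \<longrightarrow> vis y \<noteq> 0))"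

lemma bfs_queue_length:
  assumes "bfs qh qt p queue vis pred"
  shows "qt \<le> n"
proof -
  have "inj_on queue {..<qt}" using assms by (simp add: bfs_def)
  then have "card (queue ` {..<qt}) = qt" by (simp add: card_image)
  moreover have "queue ` {..<qt} \<subseteq> {..<n}" using assms by (auto simp: bfs_def)
  ultimately show ?thesis by (metis card_lessThan card_mono finite_lessThan)
qed

lemma bfs_queue: "bfs qh qt p queue vis pred \<Longrightarrow> i < qt \<Longrightarrow> queue i < n \<and> vis (queue i) \<noteq> 0"
  unfolding bfs_def by blast

lemma bfs_init:
  assumes "\<And>y. y < n \<Longrightarrow> vis y = of_bool (y = source)" "queue 0 = source"
  shows "bfs 0 1 (start source) queue vis pred"
  using assms source start_mono[of source]
  by (auto simp: bfs_def search_tree_def lessThan_Suc split: if_splits)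

lemma bfs_visit:
  assumes inv: "bfs qh qt p queue vis pred" and q: "qh < qt" "p < start (Suc (queue qh))"
    and arc: "arc (adj p) (queue qh) y" and y: "vis y = 0"
  shows "bfs qh (Suc qt) (Suc p) (queue(qt := y)) (vis(y := vis (queue qh) + 1)) (pred(y := adj p))"
proof -
  let ?x = "queue qh" and ?vis = "vis(y := vis (queue qh) + 1)" and ?queue = "queue(qt := y)"
  have x: "?x < n" "vis ?x \<noteq> 0" using bfs_queue[OF inv q(1)] by auto
  have image: "?queue ` {..<qt} = {z. z < n \<and> vis z \<noteq> 0}"
    using inv by (auto simp: bfs_def image_def)
  then have "?queue ` {..<Suc qt} = {z. z < n \<and> ?vis z \<noteq> 0}"
    using arc_ends[OF arc] by (auto simp: lessThan_Suc)
  moreover have "inj_on ?queue {..<qt}" using inv by (subst inj_on_cong[of _ _ queue]) (auto simp: bfs_def)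
  then have "inj_on ?queue {..<Suc qt}" using image y by (auto simp: lessThan_Suc)
  moreover have "\<forall>z<n. ?vis z \<le> Suc qt" using inv x by (auto simp: bfs_def intro: le_SucI)
  moreover have "search_tree n source arc ?vis (pred(y := adj p))"
    using inv x(2) arc y by (intro search_tree_insert) (auto simp: bfs_def)
  moreover have "\<forall>i<qh. \<forall>j z. arc j (?queue i) z \<longrightarrow> ?vis z \<noteq> 0"
    using inv q by (auto simp: bfs_def)
  moreover have "\<forall>k z. start ?x \<le> k \<and> k < Suc p \<and> arc (adj k) ?x z \<longrightarrow> ?vis z \<noteq> 0"
  proof (intro allI impI)
    fix k z assume k: "start ?x \<le> k \<and> k < Suc p \<and> arc (adj k) ?x z"
    show "?vis z \<noteq> 0"
    proof (cases "k = p")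
      case True
      then show ?thesis using arc_unique[OF arc] k by auto
    next
      case False
      then show ?thesis using inv q k unfolding bfs_def by (auto simp: less_Suc_eq)
    qed
  qed
  moreover have "start ?x \<le> p" "qh \<le> qt" "?queue qh = ?x" using inv q by (auto simp: bfs_def)
  ultimately show ?thesis using q unfolding bfs_def by (simp del: fun_upd_apply)
qed

lemma bfs_skip:
  assumes "bfs qh qt p queue vis pred" "qh < qt" "p < start (Suc (queue qh))"
    and "\<And>y. arc (adj p) (queue qh) y \<Longrightarrow> vis y \<noteq> 0"
  shows "bfs qh qt (Suc p) queue vis pred"
  using assms unfolding bfs_def by (auto simp: less_Suc_eq)

lemma bfs_row_end:
  "bfs qh qt p queue vis pred \<Longrightarrow> qh < qt \<Longrightarrow> \<not> p < start (Suc (queue qh)) \<Longrightarrow> p = start (Suc (queue qh))"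
  unfolding bfs_def by simp

lemma bfs_next:
  assumes inv: "bfs qh qt p queue vis pred" and q: "qh < qt" "\<not> p < start (Suc (queue qh))"
  shows "bfs (Suc qh) qt (start (queue (Suc qh))) queue vis pred"
proof -
  have "vis y \<noteq> 0" if arc: "arc j (queue qh) y" for j y
  proof -
    obtain k where "start (queue qh) \<le> k" "k < p" "adj k = j"
      using arc_listed[OF arc] bfs_row_end[OF inv q] by auto
    then show ?thesis using inv q(1) arc unfolding bfs_def by blast
  qed
  then have "\<forall>i<Suc qh. \<forall>j y. arc j (queue i) y \<longrightarrow> vis y \<noteq> 0"
    using inv by (auto simp: bfs_def less_Suc_eq)
  moreover have "start (queue (Suc qh)) \<le> start (Suc (queue (Suc qh)))" if "Suc qh < qt"
    using bfs_queue[OF inv that] start_mono by simp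
  ultimately show ?thesis using inv q(1) unfolding bfs_def by auto
qed

lemma bfs_completed:
  assumes inv: "bfs qh qt p queue vis pred" and q: "\<not> qh < qt"
  shows "search_completed n source arc vis pred"
proof -
  have "vis y \<noteq> 0" if arc: "arc j x y" and x: "vis x \<noteq> 0" for j x y
  proof -
    have "x \<in> queue ` {..<qt}" using inv x arc_ends[OF arc] by (auto simp: bfs_def)
    moreover have "qh = qt" using inv q by (auto simp: bfs_def)
    ultimately obtain i where "i < qh" "x = queue i" by auto
    then show ?thesis using inv arc unfolding bfs_def by blast
  qed
  moreover have "\<forall>y<n. vis y \<le> n" using inv bfs_queue_length[OF inv] by (auto simp: bfs_def intro: order_trans)
  ultimately show ?thesis using inv by (auto simp: search_completed_def bfs_def)
qed

definition scanned :: "nat \<Rightarrow> nat \<Rightarrow> nat \<Rightarrow> (nat \<Rightarrow> nat) \<Rightarrow> nat" where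
  "scanned qh qt p queue =
     (\<Sum>i<qh. start (Suc (queue i)) - start (queue i)) + (if qh < qt then p - start (queue qh) else 0)"

definition work_left :: "nat \<Rightarrow> nat \<Rightarrow> nat \<Rightarrow> (nat \<Rightarrow> nat) \<Rightarrow> nat" where
  "work_left qh qt p queue = (n - qh) + (start n - scanned qh qt p queue)"

lemma sum_row_lengths_le: "k \<le> n \<Longrightarrow> (\<Sum>x<k. start (Suc x) - start x) \<le> start k"
proof (induction k)
  case (Suc k)
  then show ?case using start_mono[of k] by simp
qed simp

lemma scanned_less:
  assumes inv: "bfs qh qt p queue vis pred" and q: "qh < qt" "p < start (Suc (queue qh))"
  shows "scanned qh qt p queue < start n"
proof -
  have "scanned qh qt p queue < (\<Sum>i<Suc qh. start (Suc (queue i)) - start (queue i))"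
    using inv q by (auto simp: scanned_def bfs_def)
  also have "\<dots> = (\<Sum>x\<in>queue ` {..<Suc qh}. start (Suc x) - start x)"
    using inv q by (subst sum.reindex) (auto simp: bfs_def intro: inj_on_subset)
  also have "\<dots> \<le> (\<Sum>x<n. start (Suc x) - start x)"
    using bfs_queue[OF inv] q by (intro sum_mono2) auto
  also have "\<dots> \<le> start n" by (rule sum_row_lengths_le) simp
  finally show ?thesis .
qed

lemma work_left_advance:
  assumes inv: "bfs qh qt p queue vis pred" and q: "qh < qt" "p < start (Suc (queue qh))"
    and "qh < qt'" "\<And>i. i \<le> qh \<Longrightarrow> queue' i = queue i"
  shows "work_left qh qt' (Suc p) queue' < work_left qh qt p queue"
proof -
  have "start (queue qh) \<le> p" using inv q(1) by (simp add: bfs_def)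
  then have "scanned qh qt' (Suc p) queue' = Suc (scanned qh qt p queue)"
    using assms(4,5) q(1) by (simp add: scanned_def)
  then show ?thesis using scanned_less[OF inv q] by (simp add: work_left_def)
qed

lemma work_left_next:
  assumes inv: "bfs qh qt p queue vis pred" and q: "qh < qt" "\<not> p < start (Suc (queue qh))"
  shows "work_left (Suc qh) qt (start (queue (Suc qh))) queue < work_left qh qt p queue"
proof -
  have "scanned (Suc qh) qt (start (queue (Suc qh))) queue = scanned qh qt p queue"
    using bfs_row_end[OF inv q] q(1) by (simp add: scanned_def)
  moreover have "qh < n" using bfs_queue_length[OF inv] q(1) by simp
  ultimately show ?thesis by (simp add: work_left_def)
qed

lemma work_left_le: "work_left qh qt p queue \<le> n + start n"
  by (simp add: work_left_def)

end

section \<open>Incidence lists\<close>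

definition row_com :: com where
  "row_com =
     For ''j'' (V ''n'')
       (Cond (And (Neg (Equal (Read ''tail'' (V ''j'')) (V ''x''))) (Neg (Equal (Read ''head'' (V ''j'')) (V ''x''))))
         Skip (Write ''adj'' (V ''p'') (V ''j'');; ''p'' ::= Add (V ''p'') (Num 1)))"

definition rows_com :: com where
  "rows_com = For ''x'' (V ''n'') (Write ''start'' (V ''x'') (V ''p'');; row_com)"

definition adj_com :: com where
  "adj_com = (''p'' ::= Num 0;; rows_com;; Write ''start'' (V ''n'') (V ''p''))"

lemma written_row [simp]: "written row_com = {''p'', ''j'', ''adj''}"
  by (auto simp: row_com_def)
lemma written_rows [simp]: "written rows_com = {''p'', ''x'', ''start'', ''j'', ''adj''}"
  by (auto simp: rows_com_def)
lemma written_adj [simp]: "written adj_com = {''p'', ''x'', ''start'', ''j'', ''adj''}"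
  by (auto simp: adj_com_def)

lemma map_fun_upd_upt: "map (f(n := a)) [0..<Suc n] = map f [0..<n] @ [a]"
  by simp

context network
begin

definition incident :: "nat \<Rightarrow> nat \<Rightarrow> bool" where
  "incident j x \<longleftrightarrow> tail j = x \<or> head j = x"

definition row :: "nat \<Rightarrow> nat \<Rightarrow> nat list" where
  "row x k = filter (\<lambda>j. incident j x) [0..<k]"

definition rows :: "nat \<Rightarrow> nat list" where
  "rows x = concat (map (\<lambda>y. row y n2) [0..<x])"

definition incidence_lists :: "(nat \<Rightarrow> nat) \<Rightarrow> (nat \<Rightarrow> nat) \<Rightarrow> bool" where
  "incidence_lists start adj \<longleftrightarrow>
     (\<forall>y\<le>n2. start y = length (rows y)) \<and> map adj [0..<length (rows n2)] = rows n2"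

lemma row_0 [simp]: "row x 0 = []"
  and row_Suc: "row x (Suc k) = row x k @ (if incident k x then [k] else [])"
  by (simp_all add: row_def)

lemma rows_0 [simp]: "rows 0 = []"
  and rows_Suc: "rows (Suc x) = rows x @ row x n2"
  by (simp_all add: rows_def)

lemma length_row: "length (row x k) = (\<Sum>j<k. of_bool (incident j x))"
  by (induction k) (simp_all add: row_Suc)

lemma length_rows_le: "length (rows n2) \<le> 2 * n2"
proof -
  have "length (rows k) = (\<Sum>x<k. length (row x n2))" for k
    by (induction k) (simp_all add: rows_Suc)
  then have "length (rows n2) = (\<Sum>x<n2. \<Sum>j<n2. of_bool (incident j x))" by (simp only: length_row)
  also have "\<dots> = (\<Sum>j<n2. \<Sum>x<n2. of_bool (incident j x))" by (rule sum.swap)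
  also have "\<dots> \<le> (\<Sum>j<n2. 2)"
  proof (rule sum_mono)
    fix j
    have "(\<Sum>x<n2. of_bool (incident j x)) = card ({..<n2} \<inter> {x. incident j x})" by simp
    also have "\<dots> \<le> card {tail j, head j}" by (rule card_mono) (auto simp: incident_def)
    also have "\<dots> \<le> 2" by (simp add: card_insert_if)
    finally show "(\<Sum>x<n2. of_bool (incident j x)) \<le> (2 :: nat)" .
  qed
  finally show ?thesis by simp
qed

lemma rows_split: "x < y \<Longrightarrow> \<exists>zs. rows y = rows x @ row x n2 @ zs"
proof (induction y)
  case (Suc y)
  then show ?case
  proof (cases "x = y")
    case True
    then show ?thesis by (simp add: rows_Suc)
  next
    case False
    then obtain zs where "rows y = rows x @ row x n2 @ zs" using Suc by force
    then show ?thesis by (simp add: rows_Suc)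
  qed
qed simp

lemma incidence_lists_mono: "incidence_lists start adj \<Longrightarrow> x < n2 \<Longrightarrow> start x \<le> start (Suc x)"
  by (simp add: incidence_lists_def rows_Suc)

lemma incidence_lists_adj_less:
  assumes lists: "incidence_lists start adj" and q: "q < start (Suc x)" "x < n2"
  shows "adj q < n2"
proof -
  obtain zs where "rows n2 = rows (Suc x) @ zs" using rows_split[OF q(2)] by (auto simp: rows_Suc)
  then have "q < length (rows n2)" using q lists by (simp add: incidence_lists_def)
  moreover have "map adj [0..<length (rows n2)] = rows n2" using lists by (simp add: incidence_lists_def)
  ultimately have "adj q \<in> set (rows n2)"
    by (metis add_0 length_map length_upt minus_nat.diff_0 nth_map nth_mem nth_upt)
  then show ?thesis by (auto simp: rows_def row_def)
qed

lemma incidence_lists_listed: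
  assumes lists: "incidence_lists start adj" and x: "x < n2" and j: "j < n2" "incident j x"
  shows "\<exists>q\<in>{start x..<start (Suc x)}. adj q = j"
proof -
  obtain zs where zs: "rows n2 = rows x @ row x n2 @ zs" using rows_split[OF x] by blast
  have start: "start x = length (rows x)" "start (Suc x) = length (rows x) + length (row x n2)"
    using lists x by (simp_all add: incidence_lists_def rows_Suc)
  have "j \<in> set (row x n2)" using j by (simp add: row_def)
  then obtain i where i: "i < length (row x n2)" "row x n2 ! i = j" by (auto simp: in_set_conv_nth)
  have "map adj [0..<length (rows n2)] ! (length (rows x) + i) = rows n2 ! (length (rows x) + i)"
    using lists by (simp add: incidence_lists_def)
  then have "adj (length (rows x) + i) = j" using i by (simp add: zs nth_append)
  then show ?thesis using i(1) by (intro bexI[of _ "length (rows x) + i"]) (simp_all add: start)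
qed

lemma runs_row:
  assumes s: "s ''tail'' = tail" "s ''head'' = head" "s ''n'' 0 = n2" "s ''x'' 0 = x"
    and p: "s ''p'' 0 = length xs" "map (s ''adj'') [0..<length xs] = xs"
  shows "runs row_com s (50 * (n2 + 1)) (\<lambda>s'. s' ''p'' 0 = length (xs @ row x n2) \<and>
    map (s' ''adj'') [0..<length (xs @ row x n2)] = xs @ row x n2)"
proof -
  let ?test = "And (Neg (Equal (Read ''tail'' (V ''j'')) (V ''x''))) (Neg (Equal (Read ''head'' (V ''j'')) (V ''x'')))"
    and ?append = "Write ''adj'' (V ''p'') (V ''j'');; ''p'' ::= Add (V ''p'') (Num 1)"
  let ?body = "Cond ?test Skip ?append"
  let ?I = "\<lambda>k s'. s' ''p'' 0 = length (xs @ row x k) \<and>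
    map (s' ''adj'') [0..<length (xs @ row x k)] = xs @ row x k"
  show ?thesis
    unfolding row_com_def
  proof (rule runs_For[where n = n2 and I = ?I and k = "\<lambda>_. 30"])
    fix k s' assume I: "?I k s'" and j: "s' ''j'' 0 = k"
      and frame: "unchanged_except (insert ''j'' (written ?body)) s s'"
    have test: "bval ?test s' \<longleftrightarrow> \<not> incident k x"
      using frame s j by (simp add: incident_def)
    show "runs ?body s' 30 (?I (Suc k))"
    proof (rule runs_Cond[where k = 12])
      assume "bval ?test s'"
      then show "runs Skip s' 12 (?I (Suc k))" using I test by (intro runs_Skip) (simp_all add: row_Suc)
    next
      assume "\<not> bval ?test s'"
      then have "incident k x" using test by blast
      then have "row x (Suc k) = row x k @ [k]" by (simp add: row_Suc)
      moreover have "map ((s' ''adj'')(length (xs @ row x k) := k)) [0..<Suc (length (xs @ row x k))] =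
          xs @ row x k @ [k]"
        unfolding map_fun_upd_upt using I by simp
      ultimately show "runs ?append s' 12 (?I (Suc k))"
        using I j by (intro runs_loop_free) simp_all
    qed simp
  next
    fix s' assume "unchanged_except (insert ''j'' (written ?body)) s s'"
    then show "aval (V ''n'') s' = n2" using s by simp
  qed (use p in simp_all)
qed

lemma runs_rows:
  assumes s: "s ''tail'' = tail" "s ''head'' = head" "s ''n'' 0 = n2" "s ''p'' 0 = 0"
  shows "runs rows_com s (n2 * (50 * (n2 + 1) + 5) + (n2 + 1) * 12)
    (\<lambda>s'. (\<forall>y<n2. s' ''start'' y = length (rows y)) \<and> s' ''p'' 0 = length (rows n2) \<and>
       map (s' ''adj'') [0..<length (rows n2)] = rows n2)"
proof -
  let ?body = "Write ''start'' (V ''x'') (V ''p'');; row_com"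
  let ?I = "\<lambda>x s'. (\<forall>y<x. s' ''start'' y = length (rows y)) \<and> s' ''p'' 0 = length (rows x) \<and>
    map (s' ''adj'') [0..<length (rows x)] = rows x"
  show ?thesis
    unfolding rows_com_def
  proof (rule runs_For[where n = n2 and I = ?I and k = "\<lambda>_. 50 * (n2 + 1) + 5"])
    fix x s' assume I: "?I x s'" and x: "s' ''x'' 0 = x"
      and frame: "unchanged_except (insert ''x'' (written ?body)) s s'"
    let ?s1 = "effect (Write ''start'' (V ''x'') (V ''p'')) s'"
    have s1: "?s1 ''tail'' = tail" "?s1 ''head'' = head" "?s1 ''n'' 0 = n2" "?s1 ''x'' 0 = x"
      "?s1 ''p'' 0 = length (rows x)" "map (?s1 ''adj'') [0..<length (rows x)] = rows x"
      "\<forall>y<Suc x. ?s1 ''start'' y = length (rows y)"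
      using frame s x I by (simp_all add: less_Suc_eq)
    have "runs row_com ?s1 (50 * (n2 + 1)) (?I (Suc x))"
    proof (rule runs_frame[OF runs_row[OF s1(1-6)]])
      fix s2 assume row: "s2 ''p'' 0 = length (rows x @ row x n2) \<and>
          map (s2 ''adj'') [0..<length (rows x @ row x n2)] = rows x @ row x n2"
        and "unchanged_except (written row_com) ?s1 s2"
      then have start: "s2 ''start'' = ?s1 ''start''" by simp
      show "?I (Suc x) s2" unfolding start rows_Suc using s1(7) row by blast
    qed
    then show "runs ?body s' (50 * (n2 + 1) + 5) (?I (Suc x))"
      by (rule runs_loop_free_Seq[rotated]) simp_all
  next
    fix s' assume "unchanged_except (insert ''x'' (written ?body)) s s'"
    then show "aval (V ''n'') s' = n2" using s by simp
  qed (use s(4) in simp_all)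
qed

lemma runs_adj:
  assumes s: "s ''tail'' = tail" "s ''head'' = head" "s ''n'' 0 = n2"
  shows "runs adj_com s (70 * (n2 + 1) * (n2 + 1)) (\<lambda>s'. incidence_lists (s' ''start'') (s' ''adj''))"
  unfolding adj_com_def
proof (rule runs_loop_free_Seq)
  let ?s1 = "effect (''p'' ::= Num 0) s"
  have s1: "?s1 ''tail'' = tail" "?s1 ''head'' = head" "?s1 ''n'' 0 = n2" "?s1 ''p'' 0 = 0" using s by simp_all
  show "runs (rows_com;; Write ''start'' (V ''n'') (V ''p'')) ?s1
      (n2 * (50 * (n2 + 1) + 5) + (n2 + 1) * 12 + 5) (\<lambda>s'. incidence_lists (s' ''start'') (s' ''adj''))"
  proof (rule runs_Seq[OF runs_rows[OF s1]])
    fix s' assume rows: "(\<forall>y<n2. s' ''start'' y = length (rows y)) \<and> s' ''p'' 0 = length (rows n2) \<and>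
        map (s' ''adj'') [0..<length (rows n2)] = rows n2" and "unchanged_except (written rows_com) ?s1 s'"
    then have "s' ''n'' 0 = n2" using s by simp
    moreover have "incidence_lists ((s' ''start'')(n2 := length (rows n2))) (s' ''adj'')"
      using rows by (auto simp: incidence_lists_def le_less)
    ultimately show "runs (Write ''start'' (V ''n'') (V ''p'')) s' 5 (\<lambda>s'. incidence_lists (s' ''start'') (s' ''adj''))"
      using rows by (intro runs_Write) simp_all
  qed simp
qed (use n1 n2 in \<open>simp_all add: algebra_simps\<close>)

end

section \<open>Searching the residual network\<close>

definition visit_com :: "aexp \<Rightarrow> com" where
  "visit_com a =
     (''y'' ::= a;; Write ''vis'' (V ''y'') (Add (Read ''vis'' (V ''x'')) (Num 1));;
      Write ''pred'' (V ''y'') (V ''j'');; Write ''queue'' (V ''qt'') (V ''y'');; ''qt'' ::= Add (V ''qt'') (Num 1))"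

definition forward_test :: bexp where
  "forward_test =
     And (Equal (Read ''tail'' (V ''j'')) (V ''x'')) (And (Less (Read ''flow'' (V ''j'')) (Read ''cap'' (V ''j'')))
       (And (Equal (Read ''frozen'' (V ''j'')) (Num 0)) (Equal (Read ''vis'' (Read ''head'' (V ''j''))) (Num 0))))"

definition backward_test :: bexp where
  "backward_test =
     And (Equal (Read ''head'' (V ''j'')) (V ''x'')) (And (Less (Num 0) (Read ''flow'' (V ''j'')))
       (And (Equal (Read ''frozen'' (V ''j'')) (Num 0)) (Equal (Read ''vis'' (Read ''tail'' (V ''j''))) (Num 0))))"

definition fetch_link_com :: com where
  "fetch_link_com = (''j'' ::= Read ''adj'' (V ''p'');; ''p'' ::= Add (V ''p'') (Num 1))"

definition follow_link_com :: com where
  "follow_link_com =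
     Cond forward_test (visit_com (Read ''head'' (V ''j'')))
       (Cond backward_test (visit_com (Read ''tail'' (V ''j''))) Skip)"

definition scan_com :: com where
  "scan_com =
     (''x'' ::= Read ''queue'' (V ''qh'');;
      Cond (Less (V ''p'') (Read ''start'' (Add (V ''x'') (Num 1))))
        (fetch_link_com;; follow_link_com)
        (''qh'' ::= Add (V ''qh'') (Num 1);; ''p'' ::= Read ''start'' (Read ''queue'' (V ''qh''))))"

definition clear_com :: com where
  "clear_com = For ''x'' (V ''n'') (Write ''vis'' (V ''x'') (Num 0))"

definition enqueue_source_com :: com where
  "enqueue_source_com =
     (Write ''vis'' (V ''edge_count'') (Num 1);; ''qh'' ::= Num 0;; ''qt'' ::= Num 1;;
      Write ''queue'' (Num 0) (V ''edge_count'');; ''p'' ::= Read ''start'' (V ''edge_count''))"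

definition search_com :: com where
  "search_com = (clear_com;; enqueue_source_com;; While (Less (V ''qh'') (V ''qt'')) scan_com)"

lemma written_scan [simp]:
  "written scan_com = {''x'', ''j'', ''p'', ''qh'', ''y'', ''vis'', ''pred'', ''queue'', ''qt''}"
  by (auto simp: scan_com_def fetch_link_com_def follow_link_com_def visit_com_def)
lemma written_clear [simp]: "written clear_com = {''x'', ''vis''}"
  by (simp add: clear_com_def)
lemma written_search [simp]:
  "written search_com = {''x'', ''j'', ''p'', ''qh'', ''y'', ''vis'', ''pred'', ''queue'', ''qt''}"
  by (auto simp: search_com_def enqueue_source_com_def)

lemma loop_free_scan: "loop_free scan_com"
  and max_cost_scan: "max_cost scan_com \<le> 250"
  by (simp_all add: scan_com_def fetch_link_com_def follow_link_com_def visit_com_def forward_test_def backward_test_def)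

context network
begin

definition network_stored :: "state \<Rightarrow> bool" where
  "network_stored s \<longleftrightarrow> s ''tail'' = tail \<and> s ''head'' = head \<and> s ''n'' 0 = n2 \<and> s ''edge_count'' 0 = m \<and>
     incidence_lists (s ''start'') (s ''adj'')"

lemma network_stored_frame:
  assumes "network_stored s" "unchanged_except X s s'"
    and "X \<inter> {''tail'', ''head'', ''n'', ''edge_count'', ''start'', ''adj''} = {}"
  shows "network_stored s'"
proof -
  have "s' x = s x" if "x \<in> {''tail'', ''head'', ''n'', ''edge_count'', ''start'', ''adj''}" for x
    using assms(2,3) that by blast
  then show ?thesis using assms(1) by (simp add: network_stored_def)
qed

text \<open>Cells \<open>m\<close> and \<open>m + 1\<close> of the link arrays belong to no link.\<close>

definition links_only :: "(nat \<Rightarrow> nat) \<Rightarrow> (nat \<Rightarrow> nat) \<Rightarrow> bool" where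
  "links_only f cap \<longleftrightarrow> (\<forall>j<n2. j \<notin> links \<longrightarrow> f j = 0 \<and> cap j = 0)"

lemma residual_ends: "residual f cap frozen j x y \<Longrightarrow> x < n2 \<and> y < n2 \<and> j < n2 \<and> incident j x \<and> j \<in> links"
  using link_ends[of j] by (auto simp: residual_def incident_def)

lemma residual_unique: "residual f cap frozen j x y \<Longrightarrow> residual f cap frozen j x y' \<Longrightarrow> y = y'"
  using link_ends(3)[of j] by (auto simp: residual_def)

lemma source_sink_less: "m + 1 < n2"
  using n1 n2 by simp

lemma search_graph_residual:
  assumes "incidence_lists start adj"
  shows "search_graph n2 m (residual f cap frozen) start adj"
proof
  show "m < n2" using source_sink_less by simp
  show "\<exists>q\<in>{start x..<start (Suc x)}. adj q = j" if "residual f cap frozen j x y" for j x y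
    using incidence_lists_listed[OF assms] residual_ends[OF that] by blast
qed (use residual_ends residual_unique incidence_lists_mono[OF assms] in blast)+

abbreviation residual_of :: "state \<Rightarrow> nat \<Rightarrow> nat \<Rightarrow> nat \<Rightarrow> bool" where
  "residual_of s \<equiv> residual (s ''flow'') (s ''cap'') (s ''frozen'')"

definition searching :: "state \<Rightarrow> bool" where
  "searching s \<longleftrightarrow> search_graph.bfs n2 m (residual_of s) (s ''start'') (s ''adj'')
     (s ''qh'' 0) (s ''qt'' 0) (s ''p'' 0) (s ''queue'') (s ''vis'') (s ''pred'')"

definition search_work :: "state \<Rightarrow> nat" where
  "search_work s = search_graph.work_left n2 (s ''start'') (s ''qh'' 0) (s ''qt'' 0) (s ''p'' 0) (s ''queue'')"

lemma scan_next:
  assumes net: "network_stored s" and inv: "searching s" and q: "s ''qh'' 0 < s ''qt'' 0"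
    and p: "\<not> s ''p'' 0 < s ''start'' (Suc (s ''queue'' (s ''qh'' 0)))"
  shows "searching (effect scan_com s) \<and> search_work (effect scan_com s) < search_work s"
proof -
  interpret search_graph n2 m "residual_of s" "s ''start''" "s ''adj''"
    using net by (intro search_graph_residual) (simp add: network_stored_def)
  let ?s = "effect scan_com s"
  have eff: "?s ''qh'' 0 = Suc (s ''qh'' 0)" "?s ''qt'' = s ''qt''"
    "?s ''p'' 0 = s ''start'' (s ''queue'' (Suc (s ''qh'' 0)))" "?s ''queue'' = s ''queue''"
    "?s ''vis'' = s ''vis''" "?s ''pred'' = s ''pred''" "?s ''flow'' = s ''flow''" "?s ''cap'' = s ''cap''"
    "?s ''frozen'' = s ''frozen''" "?s ''start'' = s ''start''" "?s ''adj'' = s ''adj''"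
    using p by (simp_all add: scan_com_def)
  show ?thesis
    using bfs_next[OF inv[unfolded searching_def] q p] work_left_next[OF inv[unfolded searching_def] q p]
    unfolding searching_def search_work_def eff by blast
qed

lemma scan_link_visit:
  assumes net: "network_stored s" and inv: "searching s" and q: "s ''qh'' 0 < s ''qt'' 0"
    and p: "s ''p'' 0 < s ''start'' (Suc (s ''queue'' (s ''qh'' 0)))"
    and arc: "residual_of s (s ''adj'' (s ''p'' 0)) (s ''queue'' (s ''qh'' 0)) y" and y: "s ''vis'' y = 0"
    and eff: "s' ''qh'' 0 = s ''qh'' 0" "s' ''qt'' 0 = Suc (s ''qt'' 0)" "s' ''p'' 0 = Suc (s ''p'' 0)"
      "s' ''queue'' = (s ''queue'')(s ''qt'' 0 := y)"
      "s' ''vis'' = (s ''vis'')(y := s ''vis'' (s ''queue'' (s ''qh'' 0)) + 1)"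
      "s' ''pred'' = (s ''pred'')(y := s ''adj'' (s ''p'' 0))"
    and frame: "s' ''flow'' = s ''flow''" "s' ''cap'' = s ''cap''" "s' ''frozen'' = s ''frozen''"
      "s' ''start'' = s ''start''" "s' ''adj'' = s ''adj''"
  shows "searching s' \<and> search_work s' < search_work s"
proof -
  interpret search_graph n2 m "residual_of s" "s ''start''" "s ''adj''"
    using net by (intro search_graph_residual) (simp add: network_stored_def)
  note inv = inv[unfolded searching_def]
  have "work_left (s ''qh'' 0) (Suc (s ''qt'' 0)) (Suc (s ''p'' 0)) ((s ''queue'')(s ''qt'' 0 := y)) <
      work_left (s ''qh'' 0) (s ''qt'' 0) (s ''p'' 0) (s ''queue'')"
    by (rule work_left_advance[OF inv q p]) (use q in auto)
  then show ?thesis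
    using bfs_visit[OF inv q p arc y] unfolding searching_def search_work_def eff frame by blast
qed

lemma scan_link_skip:
  assumes net: "network_stored s" and inv: "searching s" and q: "s ''qh'' 0 < s ''qt'' 0"
    and p: "s ''p'' 0 < s ''start'' (Suc (s ''queue'' (s ''qh'' 0)))"
    and arc: "\<And>y. residual_of s (s ''adj'' (s ''p'' 0)) (s ''queue'' (s ''qh'' 0)) y \<Longrightarrow> s ''vis'' y \<noteq> 0"
    and eff: "s' ''qh'' 0 = s ''qh'' 0" "s' ''qt'' = s ''qt''" "s' ''p'' 0 = Suc (s ''p'' 0)"
      "s' ''queue'' = s ''queue''" "s' ''vis'' = s ''vis''" "s' ''pred'' = s ''pred''"
    and frame: "s' ''flow'' = s ''flow''" "s' ''cap'' = s ''cap''" "s' ''frozen'' = s ''frozen''"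
      "s' ''start'' = s ''start''" "s' ''adj'' = s ''adj''"
  shows "searching s' \<and> search_work s' < search_work s"
proof -
  interpret search_graph n2 m "residual_of s" "s ''start''" "s ''adj''"
    using net by (intro search_graph_residual) (simp add: network_stored_def)
  note inv = inv[unfolded searching_def]
  have "work_left (s ''qh'' 0) (s ''qt'' 0) (Suc (s ''p'' 0)) (s ''queue'') <
      work_left (s ''qh'' 0) (s ''qt'' 0) (s ''p'' 0) (s ''queue'')"
    by (rule work_left_advance[OF inv q p q refl])
  then show ?thesis
    using bfs_skip[OF inv q p arc] unfolding searching_def search_work_def eff frame by blast
qed

definition link_fetched :: "state \<Rightarrow> state" where
  "link_fetched s = effect fetch_link_com (effect (''x'' ::= Read ''queue'' (V ''qh'')) s)"

lemma link_fetched_values: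
  "link_fetched s ''x'' 0 = s ''queue'' (s ''qh'' 0)" "link_fetched s ''j'' 0 = s ''adj'' (s ''p'' 0)"
  "link_fetched s ''p'' 0 = Suc (s ''p'' 0)" "y \<notin> {''x'', ''j'', ''p''} \<Longrightarrow> link_fetched s y = s y"
  by (simp_all add: link_fetched_def fetch_link_com_def)

lemma link_fetched_tests:
  fixes s :: state
  defines "x \<equiv> s ''queue'' (s ''qh'' 0)" and "j \<equiv> s ''adj'' (s ''p'' 0)"
  assumes "network_stored s"
  shows "bval forward_test (link_fetched s) \<longleftrightarrow>
      tail j = x \<and> s ''flow'' j < s ''cap'' j \<and> s ''frozen'' j = 0 \<and> s ''vis'' (head j) = 0"
    and "bval backward_test (link_fetched s) \<longleftrightarrow>
      head j = x \<and> 0 < s ''flow'' j \<and> s ''frozen'' j = 0 \<and> s ''vis'' (tail j) = 0"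
  using assms(3) by (simp_all add: x_def j_def network_stored_def forward_test_def backward_test_def link_fetched_values)

lemma scan_link:
  assumes net: "network_stored s" and only: "links_only (s ''flow'') (s ''cap'')"
    and inv: "searching s" and q: "s ''qh'' 0 < s ''qt'' 0"
    and p: "s ''p'' 0 < s ''start'' (Suc (s ''queue'' (s ''qh'' 0)))"
  shows "searching (effect scan_com s) \<and> search_work (effect scan_com s) < search_work s"
proof -
  let ?x = "s ''queue'' (s ''qh'' 0)" and ?j = "s ''adj'' (s ''p'' 0)" and ?s1 = "link_fetched s"
  interpret search_graph n2 m "residual_of s" "s ''start''" "s ''adj''"
    using net by (intro search_graph_residual) (simp add: network_stored_def)
  have "?x < n2" using inv q unfolding searching_def by (simp add: bfs_queue)
  then have "?j < n2" using net p by (intro incidence_lists_adj_less) (auto simp: network_stored_def)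
  then have j: "?j \<in> links" if "s ''flow'' ?j < s ''cap'' ?j \<or> 0 < s ''flow'' ?j"
    using only that unfolding links_only_def by fastforce
  have arrays: "s ''tail'' = tail" "s ''head'' = head" using net by (simp_all add: network_stored_def)
  note tests = link_fetched_tests[OF net]
  have scan: "effect scan_com s = effect follow_link_com ?s1" using p by (simp add: scan_com_def link_fetched_def)
  consider (forward) "bval forward_test ?s1" | (backward) "\<not> bval forward_test ?s1" "bval backward_test ?s1"
    | (none) "\<not> bval forward_test ?s1" "\<not> bval backward_test ?s1" by blast
  then show ?thesis
  proof cases
    case forward
    then have "effect scan_com s = effect (visit_com (Read ''head'' (V ''j''))) ?s1"
      unfolding scan follow_link_com_def by simp
    then show ?thesis using forward j arrays
      by (intro scan_link_visit[OF net inv q p, of "head ?j"])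
        (simp_all add: tests residual_def visit_com_def link_fetched_values)
  next
    case backward
    then have "effect scan_com s = effect (visit_com (Read ''tail'' (V ''j''))) ?s1"
      unfolding scan follow_link_com_def by simp
    then show ?thesis using backward(2) j arrays
      by (intro scan_link_visit[OF net inv q p, of "tail ?j"])
        (simp_all add: tests residual_def visit_com_def link_fetched_values)
  next
    case none
    then have "effect scan_com s = ?s1" unfolding scan follow_link_com_def by simp
    moreover have "s ''vis'' y \<noteq> 0" if "residual_of s ?j ?x y" for y
      using that none by (auto simp: tests residual_def)
    ultimately show ?thesis
      by (intro scan_link_skip[OF net inv q p]) (simp_all add: link_fetched_values)
  qed
qed

lemma runs_clear:
  assumes "s ''n'' 0 = n2"
  shows "runs clear_com s (20 * (n2 + 1)) (\<lambda>s'. \<forall>y<n2. s' ''vis'' y = 0)"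
  unfolding clear_com_def
proof (rule runs_For[where n = n2 and I = "\<lambda>i s'. \<forall>y<i. s' ''vis'' y = 0" and k = "\<lambda>_. 4"])
  show "runs (Write ''vis'' (V ''x'') (Num 0)) s' 4 (\<lambda>s'. \<forall>y<Suc i. s' ''vis'' y = 0)"
    if "\<forall>y<i. s' ''vis'' y = 0" "s' ''x'' 0 = i" for i s'
    using that by (intro runs_Write) (auto simp: less_Suc_eq)
qed (use assms in simp_all)

lemma runs_search_loop:
  assumes net: "network_stored s" and only: "links_only (s ''flow'') (s ''cap'')" and inv: "searching s"
  shows "runs (While (Less (V ''qh'') (V ''qt'')) scan_com) s (772 * n2 + 10)
    (\<lambda>s'. search_completed n2 m (residual_of s) (s' ''vis'') (s' ''pred''))"
proof (rule runs_While[where J = searching and \<mu> = search_work and k = 250])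
  fix s' assume inv: "searching s'" and b: "bval (Less (V ''qh'') (V ''qt'')) s'"
    and "unchanged_except (written scan_com) s s'"
  then have "network_stored s'" "links_only (s' ''flow'') (s' ''cap'')"
    using network_stored_frame[OF net, of "written scan_com" s'] only by simp_all
  then have "searching (effect scan_com s') \<and> search_work (effect scan_com s') < search_work s'"
    using scan_next[OF _ inv] scan_link[OF _ _ inv] b by auto
  then show "runs scan_com s' 250 (\<lambda>s''. searching s'' \<and> search_work s'' < search_work s')"
    by (intro runs_loop_free loop_free_scan max_cost_scan)
next
  interpret search_graph n2 m "residual_of s" "s ''start''" "s ''adj''"
    using net by (intro search_graph_residual) (simp add: network_stored_def)
  show "search_completed n2 m (residual_of s) (s' ''vis'') (s' ''pred'')"
    if "searching s'" "\<not> bval (Less (V ''qh'') (V ''qt'')) s'" "unchanged_except (written scan_com) s s'" for s'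
    using that bfs_completed by (simp add: searching_def)
  have "s ''start'' n2 \<le> 2 * n2"
    using net length_rows_le by (simp add: network_stored_def incidence_lists_def)
  then have "search_work s \<le> 3 * n2"
    using work_left_le[of "s ''qh'' 0" "s ''qt'' 0" "s ''p'' 0" "s ''queue''"] by (simp add: search_work_def)
  then show "search_work s * (250 + 1 + bcost (Less (V ''qh'') (V ''qt''))) + 1 + bcost (Less (V ''qh'') (V ''qt''))
      \<le> 772 * n2 + 10" by simp
qed (rule inv)

lemma runs_search:
  assumes net: "network_stored s" and only: "links_only (s ''flow'') (s ''cap'')"
  shows "runs search_com s (1000 * (n2 + 1))
    (\<lambda>s'. search_completed n2 m (residual_of s) (s' ''vis'') (s' ''pred''))"
  unfolding search_com_def
proof (rule runs_Seq[OF runs_clear])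
  show "s ''n'' 0 = n2" using net by (simp add: network_stored_def)
  fix s1 assume clear: "\<forall>y<n2. s1 ''vis'' y = 0" and frame: "unchanged_except (written clear_com) s s1"
  let ?s2 = "effect enqueue_source_com s1"
  interpret search_graph n2 m "residual_of s" "s ''start''" "s ''adj''"
    using net by (intro search_graph_residual) (simp add: network_stored_def)
  have "s1 ''edge_count'' 0 = m" using net frame by (simp add: network_stored_def)
  then have s2: "?s2 ''qh'' 0 = 0" "?s2 ''qt'' 0 = 1" "?s2 ''p'' 0 = s ''start'' m" "?s2 ''flow'' = s ''flow''"
    "?s2 ''cap'' = s ''cap''" "?s2 ''frozen'' = s ''frozen''" "?s2 ''start'' = s ''start''" "?s2 ''adj'' = s ''adj''"
    "?s2 ''queue'' 0 = m" "\<And>y. y < n2 \<Longrightarrow> ?s2 ''vis'' y = of_bool (y = m)"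
    using frame clear by (simp_all add: enqueue_source_com_def)
  have "searching ?s2" unfolding searching_def s2(1-8) using s2(9,10) by (intro bfs_init)
  moreover have "unchanged_except {''x'', ''vis'', ''qh'', ''qt'', ''queue'', ''p''} s ?s2"
    using frame by (simp add: enqueue_source_com_def)
  then have "network_stored ?s2" by (rule network_stored_frame[OF net]) auto
  ultimately have "runs (While (Less (V ''qh'') (V ''qt'')) scan_com) ?s2 (772 * n2 + 10)
      (\<lambda>s'. search_completed n2 m (residual_of s) (s' ''vis'') (s' ''pred''))"
    using runs_search_loop[of ?s2] only unfolding s2(4-6) by blast
  then show "runs (enqueue_source_com;; While (Less (V ''qh'') (V ''qt'')) scan_com) s1 (772 * n2 + 40)
      (\<lambda>s'. search_completed n2 m (residual_of s) (s' ''vis'') (s' ''pred''))"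
    by (rule runs_loop_free_Seq[rotated]) (simp_all add: enqueue_source_com_def)
qed simp

end

section \<open>Augmenting the flow\<close>

definition step_back_com :: com where
  "step_back_com =
     (''j'' ::= Read ''pred'' (V ''y'');;
      Cond (Equal (Read ''head'' (V ''j'')) (V ''y''))
        (Write ''flow'' (V ''j'') (Add (Read ''flow'' (V ''j'')) (Num 1));; ''y'' ::= Read ''tail'' (V ''j''))
        (Write ''flow'' (V ''j'') (Sub (Read ''flow'' (V ''j'')) (Num 1));; ''y'' ::= Read ''head'' (V ''j'')))"

definition augment_com :: com where
  "augment_com =
     (''y'' ::= Add (V ''edge_count'') (Num 1);;
      While (Neg (Equal (V ''y'') (V ''edge_count''))) step_back_com)"

lemma written_step_back [simp]: "written step_back_com = {''y'', ''j'', ''flow''}"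
  by (auto simp: step_back_com_def)
lemma written_augment [simp]: "written augment_com = {''y'', ''j'', ''flow''}"
  by (auto simp: augment_com_def)

context network
begin

text \<open>
  The augmenting path is followed backwards from the sink; \<open>y\<close> is the current node and \<open>f\<close> the
  flow after the changes made so far.  The levels \<open>vis\<close> decrease along the path, so it uses no link twice.
\<close>

definition augmenting ::
  "(nat \<Rightarrow> nat) \<Rightarrow> (nat \<Rightarrow> nat) \<Rightarrow> (nat \<Rightarrow> nat) \<Rightarrow> (nat \<Rightarrow> nat) \<Rightarrow> (nat \<Rightarrow> nat) \<Rightarrow> nat \<Rightarrow> (nat \<Rightarrow> nat) \<Rightarrow> bool" where
  "augmenting f0 cap frozen vis pred y f \<longleftrightarrow> y < n2 \<and> vis y \<noteq> 0 \<and> balanced f y \<and>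
     (\<Sum>i<m. int (f i)) - applicant_side y = (\<Sum>i<m. int (f0 i)) \<and> (\<forall>j\<in>links. f j \<le> cap j) \<and>
     (\<forall>j. frozen j \<noteq> 0 \<or> j \<notin> links \<longrightarrow> f j = f0 j) \<and>
     (\<forall>z<n2. vis z \<noteq> 0 \<and> z \<noteq> m \<and> vis z \<le> vis y \<longrightarrow> f (pred z) = f0 (pred z))"

lemma augmenting_sink:
  assumes "balanced f m" "\<forall>j\<in>links. f j \<le> cap j" "vis (m + 1) \<noteq> 0"
  shows "augmenting f cap frozen vis pred (m + 1) f"
  using assms source_sink_less balanced_source_iff_sink applicant_side_sink unfolding augmenting_def by simp

lemma search_tree_pred_distinct:
  assumes tree: "search_tree n2 m (residual f cap frozen) vis pred"
    and y: "y < n2" "vis y \<noteq> 0" "y \<noteq> m" and z: "z < n2" "vis z \<noteq> 0" "z \<noteq> m" "vis z < vis y"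
  shows "pred z \<noteq> pred y"
proof
  assume eq: "pred z = pred y"
  obtain x where x: "residual f cap frozen (pred y) x y" "vis y = vis x + 1"
    using tree y unfolding search_tree_def by blast
  obtain w where w: "residual f cap frozen (pred z) w z" "vis z = vis w + 1"
    using tree z(1-3) unfolding search_tree_def by blast
  have "x = w \<and> y = z \<or> x = z \<and> y = w" using x(1) w(1) eq by (auto simp: residual_def)
  then show False using x(2) w(2) z(4) by auto
qed

lemma augmenting_step:
  assumes aug: "augmenting f0 cap frozen vis pred y f"
    and tree: "search_tree n2 m (residual f0 cap frozen) vis pred" and ym: "y \<noteq> m" and j: "j = pred y"
    and move: "if head j = y then y' = tail j \<and> v = f j + 1 else y' = head j \<and> v = f j - 1"
  shows "augmenting f0 cap frozen vis pred y' (f(j := v)) \<and> vis y' < vis y"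
proof -
  have y: "y < n2" "vis y \<noteq> 0" and bal: "balanced f y"
    and sum: "(\<Sum>i<m. int (f i)) - applicant_side y = (\<Sum>i<m. int (f0 i))" and le: "\<forall>j\<in>links. f j \<le> cap j"
    and same: "\<And>j. frozen j \<noteq> 0 \<or> j \<notin> links \<Longrightarrow> f j = f0 j"
    and low: "\<And>z. z < n2 \<Longrightarrow> vis z \<noteq> 0 \<Longrightarrow> z \<noteq> m \<Longrightarrow> vis z \<le> vis y \<Longrightarrow> f (pred z) = f0 (pred z)"
    using aug unfolding augmenting_def by blast+
  obtain x where arc: "residual f0 cap frozen j x y" and x: "vis x \<noteq> 0" "vis y = vis x + 1"
    using tree y ym j unfolding search_tree_def by blast
  have jl: "j \<in> links" "x < n2" using residual_ends[OF arc] by auto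
  have "f j = f0 j" using low[of y] y ym j by simp
  then have cases: "head j = y \<and> tail j = x \<and> f j < cap j \<or> head j \<noteq> y \<and> head j = x \<and> tail j = y \<and> 0 < f j"
    using arc link_ends(3)[OF jl(1)] by (auto simp: residual_def)
  then have "y' = x" and backward: "backward_step f j y y' v" using move by (auto simp: backward_step_def)
  have "v \<le> cap j" using cases move le jl(1) by auto
  then have "\<forall>i\<in>links. (f(j := v)) i \<le> cap i" using le by simp
  moreover have "(f(j := v)) i = f0 i" if "frozen i \<noteq> 0 \<or> i \<notin> links" for i
    using that same arc by (auto simp: residual_def)
  moreover have "(f(j := v)) (pred z) = f0 (pred z)" if z: "z < n2" "vis z \<noteq> 0" "z \<noteq> m" "vis z \<le> vis x" for z
    using search_tree_pred_distinct[OF tree y ym z(1-3)] low[of z] z x(2) j by simp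
  ultimately show ?thesis
    using balanced_backward_step[OF bal jl(1) backward] edge_flow_backward_step[OF jl(1) backward] sum \<open>y' = x\<close> x jl
    unfolding augmenting_def by simp
qed

lemma runs_step_back:
  assumes aug: "augmenting f0 cap frozen (s ''vis'') (s ''pred'') (s ''y'' 0) (s ''flow'')"
    and tree: "search_tree n2 m (residual f0 cap frozen) (s ''vis'') (s ''pred'')"
    and arrays: "s ''head'' = head" "s ''tail'' = tail" and y: "s ''y'' 0 \<noteq> m"
  shows "runs step_back_com s 50 (\<lambda>s'. augmenting f0 cap frozen (s ''vis'') (s ''pred'') (s' ''y'' 0) (s' ''flow'') \<and>
    s ''vis'' (s' ''y'' 0) < s ''vis'' (s ''y'' 0))"
proof -
  let ?y = "s ''y'' 0" and ?j = "s ''pred'' (s ''y'' 0)"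
  let ?y' = "if head ?j = ?y then tail ?j else head ?j"
    and ?v = "if head ?j = ?y then s ''flow'' ?j + 1 else s ''flow'' ?j - 1"
  have "augmenting f0 cap frozen (s ''vis'') (s ''pred'') ?y' ((s ''flow'')(?j := ?v)) \<and> s ''vis'' ?y' < s ''vis'' ?y"
    by (intro augmenting_step[OF aug tree y refl]) simp_all
  moreover have "effect step_back_com s ''y'' 0 = ?y'" "effect step_back_com s ''flow'' = (s ''flow'')(?j := ?v)"
    using arrays by (simp_all add: step_back_com_def)
  ultimately show ?thesis by (intro runs_loop_free) (simp_all only:, simp_all add: step_back_com_def)
qed

lemma runs_augment:
  assumes net: "network_stored s"
    and tree: "search_tree n2 m (residual (s ''flow'') (s ''cap'') frozen) (s ''vis'') (s ''pred'')"
    and level: "s ''vis'' (m + 1) \<le> n2"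
    and bal: "balanced (s ''flow'') m" and le: "\<forall>j\<in>links. s ''flow'' j \<le> s ''cap'' j"
    and sink: "s ''vis'' (m + 1) \<noteq> 0"
  shows "runs augment_com s (100 * (n2 + 1))
    (\<lambda>s'. augmenting (s ''flow'') (s ''cap'') frozen (s ''vis'') (s ''pred'') m (s' ''flow''))"
  unfolding augment_com_def
proof (rule runs_loop_free_Seq)
  let ?aug = "augmenting (s ''flow'') (s ''cap'') frozen (s ''vis'') (s ''pred'')"
    and ?b = "Neg (Equal (V ''y'') (V ''edge_count''))"
    and ?s1 = "effect (''y'' ::= Add (V ''edge_count'') (Num 1)) s"
  have s1: "?s1 ''y'' 0 = m + 1" "?s1 ''flow'' = s ''flow''" using net by (simp_all add: network_stored_def)
  show "runs (While ?b step_back_com) ?s1 (60 * n2 + 10) (\<lambda>s'. ?aug m (s' ''flow''))"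
  proof (rule runs_While[where J = "\<lambda>s'. ?aug (s' ''y'' 0) (s' ''flow'')"
        and \<mu> = "\<lambda>s'. s ''vis'' (s' ''y'' 0)" and k = 50])
    show "?aug (?s1 ''y'' 0) (?s1 ''flow'')" unfolding s1 using bal le sink by (rule augmenting_sink)
    fix s' assume aug: "?aug (s' ''y'' 0) (s' ''flow'')" and b: "bval ?b s'"
      and "unchanged_except (written step_back_com) ?s1 s'"
    then have arrays: "s' ''edge_count'' 0 = m" "s' ''vis'' = s ''vis''" "s' ''pred'' = s ''pred''"
      "s' ''head'' = head" "s' ''tail'' = tail"
      using net by (simp_all add: network_stored_def)
    then have "s' ''y'' 0 \<noteq> m" using b by simp
    then show "runs step_back_com s' 50
        (\<lambda>s''. ?aug (s'' ''y'' 0) (s'' ''flow'') \<and> s ''vis'' (s'' ''y'' 0) < s ''vis'' (s' ''y'' 0))"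
      using runs_step_back[of _ _ _ s'] aug tree arrays by simp
  next
    fix s' assume aug: "?aug (s' ''y'' 0) (s' ''flow'')" and b: "\<not> bval ?b s'"
      and "unchanged_except (written step_back_com) ?s1 s'"
    then have "s' ''y'' 0 = m" using net by (simp add: network_stored_def)
    then show "?aug m (s' ''flow'')" using aug by simp
  next
    show "s ''vis'' (?s1 ''y'' 0) * (50 + 1 + bcost ?b) + 1 + bcost ?b \<le> 60 * n2 + 10"
      unfolding s1 using level by simp
  qed
qed simp_all

end

section \<open>The stages of the algorithm\<close>

abbreviation Or :: "bexp \<Rightarrow> bexp \<Rightarrow> bexp" where
  "Or b c \<equiv> Neg (And (Neg b) (Neg c))"

definition crosses_test :: bexp where
  "crosses_test =
     (let late = And (Less (V ''j'') (V ''edge_count'')) (Less (V ''k'') (Read ''edge_rank'' (V ''j'')));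
          tail = Neg (Equal (Read ''vis'' (Read ''tail'' (V ''j''))) (Num 0));
          head = Neg (Equal (Read ''vis'' (Read ''head'' (V ''j''))) (Num 0))
      in Neg (Or (And late (And tail (Neg head)))
                 (And (Neg late) (Or (And tail head) (And (Neg tail) (Neg head))))))"

definition enters_test :: bexp where
  "enters_test =
     And (Less (V ''j'') (V ''edge_count'')) (Equal (Read ''edge_rank'' (V ''j'')) (Add (V ''k'') (Num 1)))"

definition freeze_com :: com where
  "freeze_com =
     For ''j'' (V ''n'')
       (Cond crosses_test (Write ''frozen'' (V ''j'') (Num 1)) Skip;;
        Cond enters_test (Write ''cap'' (V ''j'') (Num 1)) Skip)"

definition next_stage_com :: com where
  "next_stage_com = (freeze_com;; ''k'' ::= Add (V ''k'') (Num 1))"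

definition round_com :: com where
  "round_com =
     (search_com;;
      Cond (Equal (Read ''vis'' (Add (V ''edge_count'') (Num 1))) (Num 0)) next_stage_com augment_com)"

definition stages_com :: com where
  "stages_com = (''k'' ::= Num 1;; While (Less (V ''k'') (Add (V ''edge_count'') (Num 1))) round_com)"

definition first_rank_com :: com where
  "first_rank_com =
     For ''j'' (V ''edge_count'')
       (Cond (Equal (Read ''edge_rank'' (V ''j'')) (Num 1)) (Write ''cap'' (V ''j'') (Num 1)) Skip)"

lemma written_freeze [simp]: "written freeze_com = {''j'', ''frozen'', ''cap''}"
  by (auto simp: freeze_com_def)
lemma written_round [simp]: "written round_com =
    {''k'', ''x'', ''j'', ''p'', ''qh'', ''y'', ''vis'', ''pred'', ''queue'', ''qt'', ''frozen'', ''cap'', ''flow''}"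
  by (auto simp: round_com_def next_stage_com_def)
lemma written_stages [simp]: "written stages_com =
    {''k'', ''x'', ''j'', ''p'', ''qh'', ''y'', ''vis'', ''pred'', ''queue'', ''qt'', ''frozen'', ''cap'', ''flow''}"
  by (auto simp: stages_com_def)
lemma written_first_rank [simp]: "written first_rank_com = {''j'', ''cap''}"
  by (auto simp: first_rank_com_def)

lemma runs_first_rank:
  assumes "s ''edge_count'' 0 = m"
  shows "runs first_rank_com s (50 * (m + 1))
    (\<lambda>s'. \<forall>j. s' ''cap'' j = (if j < m \<and> s ''edge_rank'' j = 1 then 1 else s ''cap'' j))"
proof -
  let ?body = "Cond (Equal (Read ''edge_rank'' (V ''j'')) (Num 1)) (Write ''cap'' (V ''j'') (Num 1)) Skip"
  let ?I = "\<lambda>i s'. \<forall>j. s' ''cap'' j = (if j < i \<and> s ''edge_rank'' j = 1 then 1 else s ''cap'' j)"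
  show ?thesis
    unfolding first_rank_com_def
  proof (rule runs_For[where n = m and k = "\<lambda>_. 20" and I = ?I])
    fix i s' assume I: "?I i s'" and i: "s' ''j'' 0 = i" and "unchanged_except (insert ''j'' (written ?body)) s s'"
    then have "s' ''edge_rank'' = s ''edge_rank''" by simp
    then show "runs ?body s' 20 (?I (Suc i))" using I i by (intro runs_loop_free) (auto simp: less_Suc_eq)
  qed (use assms in simp_all)
qed

context network
begin

lemma bval_crosses_test:
  assumes "s ''tail'' = tail" "s ''head'' = head" "s ''edge_count'' 0 = m" "s ''edge_rank'' = rank"
  shows "bval crosses_test s \<longleftrightarrow> crosses (s ''k'' 0) {z. s ''vis'' z \<noteq> 0} (s ''j'' 0)"
  using assms by (auto simp: crosses_test_def Let_def crosses_def)

lemma runs_freeze: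
  assumes net: "network_stored s" and rank: "s ''edge_rank'' = rank" and k: "s ''k'' 0 = k"
  shows "runs freeze_com s (200 * (n2 + 1))
    (\<lambda>s'. \<forall>j<n2. s' ''frozen'' j = (if crosses k {z. s ''vis'' z \<noteq> 0} j then 1 else s ''frozen'' j) \<and>
       s' ''cap'' j = (if j < m \<and> rank j = Suc k then 1 else s ''cap'' j))"
proof -
  let ?crosses = "crosses k {z. s ''vis'' z \<noteq> 0}"
  let ?body = "Cond crosses_test (Write ''frozen'' (V ''j'') (Num 1)) Skip;;
    Cond enters_test (Write ''cap'' (V ''j'') (Num 1)) Skip"
  let ?I = "\<lambda>i s'. \<forall>j. s' ''frozen'' j = (if j < i \<and> ?crosses j then 1 else s ''frozen'' j) \<and>
    s' ''cap'' j = (if j < i \<and> j < m \<and> rank j = Suc k then 1 else s ''cap'' j)"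
  show ?thesis
    unfolding freeze_com_def
  proof (rule runs_For[where n = n2 and k = "\<lambda>_. 180" and I = ?I])
    fix i s' assume I: "?I i s'" and i: "s' ''j'' 0 = i"
      and "unchanged_except (insert ''j'' (written ?body)) s s'"
    then have same: "s' ''tail'' = tail" "s' ''head'' = head" "s' ''edge_count'' 0 = m" "s' ''edge_rank'' = rank"
      "s' ''k'' 0 = k" "s' ''vis'' = s ''vis''"
      using net rank k by (simp_all add: network_stored_def)
    have crosses: "bval crosses_test s' \<longleftrightarrow> ?crosses i"
      using bval_crosses_test[OF same(1-4)] same(5,6) i by simp
    have enters: "bval enters_test s'' \<longleftrightarrow> i < m \<and> rank i = Suc k" if "unchanged_except {''frozen''} s' s''" for s''
      using that same i by (simp add: enters_test_def)
    show "runs ?body s' 180 (?I (Suc i))"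
    proof (rule runs_loop_free)
      let ?s1 = "effect (Cond crosses_test (Write ''frozen'' (V ''j'') (Num 1)) Skip) s'"
      have "bval enters_test ?s1 \<longleftrightarrow> i < m \<and> rank i = Suc k" by (rule enters) simp
      then have "effect ?body s' ''frozen'' = (if ?crosses i then (s' ''frozen'')(i := 1) else s' ''frozen'')"
        "effect ?body s' ''cap'' = (if i < m \<and> rank i = Suc k then (s' ''cap'')(i := 1) else s' ''cap'')"
        using crosses i by simp_all
      then show "?I (Suc i) (effect ?body s')" using I by (simp only:) (auto simp: less_Suc_eq)
    qed (simp_all add: crosses_test_def enters_test_def Let_def)
  next
    fix s' assume "unchanged_except (insert ''j'' (written ?body)) s s'"
    then show "aval (V ''n'') s' = n2" using net by (simp add: network_stored_def)
  qed simp_all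
qed

definition stage_reached :: "state \<Rightarrow> bool" where
  "stage_reached s \<longleftrightarrow> network_stored s \<and> s ''edge_rank'' = rank \<and> links_only (s ''flow'') (s ''cap'') \<and>
     stage (s ''k'' 0) (s ''flow'') (s ''cap'') (s ''frozen'') \<and> 1 \<le> s ''k'' 0 \<and> s ''k'' 0 \<le> Suc m"

definition rounds_left :: "state \<Rightarrow> nat" where
  "rounds_left s = (Suc m - s ''k'' 0) + (m - (\<Sum>i<m. s ''flow'' i))"

lemma runs_next_stage:
  assumes reached: "stage_reached s" and k: "s ''k'' 0 \<le> m"
    and search: "search_completed n2 m (residual_of s) (s ''vis'') pred" and sink: "s ''vis'' (m + 1) = 0"
  shows "runs next_stage_com s (200 * (n2 + 1) + 6) (\<lambda>s'. stage_reached s' \<and> rounds_left s' < rounds_left s)"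
  unfolding next_stage_com_def
proof (rule runs_Seq[OF runs_freeze])
  let ?k = "s ''k'' 0" and ?R = "{z. s ''vis'' z \<noteq> 0}"
  show net: "network_stored s" and rank: "s ''edge_rank'' = rank" using reached by (simp_all add: stage_reached_def)
  fix s1
  assume freeze: "\<forall>j<n2. s1 ''frozen'' j = (if crosses ?k ?R j then 1 else s ''frozen'' j) \<and>
      s1 ''cap'' j = (if j < m \<and> rank j = Suc ?k then 1 else s ''cap'' j)"
    and frame: "unchanged_except (written freeze_com) s s1"
  let ?s2 = "effect (''k'' ::= Add (V ''k'') (Num 1)) s1"
  have s2: "?s2 ''k'' 0 = Suc ?k" "?s2 ''flow'' = s ''flow''" "?s2 ''cap'' = s1 ''cap''" "?s2 ''frozen'' = s1 ''frozen''"
    "?s2 ''edge_rank'' = rank"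
    using frame rank by simp_all
  have "stage (Suc ?k) (s ''flow'') (s1 ''cap'') (s1 ''frozen'')"
  proof (rule stage_Suc)
    show "stage ?k (s ''flow'') (s ''cap'') (s ''frozen'')" "1 \<le> ?k" using reached by (simp_all add: stage_reached_def)
    show "y \<in> ?R" if "residual_of s j x y" "x \<in> ?R" for j x y
      using search that unfolding search_completed_def by blast
    show "m \<in> ?R" "m + 1 \<notin> ?R" using search sink by (simp_all add: search_completed_def search_tree_def)
  qed (use freeze link_ends(4) in auto)
  moreover have "links_only (s ''flow'') (s1 ''cap'')"
    using reached freeze by (auto simp: stage_reached_def links_only_def links_def)
  moreover have "network_stored ?s2"
    by (rule network_stored_frame[OF net, where X = "{''j'', ''frozen'', ''cap'', ''k''}"]) (use frame in auto)
  ultimately have "stage_reached ?s2" using k unfolding stage_reached_def s2 by simp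
  moreover have "rounds_left ?s2 < rounds_left s" using k unfolding rounds_left_def s2 by simp
  ultimately show "runs (''k'' ::= Add (V ''k'') (Num 1)) s1 6 (\<lambda>s'. stage_reached s' \<and> rounds_left s' < rounds_left s)"
    by (intro runs_loop_free) simp_all
qed simp_all

lemma runs_augment_stage:
  assumes reached: "stage_reached s"
    and search: "search_completed n2 m (residual_of s) (s ''vis'') (s ''pred'')" and sink: "s ''vis'' (m + 1) \<noteq> 0"
  shows "runs augment_com s (100 * (n2 + 1)) (\<lambda>s'. stage_reached s' \<and> rounds_left s' < rounds_left s)"
proof (rule runs_frame[OF runs_augment])
  let ?k = "s ''k'' 0"
  have st: "stage ?k (s ''flow'') (s ''cap'') (s ''frozen'')" and net: "network_stored s"
    using reached by (simp_all add: stage_reached_def)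
  show "network_stored s" by (rule net)
  show "search_tree n2 m (residual_of s) (s ''vis'') (s ''pred'')" "s ''vis'' (m + 1) \<le> n2"
    using search source_sink_less by (simp_all add: search_completed_def)
  show "balanced (s ''flow'') m" "\<forall>j\<in>links. s ''flow'' j \<le> s ''cap'' j"
    using st unfolding stage_def by blast+
  show "s ''vis'' (m + 1) \<noteq> 0" by (rule sink)
  fix s' assume aug: "augmenting (s ''flow'') (s ''cap'') (s ''frozen'') (s ''vis'') (s ''pred'') m (s' ''flow'')"
    and frame: "unchanged_except (written augment_com) s s'"
  have same: "s' ''k'' = s ''k''" "s' ''cap'' = s ''cap''" "s' ''frozen'' = s ''frozen''"
    "s' ''edge_rank'' = s ''edge_rank''"
    using frame by simp_all
  have st': "stage ?k (s' ''flow'') (s ''cap'') (s ''frozen'')"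
    by (rule stage_augment[OF st]) (use aug in \<open>auto simp: augmenting_def\<close>)
  moreover have "network_stored s'" by (rule network_stored_frame[OF net frame]) auto
  moreover have "links_only (s' ''flow'') (s ''cap'')"
    using reached aug by (auto simp: stage_reached_def links_only_def augmenting_def)
  ultimately have "stage_reached s'" using reached unfolding stage_reached_def same by simp
  moreover have "int (\<Sum>i<m. s' ''flow'' i) = int (Suc (\<Sum>i<m. s ''flow'' i))"
    using aug by (simp add: augmenting_def)
  then have "(\<Sum>i<m. s' ''flow'' i) = Suc (\<Sum>i<m. s ''flow'' i)" by (simp only: of_nat_eq_iff)
  then have "rounds_left s' < rounds_left s"
    using stage_sum_flow_le[OF st'] unfolding rounds_left_def same by simp
  ultimately show "stage_reached s' \<and> rounds_left s' < rounds_left s" by blast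
qed

lemma runs_round:
  assumes reached: "stage_reached s" and k: "s ''k'' 0 \<le> m"
  shows "runs round_com s (1220 * (n2 + 1)) (\<lambda>s'. stage_reached s' \<and> rounds_left s' < rounds_left s)"
  unfolding round_com_def
proof (rule runs_Seq[OF runs_search])
  show net: "network_stored s" and "links_only (s ''flow'') (s ''cap'')"
    using reached by (simp_all add: stage_reached_def)
  fix s1 assume search: "search_completed n2 m (residual_of s) (s1 ''vis'') (s1 ''pred'')"
    and frame: "unchanged_except (written search_com) s s1"
  have same: "s1 ''k'' = s ''k''" "s1 ''flow'' = s ''flow''" "s1 ''cap'' = s ''cap''" "s1 ''frozen'' = s ''frozen''"
    "s1 ''edge_rank'' = s ''edge_rank''" "s1 ''edge_count'' 0 = m"
    using frame net by (simp_all add: network_stored_def)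
  have "network_stored s1" by (rule network_stored_frame[OF net frame]) auto
  then have reached1: "stage_reached s1" using reached unfolding stage_reached_def same by blast
  have left: "rounds_left s1 = rounds_left s" unfolding rounds_left_def same ..
  have k1: "s1 ''k'' 0 \<le> m" using k same(1) by simp
  have search1: "search_completed n2 m (residual_of s1) (s1 ''vis'') (s1 ''pred'')" using search unfolding same .
  let ?Q = "\<lambda>s'. stage_reached s' \<and> rounds_left s' < rounds_left s"
  show "runs (Cond (Equal (Read ''vis'' (Add (V ''edge_count'') (Num 1))) (Num 0)) next_stage_com augment_com) s1
      (200 * (n2 + 1) + 14) ?Q" (is "runs (Cond ?unreached _ _) _ _ _")
  proof (rule runs_Cond)
    assume "bval ?unreached s1"
    then have "s1 ''vis'' (m + 1) = 0" using same(6) by simp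
    from runs_next_stage[OF reached1 k1 search1 this]
    show "runs next_stage_com s1 (200 * (n2 + 1) + 6) ?Q" unfolding left .
  next
    assume "\<not> bval ?unreached s1"
    then have "s1 ''vis'' (m + 1) \<noteq> 0" using same(6) by simp
    from runs_augment_stage[OF reached1 search1 this]
    show "runs augment_com s1 (200 * (n2 + 1) + 6) ?Q" unfolding left by (rule runs_weaken) simp_all
  qed simp
qed simp

lemma runs_stages:
  assumes net: "network_stored s" and rank: "s ''edge_rank'' = rank" and only: "links_only (s ''flow'') (s ''cap'')"
    and st: "stage 1 (s ''flow'') (s ''cap'') (s ''frozen'')"
  shows "runs stages_com s (3000 * (n2 + 1) * (m + 1)) (\<lambda>s'. \<exists>cap frozen. stage (Suc m) (s' ''flow'') cap frozen)"
proof -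
  let ?b = "Less (V ''k'') (Add (V ''edge_count'') (Num 1))" and ?s1 = "effect (''k'' ::= Num 1) s"
  have "runs (While ?b round_com) ?s1 (2 * m * (1220 * (n2 + 1) + 8) + 8)
      (\<lambda>s'. \<exists>cap frozen. stage (Suc m) (s' ''flow'') cap frozen)"
  proof (rule runs_While[where J = stage_reached and \<mu> = rounds_left and k = "1220 * (n2 + 1)"])
    have "network_stored ?s1" by (rule network_stored_frame[OF net, where X = "{''k''}"]) auto
    then show "stage_reached ?s1" using rank only st by (simp add: stage_reached_def)
  next
    fix s' assume "stage_reached s'" "bval ?b s'"
    then show "runs round_com s' (1220 * (n2 + 1)) (\<lambda>s''. stage_reached s'' \<and> rounds_left s'' < rounds_left s')"
      by (intro runs_round) (simp_all add: stage_reached_def network_stored_def)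
  next
    fix s' assume reached: "stage_reached s'" and "\<not> bval ?b s'"
    then have "s' ''k'' 0 = Suc m" by (auto simp: stage_reached_def network_stored_def)
    then show "\<exists>cap frozen. stage (Suc m) (s' ''flow'') cap frozen"
      using reached unfolding stage_reached_def by metis
  next
    have "rounds_left ?s1 \<le> 2 * m" by (simp add: rounds_left_def)
    then show "rounds_left ?s1 * (1220 * (n2 + 1) + 1 + bcost ?b) + 1 + bcost ?b \<le> 2 * m * (1220 * (n2 + 1) + 8) + 8"
      by (simp add: mult_le_mono1)
  qed
  then show ?thesis
    unfolding stages_com_def by (rule runs_loop_free_Seq[rotated]) (simp_all add: algebra_simps)
qed

end

section \<open>Output\<close>

definition output_com :: com where
  "output_com =
     For ''j'' (V ''edge_count'')
       (Cond (Equal (Read ''flow'' (V ''j'')) (Num 1))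
         (Write ''out_applicant'' (V ''out_count'') (Read ''edge_applicant'' (V ''j''));;
          Write ''out_post'' (V ''out_count'') (Read ''edge_post'' (V ''j''));;
          ''out_count'' ::= Add (V ''out_count'') (Num 1)) Skip)"

lemma output_edges_append:
  fixes s :: state
  defines "n \<equiv> s ''out_count'' 0"
  assumes "s' ''out_count'' 0 = Suc n"
    and "s' ''out_applicant'' = (s ''out_applicant'')(n := a)" "s' ''out_post'' = (s ''out_post'')(n := p)"
  shows "output_edges s' = insert (a, p) (output_edges s)"
proof -
  have image: "output_edges s = (\<lambda>i. (s ''out_applicant'' i, s ''out_post'' i)) ` {..<s ''out_count'' 0}" for s
    by (auto simp: output_edges_def)
  have "(\<lambda>i. (s' ''out_applicant'' i, s' ''out_post'' i)) ` {..<n} = output_edges s"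
    unfolding image using assms by (intro image_cong) auto
  then show ?thesis unfolding image[of s'] assms(2) lessThan_Suc image_insert by (simp add: assms(3,4))
qed

lemma runs_output:
  assumes m: "s ''edge_count'' 0 = m" and empty: "s ''out_count'' 0 = 0"
  shows "runs output_com s (100 * (m + 1)) (\<lambda>s'. output_edges s' =
    (\<lambda>j. (s ''edge_applicant'' j, s ''edge_post'' j)) ` {j. j < m \<and> s ''flow'' j = 1})"
proof -
  let ?edge = "\<lambda>j. (s ''edge_applicant'' j, s ''edge_post'' j)"
  let ?I = "\<lambda>i s'. output_edges s' = ?edge ` {j. j < i \<and> s ''flow'' j = 1}"
  let ?test = "Equal (Read ''flow'' (V ''j'')) (Num 1)"
    and ?append = "Write ''out_applicant'' (V ''out_count'') (Read ''edge_applicant'' (V ''j''));;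
        Write ''out_post'' (V ''out_count'') (Read ''edge_post'' (V ''j''));;
        ''out_count'' ::= Add (V ''out_count'') (Num 1)"
  show ?thesis
    unfolding output_com_def
  proof (rule runs_For[where n = m and k = "\<lambda>_. 50" and I = ?I])
    fix i s' assume I: "?I i s'" and i: "s' ''j'' 0 = i"
      and frame: "unchanged_except (insert ''j'' (written (Cond ?test ?append Skip))) s s'"
    have same: "s' ''flow'' = s ''flow''" "s' ''edge_applicant'' = s ''edge_applicant''"
      "s' ''edge_post'' = s ''edge_post''"
      using frame by simp_all
    have selected: "{j. j < Suc i \<and> s ''flow'' j = 1} =
        (if s ''flow'' i = 1 then insert i {j. j < i \<and> s ''flow'' j = 1} else {j. j < i \<and> s ''flow'' j = 1})"
      by (auto simp: less_Suc_eq)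
    have "output_edges (effect ?append s') = insert (?edge i) (output_edges s')"
      using same i by (intro output_edges_append) simp_all
    moreover have "effect (Cond ?test ?append Skip) s' = (if s ''flow'' i = 1 then effect ?append s' else s')"
      using same i by simp
    ultimately have "?I (Suc i) (effect (Cond ?test ?append Skip) s')"
      using I selected by (cases "s ''flow'' i = 1") (simp_all only: if_True if_False image_insert simp_thms)
    then show "runs (Cond ?test ?append Skip) s' 50 (?I (Suc i))" by (intro runs_loop_free) simp_all
  next
    show "?I 0 s" using empty by (simp add: output_edges_def)
    show "?I i (s'(''j'' := v))" if "?I i s'" for i s' v using that by (simp add: output_edges_def)
  qed (use m in simp_all)
qed

section \<open>From instances to networks\<close>

lemma length_preference_list_le:
  assumes gs: "preference_list gs X" and "finite X"
  shows "length gs \<le> card X"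
proof -
  have "\<forall>i\<in>{..<length gs}. \<exists>x. x \<in> gs ! i"
    using gs nth_mem unfolding preference_list_def by (metis ex_in_conv lessThan_iff)
  then obtain h where h: "\<forall>i\<in>{..<length gs}. h i \<in> gs ! i" by metis
  have "inj_on h {..<length gs}"
  proof (rule inj_onI)
    fix i j assume ij: "i \<in> {..<length gs}" "j \<in> {..<length gs}" "h i = h j"
    then have "h i \<in> gs ! i" "h j \<in> gs ! j" using h by blast+
    then have "h i \<in> gs ! i \<inter> gs ! j" using ij(3) by simp
    then show "i = j" using gs ij unfolding preference_list_def by blast
  qed
  moreover have "h ` {..<length gs} \<subseteq> X"
    using h gs nth_mem unfolding preference_list_def by fastforce
  ultimately show ?thesis using card_inj_on_le[of h "{..<length gs}" X] \<open>finite X\<close> by simp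
qed

lemma has_rank_unique:
  assumes "preference_list (pref I (fst e)) X" "has_rank I e k" "has_rank I e k'"
  shows "k = k'"
proof -
  have "k - 1 < length (pref I (fst e))" "k' - 1 < length (pref I (fst e))" "1 \<le> k" "1 \<le> k'"
    "snd e \<in> pref I (fst e) ! (k - 1) \<inter> pref I (fst e) ! (k' - 1)"
    using assms(2,3) by (auto simp: has_rank_def)
  then have "k - 1 = k' - 1" using assms(1) unfolding preference_list_def by blast
  then show ?thesis using \<open>1 \<le> k\<close> \<open>1 \<le> k'\<close> by simp
qed

lemma stores_bij_betw:
  assumes "stores s x k xs" "distinct xs"
  shows "bij_betw (s x) {k..<k + length xs} (set xs)"
proof -
  have "bij_betw (\<lambda>i. i - k) {k..<k + length xs} {..<length xs}"
    by (rule bij_betw_byWitness[where f' = "\<lambda>i. i + k"]) auto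
  then have nth: "bij_betw ((!) xs \<circ> (\<lambda>i. i - k)) {k..<k + length xs} (set xs)"
    using bij_betw_nth[OF assms(2)] by (rule bij_betw_trans) auto
  have "s x i = ((!) xs \<circ> (\<lambda>i. i - k)) i" if "i \<in> {k..<k + length xs}" for i
    using assms(1) that unfolding stores_def by (auto dest: spec[of _ "i - k"])
  then show ?thesis by (rule iffD2[OF bij_betw_cong nth])
qed

locale encoded =
  fixes I :: cm_instance and s :: state and es :: "(nat \<times> nat) list"
  assumes valid: "valid_instance I" and enc: "encodes I s"
    and es: "distinct es" "set es = edges I" "length es = s ''edge_count'' 0"
    and ends_stored: "stores s ''edge_applicant'' 0 (map fst es)" "stores s ''edge_post'' 0 (map snd es)"
    and ranks_stored: "\<And>i. i < s ''edge_count'' 0 \<Longrightarrow> has_rank I (es ! i) (s ''edge_rank'' i)"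
begin

abbreviation "m \<equiv> s ''edge_count'' 0"
abbreviation "appl \<equiv> s ''edge_applicant''"
abbreviation "post \<equiv> s ''edge_post''"
abbreviation "rk \<equiv> s ''edge_rank''"

definition edge_set :: "nat set \<Rightarrow> (nat \<times> nat) set" where
  "edge_set X = (\<lambda>j. (appl j, post j)) ` X"

lemma es_nth: "j < m \<Longrightarrow> es ! j = (appl j, post j)"
  using ends_stored es(3) by (auto simp: stores_def intro: prod_eqI)

lemma edges_eq: "edges I = edge_set {..<m}"
  unfolding es(2)[symmetric] edge_set_def using es_nth es(3) by (force simp: set_conv_nth)

lemma card_edges: "card (edges I) = m"
  using es distinct_card by fastforce

lemma inj_edge: "inj_on (\<lambda>j. (appl j, post j)) {..<m}"
proof (rule inj_onI)
  fix i j assume ij: "i \<in> {..<m}" "j \<in> {..<m}" "(appl i, post i) = (appl j, post j)"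
  then have "es ! i = es ! j" using es_nth by simp
  then show "i = j" using es(1,3) ij by (simp add: nth_eq_iff_index_eq)
qed

lemma edge_ends: "j < m \<Longrightarrow> appl j \<in> applicants I \<and> post j \<in> posts I"
  using valid edges_eq by (auto simp: edge_set_def valid_instance_def)

lemma sides_disjoint: "applicants I \<inter> posts I = {}"
  using valid by (simp add: valid_instance_def)

lemma partners_applicant:
  assumes "X \<subseteq> {..<m}" "a \<in> applicants I"
  shows "partners (edge_set X) a = post ` {j \<in> X. appl j = a}"
  using assms edge_ends sides_disjoint by (auto simp: partners_def edge_set_def)

lemma partners_post:
  assumes "X \<subseteq> {..<m}" "p \<in> posts I"
  shows "partners (edge_set X) p = appl ` {j \<in> X. post j = p}"
  using assms edge_ends sides_disjoint by (auto simp: partners_def edge_set_def)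

subsection \<open>Classes\<close>

lemma vertex_classes:
  assumes "u \<in> vertices I"
  shows "bij_betw (class_members s) (class_numbers s u) (classes I u)"
    and "c \<in> class_numbers s u \<Longrightarrow>
      s ''class_quota'' c = class_quota I u (class_members s c) \<and> inj_on (s ''member'') (member_cells s c)"
proof -
  let ?start = "s ''class_start'' u"
  obtain Cs where Cs: "distinct Cs" "set Cs = classes I u" "s ''class_count'' u = length Cs"
    and stored: "\<forall>j<length Cs. let c = ?start + j in s ''class_quota'' c = class_quota I u (Cs ! j) \<and>
      (\<exists>xs. distinct xs \<and> set xs = Cs ! j \<and> s ''member_count'' c = length xs \<and>
         stores s ''member'' (s ''member_start'' c) xs)"
    using enc assms unfolding encodes_def by blast
  have nth: "class_members s c = Cs ! (c - ?start)" "inj_on (s ''member'') (member_cells s c)"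
    "s ''class_quota'' c = class_quota I u (Cs ! (c - ?start))"
    if c: "c \<in> class_numbers s u" for c
  proof -
    have "c - ?start < length Cs" "?start + (c - ?start) = c" using c Cs(3) by (auto simp: class_numbers_def)
    then obtain xs where xs: "s ''class_quota'' c = class_quota I u (Cs ! (c - ?start))" "distinct xs"
      "set xs = Cs ! (c - ?start)" "s ''member_count'' c = length xs" "stores s ''member'' (s ''member_start'' c) xs"
      using stored unfolding Let_def by metis
    have "bij_betw (s ''member'') (member_cells s c) (Cs ! (c - ?start))"
      using stores_bij_betw[OF xs(5,2)] xs(3,4) by (simp add: member_cells_def)
    then show "class_members s c = Cs ! (c - ?start)" "inj_on (s ''member'') (member_cells s c)"
      by (simp_all add: class_members_def bij_betw_def)
    show "s ''class_quota'' c = class_quota I u (Cs ! (c - ?start))" by (rule xs(1))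
  qed
  have "bij_betw (\<lambda>c. c - ?start) (class_numbers s u) {..<length Cs}"
    by (rule bij_betw_byWitness[where f' = "\<lambda>j. j + ?start"]) (auto simp: class_numbers_def Cs(3))
  then have "bij_betw ((!) Cs \<circ> (\<lambda>c. c - ?start)) (class_numbers s u) (classes I u)"
    using bij_betw_nth[OF Cs(1) refl Cs(2)[symmetric]] by (rule bij_betw_trans)
  then show "bij_betw (class_members s) (class_numbers s u) (classes I u)"
    using nth(1) by (simp cong: bij_betw_cong)
  show "s ''class_quota'' c = class_quota I u (class_members s c) \<and> inj_on (s ''member'') (member_cells s c)"
    if "c \<in> class_numbers s u" using nth that by simp
qed

lemma classes_fit_iff:
  assumes "u \<in> vertices I"
  shows "(\<forall>C\<in>classes I u. card (Y \<inter> C) \<le> class_quota I u C) \<longleftrightarrow>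
    (\<forall>c\<in>class_numbers s u. card (Y \<inter> class_members s c) \<le> s ''class_quota'' c)"
proof -
  have "classes I u = class_members s ` class_numbers s u"
    using vertex_classes(1)[OF assms] by (simp add: bij_betw_def)
  then show ?thesis using vertex_classes(2)[OF assms] by simp
qed

lemma classified_sideI:
  assumes inj: "inj_on (\<lambda>j. (own j, opp j)) {..<m}"
    and side: "\<And>u. u \<in> own ` {..<m} \<Longrightarrow> u \<in> vertices I \<and> partners (edges I) u = opp ` {j. j < m \<and> own j = u}"
  shows "classified_side m own opp (class_numbers s) (class_members s)"
proof
  fix u assume u: "u \<in> own ` {..<m}"
  then have uV: "u \<in> vertices I" using side by blast
  have image: "class_members s ` class_numbers s u = classes I u"
    and inj_members: "inj_on (class_members s) (class_numbers s u)"
    using vertex_classes(1)[OF uV] by (simp_all add: bij_betw_def)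
  show "inj_on (class_members s) (class_numbers s u)" by (rule inj_members)
  show "finite (class_numbers s u)" by (simp add: class_numbers_def)
  show "laminar (class_members s ` class_numbers s u)" unfolding image using valid uV by (simp add: valid_instance_def)
  show "class_members s c \<subseteq> opp ` {j. j < m \<and> own j = u}" if "c \<in> class_numbers s u" for c
  proof -
    have "class_members s c \<in> classes I u" using image that by blast
    then show ?thesis using valid uV side[OF u] unfolding valid_instance_def by blast
  qed
qed (rule inj)

lemma applicant_classified_side: "classified_side m appl post (class_numbers s) (class_members s)"
proof (rule classified_sideI[OF inj_edge])
  fix u assume "u \<in> appl ` {..<m}"
  then have "u \<in> applicants I" using edge_ends by auto
  then show "u \<in> vertices I \<and> partners (edges I) u = post ` {j. j < m \<and> appl j = u}"
    using partners_applicant[of "{..<m}" u] edges_eq by (simp add: vertices_def)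
qed

lemma post_classified_side: "classified_side m post appl (class_numbers s) (class_members s)"
proof (rule classified_sideI)
  show "inj_on (\<lambda>j. (post j, appl j)) {..<m}" using inj_edge by (auto simp: inj_on_def)
  fix u assume "u \<in> post ` {..<m}"
  then have "u \<in> posts I" using edge_ends by auto
  then show "u \<in> vertices I \<and> partners (edges I) u = appl ` {j. j < m \<and> post j = u}"
    using partners_post[of "{..<m}" u] edges_eq by (simp add: vertices_def)
qed

lemma inj_on_member_cells:
  "u \<in> appl ` {..<m} \<union> post ` {..<m} \<Longrightarrow> c \<in> class_numbers s u \<Longrightarrow> inj_on (s ''member'') (member_cells s c)"
  using vertex_classes(2)[of u c] edge_ends by (auto simp: vertices_def)

sublocale A: side_program s "''edge_applicant''" "''edge_post''" "''tail''" "''head''" "V ''edge_count''" "m + 2" m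
  by (intro side_program.intro applicant_classified_side side_program_axioms.intro)
    (use inj_on_member_cells in \<open>auto simp: same_inputs_simps\<close>)

lemma post_side_program:
  assumes "m + 2 \<le> n1"
  shows "side_program s ''edge_post'' ''edge_applicant'' ''head'' ''tail'' (Add (V ''edge_count'') (Num 1)) n1 (m + 1)"
  by (intro side_program.intro post_classified_side side_program_axioms.intro)
    (use assms inj_on_member_cells in \<open>auto simp: same_inputs_simps\<close>)

definition vertex_fits :: "nat \<Rightarrow> nat set \<Rightarrow> bool" where
  "vertex_fits u Y \<longleftrightarrow> card Y \<le> s ''quota'' u \<and>
     (\<forall>c\<in>class_numbers s u. card (Y \<inter> class_members s c) \<le> s ''class_quota'' c)"

lemma vertex_fits_at_ends_iff:
  assumes "own ` {..<m} \<subseteq> B" "X \<subseteq> {..<m}"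
  shows "(\<forall>u\<in>B. vertex_fits u (opp ` {j \<in> X. own j = u})) \<longleftrightarrow>
    (\<forall>u\<in>own ` {..<m}. vertex_fits u (opp ` {j \<in> X. own j = u}))"
proof -
  have "vertex_fits u (opp ` {j \<in> X. own j = u})" if "u \<notin> own ` {..<m}" for u
  proof -
    have "{j \<in> X. own j = u} = {}" using that assms(2) by auto
    then show ?thesis by (simp only: image_empty) (simp add: vertex_fits_def)
  qed
  then show ?thesis using assms(1) by blast
qed

lemma feasible_edge_set_iff:
  assumes X: "X \<subseteq> {..<m}"
  shows "feasible I (edge_set X) \<longleftrightarrow>
    (\<forall>u\<in>appl ` {..<m}. vertex_fits u (post ` {j \<in> X. appl j = u})) \<and>
    (\<forall>u\<in>post ` {..<m}. vertex_fits u (appl ` {j \<in> X. post j = u}))"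
proof -
  have "edge_set X \<subseteq> edges I" using X edges_eq by (auto simp: edge_set_def)
  moreover have "s ''quota'' u = quota I u" if "u \<in> vertices I" for u using enc that by (simp add: encodes_def)
  ultimately have "feasible I (edge_set X) \<longleftrightarrow> (\<forall>u\<in>vertices I. vertex_fits u (partners (edge_set X) u))"
    unfolding feasible_def vertex_fits_def using classes_fit_iff by simp
  also have "\<dots> \<longleftrightarrow> (\<forall>u\<in>applicants I. vertex_fits u (post ` {j \<in> X. appl j = u})) \<and>
      (\<forall>u\<in>posts I. vertex_fits u (appl ` {j \<in> X. post j = u}))"
    unfolding vertices_def ball_Un using partners_applicant[OF X] partners_post[OF X] by simp
  also have "(\<forall>u\<in>applicants I. vertex_fits u (post ` {j \<in> X. appl j = u})) \<longleftrightarrow>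
      (\<forall>u\<in>appl ` {..<m}. vertex_fits u (post ` {j \<in> X. appl j = u}))"
    by (rule vertex_fits_at_ends_iff[OF _ X]) (use edge_ends in auto)
  also have "(\<forall>u\<in>posts I. vertex_fits u (appl ` {j \<in> X. post j = u})) \<longleftrightarrow>
      (\<forall>u\<in>post ` {..<m}. vertex_fits u (appl ` {j \<in> X. post j = u}))"
    by (rule vertex_fits_at_ends_iff[OF _ X]) (use edge_ends in auto)
  finally show ?thesis .
qed

subsection \<open>Ranks\<close>

lemma applicant_preference_list:
  assumes "j < m"
  shows "preference_list (pref I (appl j)) (partners (edges I) (appl j))"
  using valid edge_ends[OF assms] by (simp add: valid_instance_def)

lemma has_rank_iff:
  assumes "j < m"
  shows "has_rank I (appl j, post j) k \<longleftrightarrow> k = rk j"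
proof -
  have "has_rank I (appl j, post j) (rk j)" using ranks_stored[OF assms] es_nth[OF assms] by simp
  then show ?thesis using has_rank_unique[of I "(appl j, post j)"] applicant_preference_list[OF assms] by auto
qed

lemma rank_bounds:
  assumes "j < m"
  shows "1 \<le> rk j" "rk j \<le> m"
proof -
  have "has_rank I (appl j, post j) (rk j)" using has_rank_iff[OF assms] by simp
  then show "1 \<le> rk j" by (simp add: has_rank_def)
  have partners: "partners (edges I) (appl j) = post ` {i \<in> {..<m}. appl i = appl j}"
    using partners_applicant[OF order_refl] edge_ends[OF assms] edges_eq by simp
  have "rk j \<le> length (pref I (appl j))" using \<open>has_rank I _ (rk j)\<close> by (simp add: has_rank_def)
  also have "\<dots> \<le> card (partners (edges I) (appl j))"
    using applicant_preference_list[OF assms] by (rule length_preference_list_le) (simp add: partners)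
  also have "\<dots> \<le> card {i \<in> {..<m}. appl i = appl j}" unfolding partners by (rule card_image_le) simp
  also have "\<dots> \<le> card {..<m}" by (rule card_mono) auto
  finally show "rk j \<le> m" by simp
qed

lemma max_rank_le: "max_rank I \<le> m"
proof -
  have ranks: "{k. \<exists>e\<in>edges I. has_rank I e k} \<subseteq> {..m}"
    using has_rank_iff rank_bounds unfolding edges_eq edge_set_def by auto
  then have "finite {k. \<exists>e\<in>edges I. has_rank I e k}" using finite_subset by blast
  then show ?thesis using ranks unfolding max_rank_def by (subst Max_le_iff) auto
qed

lemma signature_nth:
  assumes "X \<subseteq> {..<m}" "i < max_rank I"
  shows "signature I (edge_set X) ! i = rank_count rk (Suc i) X"
proof -
  have "{j \<in> X. has_rank I (appl j, post j) (Suc i)} = {j \<in> X. rk j = Suc i}"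
    using has_rank_iff assms(1) by auto
  moreover have "{e \<in> edge_set X. has_rank I e (Suc i)} =
      (\<lambda>j. (appl j, post j)) ` {j \<in> X. has_rank I (appl j, post j) (Suc i)}"
    by (auto simp: edge_set_def)
  moreover have "inj_on (\<lambda>j. (appl j, post j)) {j \<in> X. rk j = Suc i}"
    by (rule inj_on_subset[OF inj_edge]) (use assms in auto)
  ultimately have "card {e \<in> edge_set X. has_rank I e (Suc i)} = rank_count rk (Suc i) X"
    by (simp only: card_image rank_count_def)
  then show ?thesis using assms(2) unfolding signature_def by (simp del: upt_Suc)
qed

lemma rank_maximal_edge_set:
  assumes M: "M \<subseteq> {..<m}" "feasible I (edge_set M)"
    and max: "\<And>X \<kappa>. X \<subseteq> {..<m} \<Longrightarrow> feasible I (edge_set X) \<Longrightarrow> 1 \<le> \<kappa> \<Longrightarrow> \<kappa> \<le> m \<Longrightarrow>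
      (\<And>i. 1 \<le> i \<Longrightarrow> i < \<kappa> \<Longrightarrow> rank_count rk i X = rank_count rk i M) \<Longrightarrow> rank_count rk \<kappa> X \<le> rank_count rk \<kappa> M"
  shows "rank_maximal I (edge_set M)"
  unfolding rank_maximal_def
proof (intro conjI notI; (elim exE conjE)?)
  fix M' assume feasible: "feasible I M'" and larger: "lex_larger (signature I M') (signature I (edge_set M))"
  have "M' \<subseteq> edge_set {..<m}" using feasible edges_eq by (simp add: feasible_def)
  then obtain X where X: "X \<subseteq> {..<m}" and M': "M' = edge_set X"
    unfolding edge_set_def by (meson subset_imageE)
  have length: "length (signature I Z) = max_rank I" for Z by (simp add: signature_def)
  obtain k where k: "k < max_rank I" "\<And>i. i < k \<Longrightarrow> signature I (edge_set X) ! i = signature I (edge_set M) ! i"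
    "signature I (edge_set M) ! k < signature I (edge_set X) ! k"
    using larger unfolding lex_larger_def length M' by blast
  have "rank_count rk (Suc k) X \<le> rank_count rk (Suc k) M"
  proof (rule max[OF X])
    show "feasible I (edge_set X)" using feasible M' by simp
    show "1 \<le> Suc k" "Suc k \<le> m" using k(1) max_rank_le by simp_all
    fix i assume "1 \<le> i" "i < Suc k"
    then obtain l where l: "i = Suc l" "l < k" by (cases i) auto
    then show "rank_count rk i X = rank_count rk i M"
      using k(2)[of l] k(1) signature_nth[OF X, of l] signature_nth[OF M(1), of l] by simp
  qed
  then show False using k(1,3) signature_nth[OF X] signature_nth[OF M(1)] by simp
qed (rule M(2))

end

section \<open>The algorithm\<close>

definition build_com :: com where
  "build_com =
     (''n'' ::= Add (V ''edge_count'') (Num 2);;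
      side_com ''edge_applicant'' ''edge_post'' ''tail'' ''head'' (V ''edge_count'');;
      side_com ''edge_post'' ''edge_applicant'' ''head'' ''tail'' (Add (V ''edge_count'') (Num 1)))"

definition solve_com :: com where
  "solve_com = (adj_com;; first_rank_com;; stages_com;; output_com)"

definition main_com :: com where
  "main_com = (build_com;; solve_com)"

lemma written_build [simp]: "written build_com =
    {''n'', ''tail'', ''head'', ''cap'', ''flow'', ''j'', ''parent'', ''bound'', ''c'', ''l'', ''z'',
      ''idx'', ''seen'', ''u'', ''i''}"
  by (auto simp: build_com_def)

locale applicants_built = encoded +
  fixes n1 :: nat
  assumes n1: "m + 2 \<le> n1"
begin

sublocale B: side_program s "''edge_post''" "''edge_applicant''" "''head''" "''tail''"
    "Add (V ''edge_count'') (Num 1)" n1 "m + 1"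
  using n1 by (rule post_side_program)

end

locale network_built = applicants_built +
  fixes n2 :: nat and labA labB :: "nat \<Rightarrow> class_key" and s2 :: state
  assumes A_built: "A.forest_built labA (A.keys A.ends) n1 s2"
    and B_built: "B.forest_built labB (B.keys B.ends) n2 s2"
begin

sublocale N: network m n1 n2 "s2 ''tail''" "s2 ''head''" "\<lambda>x. s2 ''cap'' x - 1" rk
proof
  show "m + 2 \<le> n1" by (rule n1)
  show "n1 \<le> n2" using B_built unfolding B.forest_built_def by blast
  show "s2 ''head'' x = x \<and> (s2 ''tail'' x = m \<or> m + 2 \<le> s2 ''tail'' x \<and> s2 ''tail'' x < x)"
    if "m + 2 \<le> x" "x < n1" for x using A.forest_built_node[OF A_built, of x] that by simp
  show "s2 ''tail'' x = x \<and> (s2 ''head'' x = m + 1 \<or> n1 \<le> s2 ''head'' x \<and> s2 ''head'' x < x)"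
    if "n1 \<le> x" "x < n2" for x using B.forest_built_node[OF B_built, of x] that by simp
  show "m + 2 \<le> s2 ''tail'' j \<and> s2 ''tail'' j < n1 \<and> n1 \<le> s2 ''head'' j \<and> s2 ''head'' j < n2" if "j < m" for j
    using A.forest_built_edge[OF A_built that] B.forest_built_edge[OF B_built that] by blast
  show "1 \<le> rk j \<and> rk j \<le> m" if "j < m" for j using rank_bounds[OF that] by blast
qed

lemma n2_le: "n2 \<le> 7 * m + 2"
  using A.forest_built_node_count[OF A_built] B.forest_built_node_count[OF B_built]
    A.card_keys_ends_le B.card_keys_ends_le by linarith

lemma tree_links_initial: "x \<in> N.tree_links \<Longrightarrow> s2 ''flow'' x = 1 \<and> 0 < s2 ''cap'' x"
  using A.forest_built_node(3,4)[OF A_built, of x] B.forest_built_node(3,4)[OF B_built, of x]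
  by (cases "x < n1") (auto simp: N.tree_links_def)

lemma class_edges_eq:
  "x \<in> {m + 2..<n1} \<Longrightarrow> N.class_edges x = A.key_edges (labA x)"
  "x \<in> {n1..<n2} \<Longrightarrow> N.class_edges x = B.key_edges (labB x)"
  using A.forest_built_edge(3)[OF A_built] B.forest_built_edge(3)[OF B_built]
    A.key_edgesD[of _ "labA x"] B.key_edgesD[of _ "labB x"]
  by (auto simp: N.class_edges_applicant N.class_edges_post)

lemma fits_iff_feasible:
  assumes X: "X \<subseteq> {..<m}"
  shows "N.fits X \<longleftrightarrow> feasible I (edge_set X)"
proof -
  have "N.tree_links = {m + 2..<n1} \<union> {n1..<n2}" using N.n1 N.n2 by (auto simp: N.tree_links_def)
  then have "N.fits X \<longleftrightarrow>
      (\<forall>x\<in>{m + 2..<n1}. card (X \<inter> A.key_edges (labA x)) \<le> s2 ''cap'' x - 1) \<and>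
      (\<forall>x\<in>{n1..<n2}. card (X \<inter> B.key_edges (labB x)) \<le> s2 ''cap'' x - 1)"
    using X class_edges_eq unfolding N.fits_def by (simp only: ball_Un cong: ball_cong) simp
  also have "\<dots> \<longleftrightarrow> (\<forall>u\<in>A.ends. vertex_fits u (A.partners_in X u)) \<and> (\<forall>u\<in>B.ends. vertex_fits u (B.partners_in X u))"
    unfolding A.forest_built_fit_iff[OF A_built] B.forest_built_fit_iff[OF B_built]
      A.keys_fit_iff[OF X] B.keys_fit_iff[OF X] vertex_fits_def ..
  also have "\<dots> \<longleftrightarrow> feasible I (edge_set X)"
    unfolding feasible_edge_set_iff[OF X] A.ends_def B.ends_def A.partners_in_def B.partners_in_def ..
  finally show ?thesis .
qed

lemma last_stage_rank_maximal:
  assumes st: "N.stage (Suc m) f cap frozen"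
  shows "rank_maximal I (edge_set (N.chosen f))"
proof (rule rank_maximal_edge_set)
  show sub: "N.chosen f \<subseteq> {..<m}" by (auto simp: N.chosen_def)
  show "feasible I (edge_set (N.chosen f))" using N.stage_fits[OF st] fits_iff_feasible[OF sub] by blast
qed (use N.last_stage_lex_maximal[OF st] fits_iff_feasible in blast)

lemma first_stage:
  assumes same: "s' ''flow'' = s2 ''flow''" "s' ''frozen'' = (\<lambda>_. 0)"
    and cap: "\<And>j. s' ''cap'' j = (if j < m \<and> rk j = 1 then 1 else s2 ''cap'' j)"
    and zero: "\<And>y. y < m + 2 \<Longrightarrow> s2 ''flow'' y = 0 \<and> s2 ''cap'' y = 0"
  shows "N.links_only (s' ''flow'') (s' ''cap'')" "N.stage 1 (s' ''flow'') (s' ''cap'') (s' ''frozen'')"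
proof -
  show "N.links_only (s' ''flow'') (s' ''cap'')"
    using zero by (auto simp: N.links_only_def N.links_def N.tree_links_def same cap)
  show "N.stage 1 (s' ''flow'') (s' ''cap'') (s' ''frozen'')"
  proof (rule N.stage_init)
    show "s' ''flow'' j = 0" if "j < m" for j using zero[of j] that same by simp
    show "s' ''flow'' x = 1" if "x \<in> N.tree_links" for x using tree_links_initial[OF that] same by simp
    show "s' ''frozen'' j = 0" for j using same by simp
    show "s' ''cap'' j = of_bool (rk j \<le> 1)" if "j < m" for j
      using cap[of j] zero[of j] rank_bounds(1)[OF that] that by auto
    show "s' ''cap'' x = s2 ''cap'' x - 1 + 1" if "x \<in> N.tree_links" for x
      using cap[of x] tree_links_initial[OF that] that by (auto simp: N.tree_links_def)
  qed
qed

lemma solve_time_le: "70 * (n2 + 1) * (n2 + 1) + (50 * (m + 1) + (3000 * (n2 + 1) * (m + 1) + 100 * (m + 1))) \<le>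
    25000 * (m + 2) * (m + 2)"
proof -
  define M where "M = m + 2"
  have n2: "n2 + 1 \<le> 7 * M" using n2_le by (simp add: M_def)
  have "70 * (n2 + 1) * (n2 + 1) \<le> 3430 * (M * M)" using mult_le_mono[OF n2 n2] by (simp add: algebra_simps)
  moreover have "(n2 + 1) * (m + 1) \<le> 7 * M * M" by (intro mult_le_mono n2) (simp add: M_def)
  then have "3000 * (n2 + 1) * (m + 1) \<le> 21000 * (M * M)" by (simp only: mult.assoc)
  moreover have "m + 1 \<le> M * M" using le_square[of "m + 2"] unfolding M_def by linarith
  then have "50 * (m + 1) + 100 * (m + 1) \<le> 150 * (M * M)" unfolding distrib_right[symmetric] by simp
  ultimately show ?thesis by (simp only: M_def[symmetric] mult.assoc)
qed

lemma runs_solve: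
  assumes inputs: "same_inputs s s2" and n: "s2 ''n'' 0 = n2"
    and zero: "\<And>y. y < m + 2 \<Longrightarrow> s2 ''flow'' y = 0 \<and> s2 ''cap'' y = 0"
    and init: "s2 ''frozen'' = (\<lambda>_. 0)" "s2 ''out_count'' 0 = 0"
  shows "runs solve_com s2 (25000 * (m + 2) * (m + 2)) (\<lambda>s'. rank_maximal I (output_edges s'))" (is "runs _ _ _ ?Q")
  unfolding solve_com_def
proof (rule runs_Seq[OF N.runs_adj[OF refl refl n] _ solve_time_le])
  have inputs2: "s2 ''edge_count'' = s ''edge_count''" "s2 ''edge_rank'' = rk" "s2 ''edge_applicant'' = appl"
    "s2 ''edge_post'' = post"
    using inputs by (simp_all add: same_inputs_def input_arrays_def)
  fix s3 assume lists: "N.incidence_lists (s3 ''start'') (s3 ''adj'')"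
    and frame3: "unchanged_except (written adj_com) s2 s3"
  show "runs (first_rank_com;; stages_com;; output_com) s3
      (50 * (m + 1) + (3000 * (n2 + 1) * (m + 1) + 100 * (m + 1))) ?Q"
  proof (rule runs_Seq[OF runs_first_rank _ order_refl])
    show "s3 ''edge_count'' 0 = m" using frame3 inputs2 by simp
    fix s4 assume cap4: "\<forall>j. s4 ''cap'' j = (if j < m \<and> s3 ''edge_rank'' j = 1 then 1 else s3 ''cap'' j)"
      and frame4: "unchanged_except (written first_rank_com) s3 s4"
    have s4: "s4 ''flow'' = s2 ''flow''" "s4 ''frozen'' = (\<lambda>_. 0)" "s4 ''edge_rank'' = rk"
      "\<And>j. s4 ''cap'' j = (if j < m \<and> rk j = 1 then 1 else s2 ''cap'' j)"
      using frame3 frame4 cap4 inputs2 init by simp_all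
    note stage = first_stage[OF s4(1,2,4) zero]
    have net: "N.network_stored s4"
      using lists frame3 frame4 inputs2 n by (simp add: N.network_stored_def)
    show "runs (stages_com;; output_com) s4 (3000 * (n2 + 1) * (m + 1) + 100 * (m + 1)) ?Q"
    proof (rule runs_Seq[OF N.runs_stages[OF net s4(3) stage] _ order_refl])
      fix s5 assume "\<exists>cap frozen. N.stage (Suc m) (s5 ''flow'') cap frozen"
        and frame5: "unchanged_except (written stages_com) s4 s5"
      then have maximal: "rank_maximal I (edge_set (N.chosen (s5 ''flow'')))" using last_stage_rank_maximal by blast
      have s5: "s5 ''edge_count'' 0 = m" "s5 ''out_count'' 0 = 0" "s5 ''edge_applicant'' = appl"
        "s5 ''edge_post'' = post"
        using frame3 frame4 frame5 inputs2 init by simp_all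
      show "runs output_com s5 (100 * (m + 1)) ?Q"
        by (rule runs_weaken[OF runs_output[where s = s5, OF s5(1,2)] order_refl])
          (use maximal in \<open>simp add: edge_set_def N.chosen_def s5\<close>)
    qed
  qed
qed

end

lemma (in applicants_built) network_built_sides:
  assumes A_built: "A.forest_built labA (A.keys A.ends) n1 s1" and B_con: "B.constructed s1 (B.keys B.ends) s2"
  shows "\<exists>labB. network_built I s es n1 (s2 ''n'' 0) labA labB s2"
proof -
  have kept: "B.lower_kept s1 s2" using B_con unfolding B.constructed_def by blast
  have "A.forest_built labA (A.keys A.ends) n1 s2"
  proof (rule A.forest_built_cong[OF A_built])
    show "s2 ''tail'' y = s1 ''tail'' y" if "y < m \<or> m + 2 \<le> y \<and> y < n1" for y
      using kept that n1 by (auto simp: B.lower_kept_def)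
    show "s2 ''head'' y = s1 ''head'' y \<and> s2 ''flow'' y = s1 ''flow'' y \<and> s2 ''cap'' y = s1 ''cap'' y"
      if "m + 2 \<le> y" "y < n1" for y using kept that by (simp add: B.lower_kept_def)
  qed
  moreover obtain labB where "B.forest_built labB (B.keys B.ends) (s2 ''n'' 0) s2"
    using B_con unfolding B.constructed_def by blast
  ultimately have "network_built I s es n1 (s2 ''n'' 0) labA labB s2" by unfold_locales
  then show ?thesis by blast
qed

context encoded
begin

lemma initially_zero: "x \<notin> input_arrays \<Longrightarrow> s x i = 0"
  using enc by (simp add: encodes_def)

lemma runs_build: "runs build_com s (1100 * (m + 2) * (m + 2))
    (\<lambda>s2. same_inputs s s2 \<and> (\<exists>n1 labA labB. network_built I s es n1 (s2 ''n'' 0) labA labB s2) \<and>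
      (\<forall>y<m + 2. s2 ''flow'' y = 0 \<and> s2 ''cap'' y = 0))" (is "runs _ _ _ ?Q")
  unfolding build_com_def
proof (rule runs_loop_free_Seq)
  let ?s0 = "effect (''n'' ::= Add (V ''edge_count'') (Num 2)) s"
  show "runs (side_com ''edge_applicant'' ''edge_post'' ''tail'' ''head'' (V ''edge_count'');;
      side_com ''edge_post'' ''edge_applicant'' ''head'' ''tail'' (Add (V ''edge_count'') (Num 1))) ?s0
      (500 * (m + 2) * (m + 2) + 500 * (m + 2) * (m + 2)) ?Q"
  proof (rule runs_Seq[OF A.runs_side _ order_refl])
    show "same_inputs s ?s0" by (simp add: same_inputs_def input_arrays_def)
    show "?s0 ''n'' 0 = m + 2" by simp
    show "?s0 ''seen'' u = 0" for u by (simp add: initially_zero input_arrays_def)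
    fix s1 assume "A.constructed ?s0 (A.keys A.ends) s1 \<and> (\<forall>u. u \<notin> A.ends \<longrightarrow> s1 ''seen'' u = ?s0 ''seen'' u)"
    then have s1: "A.constructed ?s0 (A.keys A.ends) s1" and seen1: "\<And>u. u \<notin> A.ends \<Longrightarrow> s1 ''seen'' u = ?s0 ''seen'' u"
      by blast+
    define n1 where "n1 = s1 ''n'' 0"
    obtain labA where A_built: "A.forest_built labA (A.keys A.ends) n1 s1"
      using s1 unfolding A.constructed_def n1_def by blast
    then interpret applicants_built I s es n1 by unfold_locales (simp add: A.forest_built_def)
    show "runs (side_com ''edge_post'' ''edge_applicant'' ''head'' ''tail'' (Add (V ''edge_count'') (Num 1))) s1
        (500 * (m + 2) * (m + 2)) ?Q"
    proof (rule runs_weaken[OF B.runs_side order_refl])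
      show "same_inputs s s1" using s1 by (simp add: A.constructed_def)
      show "s1 ''n'' 0 = n1" by (simp add: n1_def)
      show "s1 ''seen'' u = 0" if "u \<in> B.ends" for u
      proof -
        have "u \<notin> A.ends" using that edge_ends sides_disjoint by (fastforce simp: A.ends_def B.ends_def)
        then show ?thesis using seen1 by (simp add: initially_zero input_arrays_def)
      qed
      fix s2 assume s2: "B.constructed s1 (B.keys B.ends) s2 \<and> (\<forall>u. u \<notin> B.ends \<longrightarrow> s2 ''seen'' u = s1 ''seen'' u)"
      then have same: "same_inputs s s2" and kept: "B.lower_kept s1 s2" unfolding B.constructed_def by blast+
      have "s2 ''flow'' y = 0 \<and> s2 ''cap'' y = 0" if "y < m + 2" for y
        using s1 kept that n1 initially_zero[of "''flow''" y] initially_zero[of "''cap''" y]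
        by (simp add: A.constructed_def A.lower_kept_def B.lower_kept_def input_arrays_def)
      moreover have "\<exists>labB. network_built I s es n1 (s2 ''n'' 0) labA labB s2"
        using s2 by (blast intro: network_built_sides[OF A_built])
      ultimately show "?Q s2" using same by blast
    qed
  qed
qed (simp_all add: algebra_simps)

lemma runs_main: "runs main_com s (30000 * (m + 2) * (m + 2)) (\<lambda>s'. rank_maximal I (output_edges s'))"
  unfolding main_com_def
proof (rule runs_Seq[OF runs_build])
  fix s2 assume built: "same_inputs s s2 \<and> (\<exists>n1 labA labB. network_built I s es n1 (s2 ''n'' 0) labA labB s2) \<and>
      (\<forall>y<m + 2. s2 ''flow'' y = 0 \<and> s2 ''cap'' y = 0)" and frame: "unchanged_except (written build_com) s s2"
  then obtain n1 labA labB where "network_built I s es n1 (s2 ''n'' 0) labA labB s2" by blast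
  then interpret network_built I s es n1 "s2 ''n'' 0" labA labB s2 .
  have "s2 ''frozen'' = (\<lambda>_. 0)" "s2 ''out_count'' 0 = 0"
    using frame initially_zero by (simp_all add: input_arrays_def fun_eq_iff)
  then show "runs solve_com s2 (25000 * (m + 2) * (m + 2)) (\<lambda>s'. rank_maximal I (output_edges s'))"
    using built by (intro runs_solve) auto
qed (simp add: algebra_simps)

end

lemma encoded_exists: "valid_instance I \<Longrightarrow> encodes I s \<Longrightarrow> \<exists>es. encoded I s es"
proof -
  assume valid: "valid_instance I" and enc: "encodes I s"
  then obtain es where "distinct es" "set es = edges I" "s ''edge_count'' 0 = length es"
    "stores s ''edge_applicant'' 0 (map fst es)" "stores s ''edge_post'' 0 (map snd es)"
    "\<forall>i<length es. has_rank I (es ! i) (s ''edge_rank'' i)"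
    unfolding encodes_def by blast
  then have "encoded I s es" using valid enc by unfold_locales simp_all
  then show ?thesis ..
qed

lemma quadratic_bigo: "(\<lambda>m. real (30000 * (m + 2) * (m + 2))) \<in> O(\<lambda>m. real m ^ 2)"
proof (rule bigoI)
  have "real (30000 * (m + 2) * (m + 2)) \<le> 270000 * real m ^ 2" if "1 \<le> m" for m
  proof -
    have "(m + 2) * (m + 2) \<le> (3 * m) * (3 * m)" using that by (intro mult_le_mono) auto
    then have "30000 * (m + 2) * (m + 2) \<le> 270000 * m ^ 2" by (simp add: power2_eq_square algebra_simps)
    then have "real (30000 * (m + 2) * (m + 2)) \<le> real (270000 * m ^ 2)" by (simp only: of_nat_le_iff)
    then show ?thesis by simp
  qed
  then show "\<forall>\<^sub>F m in sequentially. norm (real (30000 * (m + 2) * (m + 2))) \<le> 270000 * norm (real m ^ 2)"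
    by (intro eventually_sequentiallyI[of 1]) simp
qed

theorem theorem1:
  shows "\<exists>(c :: com) (T :: nat \<Rightarrow> nat).
    (\<lambda>m. real (T m)) \<in> O(\<lambda>m. real m ^ 2) \<and>
    (\<forall>I s. valid_instance I \<and> encodes I s \<longrightarrow>
      (\<exists>t s'. exec c s t s' \<and> t \<le> T (card (edges I)) \<and> rank_maximal I (output_edges s')))"
proof (rule exI[of _ main_com], rule exI[of _ "\<lambda>m. 30000 * (m + 2) * (m + 2)"], intro conjI allI impI)
  show "(\<lambda>m. real (30000 * (m + 2) * (m + 2))) \<in> O(\<lambda>m. real m ^ 2)" by (rule quadratic_bigo)
next
  fix I s assume "valid_instance I \<and> encodes I s"
  then obtain es where "encoded I s es" using encoded_exists by blast
  then interpret encoded I s es .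
  show "\<exists>t s'. exec main_com s t s' \<and> t \<le> 30000 * (card (edges I) + 2) * (card (edges I) + 2) \<and>
      rank_maximal I (output_edges s')"
    using runs_main unfolding runs_def card_edges .
qed

end
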